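(* Let $p,q\in\Bbbk^\times$ and let $r,s$ be positive integers with $\gcd(r,s)=1$, $q^r=p^s$ and $pq\neq 1$, and assume that $H_{p,q}$ is not a polynomial identity ring. Then the algebra $A_p(r,s)$ is a simple noetherian domain.
   Context: $\Bbbk$ is an uncountable, algebraically closed field of characteristic zero. $H=H_{p,q}=\Bbbk\langle x,y,z\mid zx-p^{-1}xz,\ zy-pyz,\ yx-qxy-z\rangle$. Put $\Omega=(yx-p^{-1}xy)^r z^s\in H$, a central element, and define $A_p(r,s)=H/(\Omega-1)H$. *)

theory Defs
  imports
    "HOL-Algebra.Algebra"
    "HOL-Algebra.Algebraic_Closure_Type"
    "HOL-Library.Poly_Mapping"
    "HOL-Library.Countable_Set"
begin

section \<open>Free algebras\<close>

text \<open>
  Words are written additively, because the product of \<^theory>\<open>HOL-Library.Poly_Mapping\<close> is the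
  convolution product over an additive, not necessarily commutative, monoid. With this instance,
  the type \<open>'v free_monoid \<Rightarrow>\<^sub>0 'k\<close> with its \<^class>\<open>ring_1\<close> structure is the free associative
  unital algebra on the letters \<open>'v\<close>.
\<close>

datatype 'a free_monoid = Word (letters: "'a list")

instantiation free_monoid :: (type) monoid_add
begin

definition zero_free_monoid :: "'a free_monoid"
  where "0 = Word []"

definition plus_free_monoid :: "'a free_monoid \<Rightarrow> 'a free_monoid \<Rightarrow> 'a free_monoid"
  where "u + w = Word (letters u @ letters w)"

instance
  by standard (simp_all add: zero_free_monoid_def plus_free_monoid_def)

end

type_synonym ('v, 'k) free_alg = "'v free_monoid \<Rightarrow>\<^sub>0 'k"

definition gen :: "'v \<Rightarrow> ('v, 'k::ring_1) free_alg"
  where "gen v = Poly_Mapping.single (Word [v]) 1"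

definition scalar :: "'k \<Rightarrow> ('v, 'k::ring_1) free_alg"
  where "scalar c = Poly_Mapping.single 0 c"

lemma ring_ring_of_type_algebra: "ring (ring_of_type_algebra :: 'a::ring_1 ring)"
proof -
  have "\<exists>y. x + y = 0" for x :: 'a
    using add.right_inverse by blast
  then show ?thesis
    unfolding ring_of_type_algebra_def using add.right_inverse
    by unfold_locales (auto simp: algebra_simps Units_def)
qed


section \<open>Polynomial identity rings\<close>

definition nc_eval :: "('a, 'm) ring_scheme \<Rightarrow> ('v \<Rightarrow> 'a) \<Rightarrow> ('v, int) free_alg \<Rightarrow> 'a"
  where "nc_eval R \<phi> f =
    (\<Oplus>\<^bsub>R\<^esub>w\<in>Poly_Mapping.keys f.
       [Poly_Mapping.lookup f w] \<cdot>\<^bsub>R\<^esub> foldr (\<otimes>\<^bsub>R\<^esub>) (map \<phi> (letters w)) \<one>\<^bsub>R\<^esub>)"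

text \<open>
  A noncommutative polynomial is monic if at least one monomial of highest total degree in its
  support has coefficient 1 (McConnell--Robson, Brown--Goodearl). In particular it is nonzero.
\<close>

definition nc_monic :: "('v, int) free_alg \<Rightarrow> bool"
  where "nc_monic f \<longleftrightarrow>
    (\<exists>w. Poly_Mapping.lookup f w = 1 \<and>
         (\<forall>u\<in>Poly_Mapping.keys f. length (letters u) \<le> length (letters w)))"

definition PI_ring :: "('a, 'm) ring_scheme \<Rightarrow> bool"
  where "PI_ring R \<longleftrightarrow> ring R \<and>
    (\<exists>f :: (nat, int) free_alg. nc_monic f \<and>
       (\<forall>\<phi> \<in> UNIV \<rightarrow> carrier R. nc_eval R \<phi> f = \<zero>\<^bsub>R\<^esub>))"


section \<open>Simple, noetherian and integral rings without commutativity\<close>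

text \<open>
  The library locale \<^locale>\<open>domain\<close> includes commutativity, and \<^locale>\<open>noetherian_ring\<close> only
  speaks about two-sided ideals. The notions below are the usual ones for noncommutative rings.
\<close>

definition simple_ring :: "('a, 'm) ring_scheme \<Rightarrow> bool"
  where "simple_ring R \<longleftrightarrow> ring R \<and> \<one>\<^bsub>R\<^esub> \<noteq> \<zero>\<^bsub>R\<^esub> \<and>
    (\<forall>I. ideal I R \<longrightarrow> I = {\<zero>\<^bsub>R\<^esub>} \<or> I = carrier R)"

definition nc_domain :: "('a, 'm) ring_scheme \<Rightarrow> bool"
  where "nc_domain R \<longleftrightarrow> ring R \<and> \<one>\<^bsub>R\<^esub> \<noteq> \<zero>\<^bsub>R\<^esub> \<and>
    (\<forall>a\<in>carrier R. \<forall>b\<in>carrier R. a \<otimes>\<^bsub>R\<^esub> b = \<zero>\<^bsub>R\<^esub> \<longrightarrow> a = \<zero>\<^bsub>R\<^esub> \<or> b = \<zero>\<^bsub>R\<^esub>)"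

definition left_ideal :: "'a set \<Rightarrow> ('a, 'm) ring_scheme \<Rightarrow> bool"
  where "left_ideal I R \<longleftrightarrow> additive_subgroup I R \<and>
    (\<forall>a\<in>I. \<forall>x\<in>carrier R. x \<otimes>\<^bsub>R\<^esub> a \<in> I)"

definition right_ideal :: "'a set \<Rightarrow> ('a, 'm) ring_scheme \<Rightarrow> bool"
  where "right_ideal I R \<longleftrightarrow> additive_subgroup I R \<and>
    (\<forall>a\<in>I. \<forall>x\<in>carrier R. a \<otimes>\<^bsub>R\<^esub> x \<in> I)"

definition left_noetherian :: "('a, 'm) ring_scheme \<Rightarrow> bool"
  where "left_noetherian R \<longleftrightarrow> ring R \<and>
    (\<forall>I :: nat \<Rightarrow> 'a set. (\<forall>n. left_ideal (I n) R \<and> I n \<subseteq> I (Suc n)) \<longrightarrow>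
       (\<exists>N. \<forall>n\<ge>N. I n = I N))"

definition right_noetherian :: "('a, 'm) ring_scheme \<Rightarrow> bool"
  where "right_noetherian R \<longleftrightarrow> ring R \<and>
    (\<forall>I :: nat \<Rightarrow> 'a set. (\<forall>n. right_ideal (I n) R \<and> I n \<subseteq> I (Suc n)) \<longrightarrow>
       (\<exists>N. \<forall>n\<ge>N. I n = I N))"

definition nc_noetherian :: "('a, 'm) ring_scheme \<Rightarrow> bool"
  where "nc_noetherian R \<longleftrightarrow> left_noetherian R \<and> right_noetherian R"


section \<open>The algebras \<open>H\<close> and \<open>A\<close>\<close>

datatype xyz = Gen_x | Gen_y | Gen_z

abbreviation fx :: "(xyz, 'k::field) free_alg" where "fx \<equiv> gen Gen_x"
abbreviation fy :: "(xyz, 'k::field) free_alg" where "fy \<equiv> gen Gen_y"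
abbreviation fz :: "(xyz, 'k::field) free_alg" where "fz \<equiv> gen Gen_z"

definition H_relations :: "'k::field \<Rightarrow> 'k \<Rightarrow> (xyz, 'k) free_alg set"
  where "H_relations p q =
    {fz * fx - scalar (inverse p) * fx * fz,
     fz * fy - scalar p * fy * fz,
     fy * fx - scalar q * fx * fy - fz}"

definition H_ideal :: "'k::field \<Rightarrow> 'k \<Rightarrow> (xyz, 'k) free_alg set"
  where "H_ideal p q = Idl\<^bsub>ring_of_type_algebra\<^esub> (H_relations p q)"

definition H_alg :: "'k::field \<Rightarrow> 'k \<Rightarrow> (xyz, 'k) free_alg set ring"
  where "H_alg p q = ring_of_type_algebra Quot H_ideal p q"

definition Omega :: "'k::field \<Rightarrow> 'k \<Rightarrow> nat \<Rightarrow> nat \<Rightarrow> (xyz, 'k) free_alg set"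
  where "Omega p q r s =
    H_ideal p q +>\<^bsub>ring_of_type_algebra\<^esub>
      ((fy * fx - scalar (inverse p) * fx * fy) ^ r * fz ^ s)"

text \<open>
  The set that is factored out is the right ideal \<open>(\<Omega> - 1) H\<close>. It is two-sided whenever \<open>\<Omega>\<close> is
  central, for instance if \<open>p \<noteq> 0\<close> and \<open>q ^ r = p ^ s\<close>; only then is the quotient meaningful.
\<close>

definition A_alg :: "'k::field \<Rightarrow> 'k \<Rightarrow> nat \<Rightarrow> nat \<Rightarrow> (xyz, 'k) free_alg set set ring"
  where "A_alg p q r s =
    H_alg p q Quot
      ((Omega p q r s \<ominus>\<^bsub>H_alg p q\<^esub> \<one>\<^bsub>H_alg p q\<^esub>) <#\<^bsub>H_alg p q\<^esub> carrier (H_alg p q))"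

lemma ideal_H_ideal: "ideal (H_ideal p q) (ring_of_type_algebra :: (xyz, 'k::field) free_alg ring)"
  unfolding H_ideal_def
  by (rule ring.genideal_ideal[OF ring_ring_of_type_algebra])
     (simp add: ring_of_type_algebra_def)

lemma ring_H_alg: "ring (H_alg p q)"
  unfolding H_alg_def by (rule ideal.quotient_is_ring[OF ideal_H_ideal])

end

theory Submission
  imports Defs "HOL-Combinatorics.Permutations" "HOL-Computational_Algebra.Polynomial"
begin

text \<open>
  Put \<open>w = y x - p\<inverse> x y\<close>. In \<open>H\<close> the elements \<open>z\<close> and \<open>w\<close> commute with each other, they commute with
  \<open>x\<close> and \<open>y\<close> up to scalars, and since \<open>p q \<noteq> 1\<close> both \<open>x y\<close> and \<open>y x\<close> are linear combinations of \<open>w\<close> and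
  \<open>z\<close>. So \<open>H\<close> is a generalized Weyl algebra over \<open>k[z, w]\<close>, spanned by the monomials
  \<open>z^i w^j x^n\<close> and \<open>z^i w^j y^n\<close> (\<open>normal_UNIV\<close>), and \<open>\<Omega> = w^r z^s\<close>. In \<open>A\<close>, where \<open>\<Omega> = 1\<close>, the
  coprimality of \<open>r\<close> and \<open>s\<close> identifies the subring generated by \<open>z\<close> and \<open>w\<close> with Laurent polynomials in
  one variable \<open>t\<close>, where \<open>z = t^r\<close> and \<open>w = t^(-s)\<close>.

  Not being a polynomial identity ring enters only through the fact that \<open>p\<close> is not a root of unity.
  Otherwise \<open>q\<close> is one too, \<open>H\<close> is spanned by finitely many elements over its centre, and a
  standard identity holds (\<open>standard_identity_root_of_unity\<close>).

  Simplicity (\<open>weyl_torus_simple\<close>): commutation with \<open>z\<close> and with \<open>x\<close> or \<open>y\<close> scales the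
  monomials \<open>t^e x^n\<close> and \<open>t^e y^n\<close> by scalars that separate them, so a nonzero ideal contains a power
  of \<open>x\<close> or of \<open>y\<close>. Multiplying \<open>x^n\<close> by \<open>y\<close> from both sides gives two independent combinations of
  \<open>w x^(n-1)\<close> and \<open>z x^(n-1)\<close>, because \<open>(p q)^n \<noteq> 1\<close>; hence \<open>x^(n-1)\<close> is in the ideal, and
  finally \<open>1\<close> is.

  Domain: \<open>A\<close> acts on sequences by difference operators, with \<open>x\<close> as the dilation of \<open>t\<close>. By
  simplicity the action is faithful, and its existence shows that \<open>1 \<noteq> 0\<close> in \<open>A\<close>. The
  operators are finite sums of shifts whose coefficients vanish identically or are eventually
  nonzero, so leading terms show that products of nonzero operators are nonzero (\<open>act_domain\<close>).

  Noetherianity is the Hilbert basis theorem for adjoining \<open>z\<close>, \<open>x\<close> and \<open>y\<close> one after the other to the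
  field (\<open>acc_over_extension\<close>). It applies to the quotient \<open>A\<close> directly, since the leading
  coefficients of all polynomial expressions of an element are considered.

  All of this is carried out in the free algebra modulo two-sided ideals, and transferred to the
  iterated quotient at the end (\<open>quotient_map\<close>).
\<close>

section \<open>Congruence modulo a two-sided ideal\<close>

text \<open>
  The quotient \<open>H\<close> and its quotient \<open>A\<close> have sets, and sets of sets, as elements. Computing with
  representatives in the free algebra, up to congruence modulo a two-sided ideal, keeps ordinary
  ring arithmetic available, and lets one calculation serve \<open>H\<close>, \<open>A\<close> and every quotient of \<open>A\<close>.
\<close>

locale two_sided =
  fixes K :: "'a::ring_1 set"
  assumes zero_mem: "0 \<in> K"
    and add_mem: "a \<in> K \<Longrightarrow> b \<in> K \<Longrightarrow> a + b \<in> K"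
    and lmult_mem: "a \<in> K \<Longrightarrow> b * a \<in> K"
    and rmult_mem: "a \<in> K \<Longrightarrow> a * b \<in> K"
begin

lemma uminus_mem: "a \<in> K \<Longrightarrow> - a \<in> K"
  using lmult_mem[of a "- 1"] by simp

lemma diff_mem: "a \<in> K \<Longrightarrow> b \<in> K \<Longrightarrow> a - b \<in> K"
  using add_mem[of a "- b"] uminus_mem by simp

lemma sum_mem: "(\<And>i. i \<in> S \<Longrightarrow> f i \<in> K) \<Longrightarrow> sum f S \<in> K"
  by (induction S rule: infinite_finite_induct) (auto intro: zero_mem add_mem)

definition eqv :: "'a \<Rightarrow> 'a \<Rightarrow> bool" (infix "\<doteq>" 50)
  where "a \<doteq> b \<longleftrightarrow> a - b \<in> K"

lemma eqv_refl [simp, intro]: "a \<doteq> a"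
  by (simp add: eqv_def zero_mem)

lemma eqv_sym: "a \<doteq> b \<Longrightarrow> b \<doteq> a"
  using uminus_mem[of "a - b"] by (simp add: eqv_def)

lemma eqv_trans [trans]: "a \<doteq> b \<Longrightarrow> b \<doteq> c \<Longrightarrow> a \<doteq> c"
  using add_mem[of "a - b" "b - c"] by (simp add: eqv_def)

lemma eqv_add: "a \<doteq> b \<Longrightarrow> c \<doteq> d \<Longrightarrow> a + c \<doteq> b + d"
  using add_mem[of "a - b" "c - d"] by (simp add: eqv_def algebra_simps)

lemma eqv_diff: "a \<doteq> b \<Longrightarrow> c \<doteq> d \<Longrightarrow> a - c \<doteq> b - d"
  using diff_mem[of "a - b" "c - d"] by (simp add: eqv_def algebra_simps)

lemma eqv_mult: "a \<doteq> b \<Longrightarrow> c \<doteq> d \<Longrightarrow> a * c \<doteq> b * d"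
  using add_mem[OF rmult_mem[of "a - b" c] lmult_mem[of "c - d" b]]
  by (simp add: eqv_def algebra_simps)

lemma eqv_multL: "c \<doteq> d \<Longrightarrow> a * c \<doteq> a * d"
  by (rule eqv_mult) auto

lemma eqv_multR: "a \<doteq> b \<Longrightarrow> a * c \<doteq> b * c"
  by (rule eqv_mult) auto

lemma eqv_sum: "(\<And>i. i \<in> S \<Longrightarrow> f i \<doteq> g i) \<Longrightarrow> sum f S \<doteq> sum g S"
  by (induction S rule: infinite_finite_induct) (auto intro: eqv_add)

lemma eqv_prod_list: "(\<And>i. i \<in> set xs \<Longrightarrow> f i \<doteq> g i) \<Longrightarrow> prod_list (map f xs) \<doteq> prod_list (map g xs)"
  by (induction xs) (auto intro: eqv_mult)

lemma eqv_mem: "a \<doteq> b \<Longrightarrow> b \<in> K \<Longrightarrow> a \<in> K"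
  using add_mem[of "a - b" b] by (simp add: eqv_def)

lemma eqv_mem_iff: "a \<doteq> b \<Longrightarrow> a \<in> K \<longleftrightarrow> b \<in> K"
  using eqv_mem eqv_sym by blast

end

section \<open>Scalars and induction in a free algebra\<close>

definition smul :: "'k::comm_ring_1 \<Rightarrow> ('v, 'k) free_alg \<Rightarrow> ('v, 'k) free_alg" (infixr "\<bullet>" 75)
  where "c \<bullet> f = scalar c * f"

lemma lookup_smul [simp]: "Poly_Mapping.lookup (c \<bullet> f) w = c * Poly_Mapping.lookup f w"
  unfolding smul_def scalar_def mult_map_scale_conv_mult[symmetric]
  by (simp add: Poly_Mapping.map.rep_eq when_def)

lemma smul_add: "c \<bullet> (f + g) = c \<bullet> f + c \<bullet> g"
  by (simp add: smul_def distrib_left)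

lemma smul_diff: "c \<bullet> (f - g) = c \<bullet> f - c \<bullet> g"
  by (simp add: smul_def right_diff_distrib)

lemma add_smul: "(c + d) \<bullet> f = c \<bullet> f + d \<bullet> f"
  by (rule poly_mapping_eqI) (simp add: lookup_add algebra_simps)

lemma diff_smul: "(c - d) \<bullet> f = c \<bullet> f - d \<bullet> f"
  by (rule poly_mapping_eqI) (simp add: lookup_minus algebra_simps)

lemma smul_smul [simp]: "c \<bullet> d \<bullet> f = (c * d) \<bullet> f"
  by (rule poly_mapping_eqI) (simp add: algebra_simps)

lemma one_smul [simp]: "1 \<bullet> f = f"
  by (rule poly_mapping_eqI) simp

lemma zero_smul [simp]: "0 \<bullet> f = 0"
  by (rule poly_mapping_eqI) simp

lemma smul_zero [simp]: "c \<bullet> 0 = 0"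
  by (rule poly_mapping_eqI) simp

lemma minus_smul: "- (c \<bullet> f) = (- c) \<bullet> f"
  by (rule poly_mapping_eqI) simp

lemma smul_mult_left [simp]: "(c \<bullet> f) * g = c \<bullet> (f * g)"
  by (simp add: smul_def mult.assoc)

lemma smul_sum: "c \<bullet> sum f S = (\<Sum>i\<in>S. c \<bullet> f i)"
  by (simp add: smul_def sum_distrib_left)

lemma poly_mapping_sum_single:
  "f = (\<Sum>w\<in>Poly_Mapping.keys f. Poly_Mapping.single w (Poly_Mapping.lookup f w))"
  by (rule poly_mapping_eqI)
    (simp add: lookup_sum lookup_single when_def in_keys_iff)

lemma gen_mult_single: "gen v * Poly_Mapping.single w c = Poly_Mapping.single (Word (v # letters w)) c"
  by (simp add: gen_def mult_single plus_free_monoid_def)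

lemma single_Nil: "Poly_Mapping.single (Word []) c = c \<bullet> 1"
  by (simp add: smul_def scalar_def zero_free_monoid_def)

text \<open>
  Left multiplication by letters is enough to build a word, so a property is only ever tested
  against one new letter at the left end.
\<close>

lemma free_alg_induct [case_names one gen smul add]:
  fixes f :: "('v, 'k::comm_ring_1) free_alg"
  assumes one: "P 1"
    and gen: "\<And>v f. P f \<Longrightarrow> P (gen v * f)"
    and smul: "\<And>c f. P f \<Longrightarrow> P (c \<bullet> f)"
    and add: "\<And>f g. P f \<Longrightarrow> P g \<Longrightarrow> P (f + g)"
  shows "P f"
proof -
  have single: "P (Poly_Mapping.single (Word u) c)" for u and c :: 'k
  proof (induction u)
    case Nil
    then show ?case using smul[OF one] by (simp add: single_Nil)
  next
    case (Cons v u)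
    then show ?case using gen[of "Poly_Mapping.single (Word u) c" v] by (simp add: gen_mult_single)
  qed
  have "P 0" using smul[OF one, of 0] by simp
  then have "P (\<Sum>w\<in>S. Poly_Mapping.single w (Poly_Mapping.lookup f w))" for S
    by (induction S rule: infinite_finite_induct) (auto intro: add, metis add single free_monoid.collapse)
  then show ?thesis by (metis poly_mapping_sum_single)
qed

text \<open>
  With this rule and \<open>smul_mult_left\<close> the simplifier collects all scalars at the front of a product.
\<close>

lemma mult_smul [simp]: "f * (c \<bullet> g) = c \<bullet> (f * g)"
  for f :: "('v, 'k::comm_ring_1) free_alg"
proof -
  have "f * (c \<bullet> 1) = c \<bullet> f"
  proof (induction f rule: free_alg_induct)
    case (gen v f)
    have "gen v * (c \<bullet> f) = c \<bullet> (gen v * f)"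
    proof -
      have "gen v * Poly_Mapping.single 0 c = Poly_Mapping.single 0 c * gen v"
        by (simp add: gen_def mult_single)
      then show ?thesis by (simp add: smul_def scalar_def flip: mult.assoc)
    qed
    with gen show ?case by (simp add: mult.assoc)
  qed (auto simp: smul_add algebra_simps)
  then have "f * (c \<bullet> 1) * g = (c \<bullet> f) * g" by simp
  then show ?thesis by (simp add: mult.assoc)
qed

locale two_sided_alg = two_sided K for K :: "('v, 'k::field) free_alg set"
begin

lemma smul_mem: "a \<in> K \<Longrightarrow> c \<bullet> a \<in> K"
  by (simp add: smul_def lmult_mem)

lemma smul_mem_iff: "c \<noteq> 0 \<Longrightarrow> c \<bullet> a \<in> K \<longleftrightarrow> a \<in> K"
  using smul_mem[of "c \<bullet> a" "inverse c"] smul_mem[of a c] by auto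

lemma eqv_smul: "a \<doteq> b \<Longrightarrow> c \<bullet> a \<doteq> c \<bullet> b"
  by (simp add: smul_def eqv_multL)

lemma qcommute_flip: "a * b \<doteq> c \<bullet> (b * a) \<Longrightarrow> c \<noteq> 0 \<Longrightarrow> b * a \<doteq> inverse c \<bullet> (a * b)"
  using eqv_sym[OF eqv_smul[of "a * b" "c \<bullet> (b * a)" "inverse c"]] by simp

text \<open>
  Elements that commute up to a scalar are the basic currency of quantum algebras. The scalars
  multiply when the elements do, so commutation with products and powers follows from commutation
  with the factors.
\<close>

lemma qcommute_mult_right:
  assumes "a * b \<doteq> c \<bullet> (b * a)" "a * b' \<doteq> d \<bullet> (b' * a)"
  shows "a * (b * b') \<doteq> (c * d) \<bullet> (b * b' * a)"
proof -
  have "a * (b * b') = a * b * b'" by (simp add: mult.assoc)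
  also have "\<dots> \<doteq> (c \<bullet> (b * a)) * b'" by (rule eqv_multR[OF assms(1)])
  also have "(c \<bullet> (b * a)) * b' = c \<bullet> (b * (a * b'))" by (simp add: mult.assoc)
  also have "\<dots> \<doteq> c \<bullet> (b * (d \<bullet> (b' * a)))" by (intro eqv_smul eqv_multL assms)
  finally show ?thesis by (simp add: mult.assoc)
qed

lemma qcommute_mult_left:
  assumes "a * b \<doteq> c \<bullet> (b * a)" "a' * b \<doteq> d \<bullet> (b * a')"
  shows "a * a' * b \<doteq> (c * d) \<bullet> (b * (a * a'))"
proof -
  have "a * a' * b = a * (a' * b)" by (simp add: mult.assoc)
  also have "\<dots> \<doteq> a * (d \<bullet> (b * a'))" by (rule eqv_multL[OF assms(2)])
  also have "a * (d \<bullet> (b * a')) = d \<bullet> (a * b * a')" by (simp add: mult.assoc)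
  also have "\<dots> \<doteq> d \<bullet> ((c \<bullet> (b * a)) * a')" by (intro eqv_smul eqv_multR assms)
  finally show ?thesis by (simp add: mult.assoc mult.commute)
qed

lemma qcommute_power_right: "a * b \<doteq> c \<bullet> (b * a) \<Longrightarrow> a * b ^ n \<doteq> c ^ n \<bullet> (b ^ n * a)"
  by (induction n) (auto dest: qcommute_mult_right)

lemma qcommute_power_left: "a * b \<doteq> c \<bullet> (b * a) \<Longrightarrow> a ^ n * b \<doteq> c ^ n \<bullet> (b * a ^ n)"
  by (induction n) (auto dest: qcommute_mult_left)

end

section \<open>The generalized Weyl algebra relations\<close>

text \<open>
  Any two-sided ideal that contains the defining relations is allowed here: the ideal that defines
  \<open>H\<close>, the one that defines \<open>A\<close>, and in the proof of simplicity an arbitrary larger one.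
\<close>

locale weyl_relations = two_sided_alg K for K :: "(xyz, 'k::field) free_alg set" +
  fixes p q :: 'k
  assumes p0: "p \<noteq> 0" and q0: "q \<noteq> 0" and pq: "p * q \<noteq> 1"
    and relations: "H_relations p q \<subseteq> K"
begin

abbreviation x where "x \<equiv> fx :: (xyz, 'k) free_alg"
abbreviation y where "y \<equiv> fy :: (xyz, 'k) free_alg"
abbreviation z where "z \<equiv> fz :: (xyz, 'k) free_alg"

text \<open>
  The second normal element besides \<open>z\<close>. The products \<open>x * y\<close> and \<open>y * x\<close> are linear combinations
  of \<open>w\<close> and \<open>z\<close>, so \<open>w\<close> replaces the relation between \<open>x\<close> and \<open>y\<close> by relations
  between \<open>w\<close>, \<open>z\<close> and each of \<open>x\<close> and \<open>y\<close>.
\<close>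

definition w :: "(xyz, 'k) free_alg"
  where "w = y * x - inverse p \<bullet> (x * y)"

definition g :: 'k
  where "g = inverse (q - inverse p)"

lemma g_denom: "q - inverse p \<noteq> 0"
  using pq p0 by (auto simp: field_simps)

lemma g0: "g \<noteq> 0"
  using g_denom by (simp add: g_def)

lemma rel_zx: "z * x - inverse p \<bullet> (x * z) \<in> K"
  and rel_zy: "z * y - p \<bullet> (y * z) \<in> K"
  and rel_yx: "y * x - q \<bullet> (x * y) - z \<in> K"
  using relations by (auto simp: H_relations_def smul_def mult.assoc)

lemma zx: "z * x \<doteq> inverse p \<bullet> (x * z)"
  and zy: "z * y \<doteq> p \<bullet> (y * z)"
  using rel_zx rel_zy by (simp_all add: eqv_def)

lemma xz: "x * z \<doteq> p \<bullet> (z * x)"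
  and yz: "y * z \<doteq> inverse p \<bullet> (z * y)"
  using qcommute_flip[OF zx] qcommute_flip[OF zy] p0 by simp_all

lemma wx: "w * x \<doteq> q \<bullet> (x * w)"
proof -
  define \<rho> where "\<rho> = y * x - q \<bullet> (x * y) - z"
  have \<rho>: "\<rho> \<in> K" using rel_yx by (simp add: \<rho>_def)
  \<comment> \<open>Both sides expand to the same element of the free algebra; the right-hand side exhibits it in the ideal.\<close>
  have "w * x - q \<bullet> (x * w) = \<rho> * x - inverse p \<bullet> (x * \<rho>) + (z * x - inverse p \<bullet> (x * z))"
    by (simp add: w_def \<rho>_def algebra_simps smul_diff smul_add)
  moreover have "\<dots> \<in> K"
    by (rule add_mem[OF diff_mem[OF rmult_mem[OF \<rho>] smul_mem[OF lmult_mem[OF \<rho>]]] rel_zx])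
  ultimately show ?thesis by (simp add: eqv_def)
qed

lemma yw: "y * w \<doteq> q \<bullet> (w * y)"
proof -
  define \<rho> where "\<rho> = y * x - q \<bullet> (x * y) - z"
  have \<rho>: "\<rho> \<in> K" using rel_yx by (simp add: \<rho>_def)
  have "y * w - q \<bullet> (w * y) =
      y * \<rho> - inverse p \<bullet> (\<rho> * y) - inverse p \<bullet> (z * y - p \<bullet> (y * z))"
    using p0 by (simp add: w_def \<rho>_def algebra_simps smul_diff smul_add)
  moreover have "\<dots> \<in> K"
    by (rule diff_mem[OF diff_mem[OF lmult_mem[OF \<rho>] smul_mem[OF rmult_mem[OF \<rho>]]] smul_mem[OF rel_zy]])
  ultimately show ?thesis by (simp add: eqv_def)
qed

lemma xw: "x * w \<doteq> inverse q \<bullet> (w * x)"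
  and wy: "w * y \<doteq> inverse q \<bullet> (y * w)"
  using qcommute_flip[OF wx] qcommute_flip[OF yw] q0 by simp_all

lemma zw: "z * w \<doteq> w * z"
proof -
  have yx: "z * (y * x) \<doteq> y * x * z"
    using qcommute_mult_right[OF zy zx] p0 by simp
  have xy: "z * (x * y) \<doteq> x * y * z"
    using qcommute_mult_right[OF zx zy] p0 by simp
  show ?thesis
    using eqv_diff[OF yx eqv_smul[OF xy, of "inverse p"]]
    by (simp add: w_def algebra_simps)
qed

lemma wz: "w * z \<doteq> z * w"
  by (rule eqv_sym[OF zw])

text \<open>
  Since \<open>w = (q - inverse p) \<bullet> (x * y) + z\<close> modulo the relations, \<open>p * q \<noteq> 1\<close> is exactly what is
  needed to solve for \<open>x * y\<close>.
\<close>

lemma xy: "x * y \<doteq> g \<bullet> (w - z)"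
proof -
  have "x * y - g \<bullet> (w - z) = (- g) \<bullet> (y * x - q \<bullet> (x * y) - z)"
  proof (rule poly_mapping_eqI)
    fix u
    show "Poly_Mapping.lookup (x * y - g \<bullet> (w - z)) u =
      Poly_Mapping.lookup ((- g) \<bullet> (y * x - q \<bullet> (x * y) - z)) u"
      unfolding w_def lookup_minus lookup_smul g_def
      using g_denom p0 by (simp add: divide_simps) (simp add: algebra_simps)
  qed
  with rel_yx show ?thesis by (simp add: eqv_def smul_mem)
qed

lemma yx: "y * x \<doteq> g \<bullet> (q \<bullet> w - inverse p \<bullet> z)"
proof -
  have "y * x - g \<bullet> (q \<bullet> w - inverse p \<bullet> z) = (- g * inverse p) \<bullet> (y * x - q \<bullet> (x * y) - z)"
  proof (rule poly_mapping_eqI)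
    fix u
    show "Poly_Mapping.lookup (y * x - g \<bullet> (q \<bullet> w - inverse p \<bullet> z)) u =
      Poly_Mapping.lookup ((- g * inverse p) \<bullet> (y * x - q \<bullet> (x * y) - z)) u"
      unfolding w_def lookup_minus lookup_smul g_def
      using g_denom p0 by (simp add: divide_simps) (simp add: algebra_simps)
  qed
  with rel_yx show ?thesis by (simp add: eqv_def smul_mem)
qed

lemma x_zw: "x * (z ^ i * w ^ j) \<doteq> (p ^ i * inverse q ^ j) \<bullet> (z ^ i * w ^ j * x)"
  by (intro qcommute_mult_right qcommute_power_right xz xw)

lemma y_zw: "y * (z ^ i * w ^ j) \<doteq> (inverse p ^ i * q ^ j) \<bullet> (z ^ i * w ^ j * y)"
  by (intro qcommute_mult_right qcommute_power_right yz yw)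

lemma z_zw: "z * (z ^ i * w ^ j) \<doteq> z ^ i * w ^ j * z"
  using qcommute_mult_right[of z "z ^ i" 1 "w ^ j" 1] qcommute_power_right[of z w 1 j] zw
  by (simp add: power_commutes)

lemma w_zpow: "w * z ^ i \<doteq> z ^ i * w"
  using qcommute_power_right[of w z 1 i] wz by simp

lemma wpow_zpow: "w ^ j * z ^ i \<doteq> z ^ i * w ^ j"
  using qcommute_power_left[of w "z ^ i" 1 j] w_zpow by simp

text \<open>
  The span of the monomials \<open>z^i w^j x^n\<close> and \<open>z^i w^j y^n\<close> modulo the ideal. It is
  the whole algebra because it contains \<open>1\<close> and is stable under left multiplication by each
  generator: \<open>x\<close> and \<open>y\<close> move past \<open>z\<close> and \<open>w\<close> up to scalars, and when an \<open>x\<close> meets a \<open>y\<close> the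
  product turns into a combination of \<open>w\<close> and \<open>z\<close>.
\<close>

inductive_set normal_span :: "(xyz, 'k) free_alg set" where
  normal_x: "c \<bullet> (z ^ i * w ^ j * x ^ n) \<in> normal_span"
| normal_y: "c \<bullet> (z ^ i * w ^ j * y ^ n) \<in> normal_span"
| normal_add: "a \<in> normal_span \<Longrightarrow> b \<in> normal_span \<Longrightarrow> a + b \<in> normal_span"
| normal_eqv: "a \<in> normal_span \<Longrightarrow> a \<doteq> b \<Longrightarrow> b \<in> normal_span"

lemma normal_smul: "a \<in> normal_span \<Longrightarrow> c \<bullet> a \<in> normal_span"
  by (induction rule: normal_span.induct)
    (auto simp: smul_add intro: normal_x normal_y normal_add normal_eqv eqv_smul)

lemma normal_diff: "a \<in> normal_span \<Longrightarrow> b \<in> normal_span \<Longrightarrow> a - b \<in> normal_span"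
  using normal_add[of a "(- 1) \<bullet> b"] normal_smul[of b "- 1"]
  by (simp flip: minus_smul)

lemma normal_z: "a \<in> normal_span \<Longrightarrow> z * a \<in> normal_span"
proof (induction rule: normal_span.induct)
  case (normal_x c i j n)
  show ?case using normal_span.normal_x[of c "Suc i" j n] by (simp add: mult.assoc)
next
  case (normal_y c i j n)
  show ?case using normal_span.normal_y[of c "Suc i" j n] by (simp add: mult.assoc)
qed (auto simp: distrib_left intro: normal_add normal_eqv eqv_multL)

lemma zw_wz: "z ^ i * w ^ j * (c \<bullet> w - d \<bullet> z) \<doteq> c \<bullet> (z ^ i * w ^ Suc j) - d \<bullet> (z ^ Suc i * w ^ j)"
proof -
  have "z ^ i * w ^ j * z \<doteq> z ^ Suc i * w ^ j"
    using eqv_sym[OF z_zw[of i j]] by (simp add: mult.assoc)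
  then show ?thesis
    using eqv_diff[OF eqv_refl eqv_smul, of "z ^ i * w ^ j * z" "z ^ Suc i * w ^ j" "c \<bullet> (z ^ i * w ^ Suc j)" d]
    by (simp add: right_diff_distrib mult.assoc power_commutes)
qed

lemma drop_y: "z ^ i * w ^ j * (x * y ^ Suc n) \<doteq>
    g \<bullet> (z ^ i * w ^ Suc j * y ^ n - z ^ Suc i * w ^ j * y ^ n)"
proof -
  have "z ^ i * w ^ j * (x * y) \<doteq> z ^ i * w ^ j * (g \<bullet> (w - z))"
    by (intro eqv_multL xy)
  also have "z ^ i * w ^ j * (g \<bullet> (w - z)) = g \<bullet> (z ^ i * w ^ j * (1 \<bullet> w - 1 \<bullet> z))" by simp
  also have "\<dots> \<doteq> g \<bullet> (1 \<bullet> (z ^ i * w ^ Suc j) - 1 \<bullet> (z ^ Suc i * w ^ j))"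
    by (intro eqv_smul zw_wz)
  finally have "z ^ i * w ^ j * (x * y) \<doteq> \<dots>" .
  from eqv_multR[OF this, of "y ^ n"] show ?thesis
    by (simp only: mult.assoc left_diff_distrib smul_mult_left one_smul power_Suc)
qed

lemma drop_x: "z ^ i * w ^ j * (y * x ^ Suc n) \<doteq>
    g \<bullet> (q \<bullet> (z ^ i * w ^ Suc j * x ^ n) - inverse p \<bullet> (z ^ Suc i * w ^ j * x ^ n))"
proof -
  have "z ^ i * w ^ j * (y * x) \<doteq> z ^ i * w ^ j * (g \<bullet> (q \<bullet> w - inverse p \<bullet> z))"
    by (intro eqv_multL yx)
  also have "\<dots> = g \<bullet> (z ^ i * w ^ j * (q \<bullet> w - inverse p \<bullet> z))" by simp
  also have "\<dots> \<doteq> g \<bullet> (q \<bullet> (z ^ i * w ^ Suc j) - inverse p \<bullet> (z ^ Suc i * w ^ j))"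
    by (intro eqv_smul zw_wz)
  finally have "z ^ i * w ^ j * (y * x) \<doteq> \<dots>" .
  from eqv_multR[OF this, of "x ^ n"] show ?thesis
    by (simp only: mult.assoc left_diff_distrib smul_mult_left one_smul power_Suc)
qed

lemma normal_x_mult: "a \<in> normal_span \<Longrightarrow> x * a \<in> normal_span"
proof (induction rule: normal_span.induct)
  case (normal_x c i j n)
  have "x * (z ^ i * w ^ j) * x ^ n \<doteq> ((p ^ i * inverse q ^ j) \<bullet> (z ^ i * w ^ j * x)) * x ^ n"
    by (intro eqv_multR x_zw)
  from normal_eqv[OF _ eqv_sym[OF eqv_smul[OF this, of c]]] show ?case
    using normal_span.normal_x[of "c * (p ^ i * inverse q ^ j)" i j "Suc n"] by (simp add: mult.assoc)
next
  case (normal_y c i j n)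
  have *: "x * (z ^ i * w ^ j) * y ^ n \<doteq> ((p ^ i * inverse q ^ j) \<bullet> (z ^ i * w ^ j * x)) * y ^ n"
    by (intro eqv_multR x_zw)
  have "z ^ i * w ^ j * (x * y ^ n) \<in> normal_span"
  proof (cases n)
    case 0
    then show ?thesis using normal_span.normal_x[of 1 i j 1] by simp
  next
    case (Suc m)
    have "g \<bullet> (1 \<bullet> (z ^ i * w ^ Suc j * y ^ m) - 1 \<bullet> (z ^ Suc i * w ^ j * y ^ m)) \<in> normal_span"
      by (intro normal_smul normal_diff normal_span.normal_y)
    then show ?thesis using normal_eqv[OF _ eqv_sym[OF drop_y]] Suc by simp
  qed
  from normal_smul[OF this, of "c * (p ^ i * inverse q ^ j)"] show ?case
    using normal_eqv[OF _ eqv_sym[OF eqv_smul[OF *, of c]]] by (simp add: mult.assoc)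
qed (auto simp: distrib_left intro: normal_add normal_eqv eqv_multL)

lemma normal_y_mult: "a \<in> normal_span \<Longrightarrow> y * a \<in> normal_span"
proof (induction rule: normal_span.induct)
  case (normal_y c i j n)
  have "y * (z ^ i * w ^ j) * y ^ n \<doteq> ((inverse p ^ i * q ^ j) \<bullet> (z ^ i * w ^ j * y)) * y ^ n"
    by (intro eqv_multR y_zw)
  from normal_eqv[OF _ eqv_sym[OF eqv_smul[OF this, of c]]] show ?case
    using normal_span.normal_y[of "c * (inverse p ^ i * q ^ j)" i j "Suc n"] by (simp add: mult.assoc)
next
  case (normal_x c i j n)
  have *: "y * (z ^ i * w ^ j) * x ^ n \<doteq> ((inverse p ^ i * q ^ j) \<bullet> (z ^ i * w ^ j * y)) * x ^ n"
    by (intro eqv_multR y_zw)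
  have "z ^ i * w ^ j * (y * x ^ n) \<in> normal_span"
  proof (cases n)
    case 0
    then show ?thesis using normal_span.normal_y[of 1 i j 1] by simp
  next
    case (Suc m)
    have "g \<bullet> (q \<bullet> (z ^ i * w ^ Suc j * x ^ m) - inverse p \<bullet> (z ^ Suc i * w ^ j * x ^ m)) \<in> normal_span"
      unfolding smul_diff smul_smul
      by (intro normal_diff normal_span.normal_x)
    then show ?thesis using normal_eqv[OF _ eqv_sym[OF drop_x]] Suc by simp
  qed
  from normal_smul[OF this, of "c * (inverse p ^ i * q ^ j)"] show ?case
    using normal_eqv[OF _ eqv_sym[OF eqv_smul[OF *, of c]]] by (simp add: mult.assoc)
qed (auto simp: distrib_left intro: normal_add normal_eqv eqv_multL)

lemma normal_UNIV: "a \<in> normal_span"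
proof (induction a rule: free_alg_induct)
  case one
  show ?case using normal_x[of 1 0 0 0] by simp
next
  case (gen v f)
  then show ?case by (cases v) (auto intro: normal_x_mult normal_y_mult normal_z)
qed (auto intro: normal_smul normal_add)

end

section \<open>Simplicity\<close>

text \<open>
  If \<open>u\<close> scales each \<open>f i\<close> under commutation by a different factor, then \<open>f i\<close> is an eigenvector for
  the eigenvalue \<open>c i\<close>, and an ideal that contains a sum of eigenvectors contains its components. The
  component for \<open>c m\<close> is eliminated by \<open>u * f - c m \<bullet> (f * u)\<close>, which costs one factor \<open>u\<close> on the
  right each time.
\<close>

context two_sided_alg
begin

lemma eigen_components:
  assumes "finite S" "(\<Sum>i\<in>S. f i) \<in> K"
    and "\<And>i. i \<in> S \<Longrightarrow> u * f i \<doteq> c i \<bullet> (f i * u)"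
    and "inj_on c S"
  shows "\<exists>k. \<forall>i\<in>S. f i * u ^ k \<in> K"
  using assms
proof (induction S arbitrary: f rule: finite_induct)
  case (insert m S)
  have "u * (\<Sum>i\<in>insert m S. f i) - (c m \<bullet> (\<Sum>i\<in>insert m S. f i)) * u \<in> K"
    by (intro diff_mem lmult_mem rmult_mem smul_mem insert.prems)
  moreover have "u * (\<Sum>i\<in>insert m S. f i) - (c m \<bullet> (\<Sum>i\<in>insert m S. f i)) * u
      = (\<Sum>i\<in>insert m S. u * f i - c m \<bullet> (f i * u))"
    by (simp only: sum_distrib_left sum_distrib_right smul_sum sum_subtractf smul_mult_left)
  moreover have "(\<Sum>i\<in>insert m S. u * f i - c m \<bullet> (f i * u)) \<doteq> (\<Sum>i\<in>insert m S. (c i - c m) \<bullet> (f i * u))"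
    unfolding diff_smul using insert.prems(2) by (intro eqv_sum eqv_diff) auto
  ultimately have "(\<Sum>i\<in>insert m S. (c i - c m) \<bullet> (f i * u)) \<in> K"
    using eqv_mem_iff by simp
  then have "(\<Sum>i\<in>S. (c i - c m) \<bullet> (f i * u)) \<in> K"
    using insert.hyps by simp
  moreover have "u * ((c i - c m) \<bullet> (f i * u)) \<doteq> c i \<bullet> ((c i - c m) \<bullet> (f i * u) * u)" if "i \<in> S" for i
    using eqv_smul[OF eqv_multR[OF insert.prems(2)[of i], of u], of "c i - c m"] that
    by (simp add: mult.assoc mult.commute[of "c i"])
  ultimately obtain k where k: "\<forall>i\<in>S. (c i - c m) \<bullet> (f i * u) * u ^ k \<in> K"
    using insert.IH insert.prems(3) by (metis (no_types, lifting) inj_on_insert)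
  have S: "f i * u ^ Suc k \<in> K" if "i \<in> S" for i
  proof -
    have "c i \<noteq> c m" using insert.prems(3) insert.hyps that by (auto simp: image_iff)
    then have "c i - c m \<noteq> 0" by simp
    moreover have "(c i - c m) \<bullet> (f i * u ^ Suc k) \<in> K"
      using k that by (simp add: mult.assoc)
    ultimately show ?thesis using smul_mem_iff by blast
  qed
  have "(\<Sum>i\<in>insert m S. f i) * u ^ Suc k - (\<Sum>i\<in>S. f i * u ^ Suc k) \<in> K"
    by (intro diff_mem rmult_mem insert.prems sum_mem S)
  then have "f m * u ^ Suc k \<in> K"
    using insert.hyps by (simp add: sum_distrib_right distrib_right)
  with S show ?case by blast
qed auto

end

lemma power_int_inj_of_not_root_of_unity:
  fixes c :: "'k::field"
  assumes "c \<noteq> 0" and free: "\<And>n. n > 0 \<Longrightarrow> c ^ n \<noteq> 1"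
    and eq: "c powi m = c powi n"
  shows "m = n"
proof -
  have *: "m = 0" if "c powi m = 1" for m
  proof (rule ccontr)
    assume "m \<noteq> 0"
    moreover have "c ^ nat \<bar>m\<bar> = 1"
      using that by (auto simp: power_int_def power_inverse split: if_splits)
    ultimately show False using free[of "nat \<bar>m\<bar>"] by simp
  qed
  have "c powi (m - n) = 1" using eq assms(1) by (simp add: power_int_diff)
  from *[OF this] show ?thesis by simp
qed

text \<open>
  The relations of \<open>A\<close>, for \<open>p\<close> not a root of unity. Both \<open>z\<close> and \<open>w\<close> are now invertible.
\<close>

locale weyl_torus = weyl_relations K p q for K :: "(xyz, 'k::field) free_alg set" and p q +
  fixes r s :: nat
  assumes r0: "r > 0" and s0: "s > 0" and coprime_rs: "coprime r s"
    and qr: "q ^ r = p ^ s"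
    and p_free: "\<And>n. n > 0 \<Longrightarrow> p ^ n \<noteq> 1"
    and Omega_one: "w ^ r * z ^ s \<doteq> 1"
begin

lemma p_powi_inj: "p powi m = p powi n \<Longrightarrow> m = n"
  by (rule power_int_inj_of_not_root_of_unity[OF p0 p_free])

text \<open>
  From \<open>(p * q) ^ n = 1\<close> the \<open>r\<close>-th power and \<open>q ^ r = p ^ s\<close> give \<open>p ^ (n * (r + s)) = 1\<close>.
\<close>

lemma pq_free: "n > 0 \<Longrightarrow> (p * q) ^ n \<noteq> 1"
proof
  assume "n > 0" "(p * q) ^ n = 1"
  then have "((p * q) ^ n) ^ r = 1" by simp
  also have "((p * q) ^ n) ^ r = p ^ (n * r) * (q ^ r) ^ n"
    by (simp add: power_mult_distrib mult.commute flip: power_mult)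
  also have "\<dots> = p ^ (n * (r + s))"
    by (simp add: qr power_add distrib_left mult.commute flip: power_mult)
  finally show False using p_free[of "n * (r + s)"] \<open>n > 0\<close> r0 by simp
qed

lemma zs_wr: "z ^ s * w ^ r \<doteq> 1"
  using eqv_trans[OF eqv_sym[OF wpow_zpow] Omega_one] .

lemma zw_mult: "z ^ i * w ^ j * (z ^ i' * w ^ j') \<doteq> z ^ (i + i') * w ^ (j + j')"
proof -
  have "z ^ i * (w ^ j * z ^ i') * w ^ j' \<doteq> z ^ i * (z ^ i' * w ^ j) * w ^ j'"
    by (intro eqv_multL eqv_multR wpow_zpow)
  then show ?thesis by (simp add: power_add mult.assoc)
qed

lemma zw_period: "z ^ (s * k) * w ^ (r * k) \<doteq> 1"
proof (induction k)
  case (Suc k)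
  have "z ^ (s * Suc k) * w ^ (r * Suc k) \<doteq> z ^ s * w ^ r * (z ^ (s * k) * w ^ (r * k))"
    using eqv_sym[OF zw_mult[of s r "s * k" "r * k"]] by simp
  also have "\<dots> \<doteq> 1 * 1"
    by (intro eqv_mult zs_wr Suc.IH)
  finally show ?case by simp
qed simp

text \<open>
  Sending \<open>z\<close> to \<open>t ^ r\<close> and \<open>w\<close> to \<open>t ^ (- s)\<close> parametrizes the curve \<open>w ^ r * z ^ s = 1\<close>, and the
  weight is the exponent of \<open>t\<close>. As \<open>r\<close> and \<open>s\<close> are coprime, the products \<open>z^i w^j\<close> modulo the ideal
  correspond to the Laurent monomials in \<open>t\<close>: products of equal weight are congruent (\<open>weight_eqv\<close>), and every integer is
  a weight (\<open>weight_surj\<close>).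
\<close>

definition weight :: "nat \<Rightarrow> nat \<Rightarrow> int"
  where "weight i j = int r * int i - int s * int j"

lemma weight_zero: "weight i j = 0 \<Longrightarrow> z ^ i * w ^ j \<doteq> 1"
proof -
  assume "weight i j = 0"
  then have eq: "r * i = s * j"
    unfolding weight_def by (metis eq_iff_diff_eq_0 of_nat_eq_iff of_nat_mult)
  then have "s dvd r * i" by simp
  then have "s dvd i" using coprime_rs by (simp add: coprime_commute coprime_dvd_mult_right_iff)
  then obtain k where k: "i = s * k" ..
  with eq s0 have "j = r * k" by simp
  with k zw_period show ?thesis by simp
qed

lemma weight_add: "weight (i + i') (j + j') = weight i j + weight i' j'"
  by (simp add: weight_def algebra_simps)

text \<open>
  Adding a large enough multiple of \<open>(s, r)\<close>, which has weight zero, to \<open>(- i, - j)\<close> makes both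
  exponents nonnegative.
\<close>

lemma zw_inverse: "\<exists>i' j'. weight i' j' = - weight i j"
proof (intro exI)
  show "weight (s * (i + j) - i) (r * (i + j) - j) = - weight i j"
  proof -
    have "i + j \<le> s * (i + j)" "i + j \<le> r * (i + j)"
      using s0 r0 by simp_all
    then have "i \<le> s * (i + j)" "j \<le> r * (i + j)" by linarith+
    then show ?thesis by (simp add: weight_def of_nat_diff algebra_simps)
  qed
qed

lemma weight_eqv: "weight i j = weight i' j' \<Longrightarrow> z ^ i * w ^ j \<doteq> z ^ i' * w ^ j'"
proof -
  assume eq: "weight i j = weight i' j'"
  obtain k l where kl: "weight k l = - weight i j" using zw_inverse by blast
  have "z ^ i * w ^ j * 1 \<doteq> z ^ i * w ^ j * (z ^ (k + i') * w ^ (l + j'))"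
    using kl eq by (intro eqv_multL eqv_sym[OF weight_zero]) (simp add: weight_add)
  also have "\<dots> \<doteq> z ^ (i + k + i') * w ^ (j + l + j')"
    using zw_mult by (metis add.assoc)
  also have "\<dots> \<doteq> z ^ (i + k) * w ^ (j + l) * (z ^ i' * w ^ j')"
    by (rule eqv_sym[OF zw_mult])
  also have "\<dots> \<doteq> 1 * (z ^ i' * w ^ j')"
    using kl by (intro eqv_multR weight_zero) (simp add: weight_add)
  finally show ?thesis by simp
qed

text \<open>
  Bezout provides a monomial of weight \<open>1\<close>; its powers and their inverses provide the rest.
\<close>

lemma weight_surj: "\<exists>i j. weight i j = e"
proof -
  obtain d a b where "d dvd r" "d dvd s" "r * a = s * b + d"
    using bezout_add_strong_nat[of r s] r0 by auto
  moreover from this have "d = 1" using coprime_rs coprime_common_divisor_nat by blast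
  ultimately have one: "weight a b = 1"
    by (simp add: weight_def flip: of_nat_mult)
  have nat: "\<exists>i j. weight i j = int n" for n
  proof (intro exI)
    show "weight (n * a) (n * b) = int n"
      using arg_cong[OF one, of "\<lambda>x. int n * x"] by (simp add: weight_def algebra_simps)
  qed
  show ?thesis
  proof (cases "e \<ge> 0")
    case True
    with nat[of "nat e"] show ?thesis by simp
  next
    case False
    with nat[of "nat (- e)"] obtain i j where "weight i j = - e" by auto
    then show ?thesis using zw_inverse[of i j] by simp
  qed
qed

definition exponents :: "int \<Rightarrow> nat \<times> nat"
  where "exponents e = (SOME ij. weight (fst ij) (snd ij) = e)"

lemma weight_exponents: "weight (fst (exponents e)) (snd (exponents e)) = e"
  unfolding exponents_def by (rule someI_ex) (use weight_surj[of e] in simp)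

text \<open>
  A representative of the Laurent monomial \<open>t ^ e\<close>.
\<close>

definition t_pow :: "int \<Rightarrow> (xyz, 'k) free_alg"
  where "t_pow e = z ^ fst (exponents e) * w ^ snd (exponents e)"

lemma t_pow_eqv: "z ^ i * w ^ j \<doteq> t_pow (weight i j)"
  unfolding t_pow_def by (rule weight_eqv) (simp add: weight_exponents)

lemma t_pow_unit: "\<exists>u. u * t_pow e \<doteq> 1"
proof -
  obtain i' j' where "weight i' j' = - e" using weight_surj by blast
  then have "z ^ i' * w ^ j' * t_pow e \<doteq> 1"
    unfolding t_pow_def by (intro eqv_trans[OF zw_mult weight_zero]) (simp add: weight_add weight_exponents)
  then show ?thesis ..
qed

lemma z_unit: "z * u \<in> K \<Longrightarrow> u \<in> K"
proof -
  assume "z * u \<in> K"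
  then have "w ^ r * z ^ (s - 1) * (z * u) \<in> K" by (rule lmult_mem)
  moreover have "w ^ r * z ^ (s - 1) * (z * u) = w ^ r * z ^ s * u"
    using s0 by (metis Suc_pred' mult.assoc power_Suc2)
  ultimately show "u \<in> K"
    using eqv_mem_iff[OF eqv_multR[OF Omega_one, of u]] by simp
qed

text \<open>
  Together with the \<open>t_pow e\<close> these span the algebra, which is graded by the index \<open>n\<close>.
\<close>

definition v_pow :: "int \<Rightarrow> (xyz, 'k) free_alg"
  where "v_pow n = (if n \<ge> 0 then x ^ nat n else y ^ nat (- n))"

lemma z_v_pow: "z * v_pow n \<doteq> p powi (- n) \<bullet> (v_pow n * z)"
  using qcommute_power_right[OF zx, of "nat n"] qcommute_power_right[OF zy, of "nat (- n)"]
  by (auto simp: v_pow_def power_int_def power_inverse)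

lemma z_t_pow: "z * t_pow e \<doteq> t_pow e * z"
  unfolding t_pow_def by (rule z_zw)

lemma z_t_pow_v_pow: "z * (t_pow e * v_pow n) \<doteq> p powi (- n) \<bullet> (t_pow e * v_pow n * z)"
  using qcommute_mult_right[of z "t_pow e" 1 "v_pow n" "p powi (- n)"] z_t_pow z_v_pow by simp

text \<open>
  Raising the scalar to the power \<open>r\<close> turns it into \<open>p powi weight i j\<close>, and \<open>p\<close> is not
  a root of unity.
\<close>

lemma char_inj:
  assumes "p ^ i * inverse q ^ j = p ^ i' * inverse q ^ j'"
  shows "weight i j = weight i' j'"
proof -
  have *: "(p ^ i * inverse q ^ j) ^ r = p powi weight i j" for i j
  proof -
    have "(p ^ i * inverse q ^ j) ^ r = p ^ (r * i) * inverse (p ^ (s * j))"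
      using qr by (simp add: power_mult_distrib power_inverse mult.commute flip: power_mult)
        (metis power_mult mult.commute)
    also have "\<dots> = p powi weight i j"
      using p0 by (simp add: weight_def power_int_diff divide_inverse flip: of_nat_mult)
    finally show ?thesis .
  qed
  show ?thesis using *[of i j] *[of i' j'] assms p_powi_inj by metis
qed

text \<open>
  The scalar by which \<open>x\<close> commutes with \<open>t ^ e\<close>. It separates the exponents \<open>e\<close>, just as the
  scalar \<open>p powi (- n)\<close>, by which \<open>z\<close> commutes with \<open>v_pow n\<close>, separates the degrees \<open>n\<close>.
\<close>

definition \<chi> :: "int \<Rightarrow> 'k"
  where "\<chi> e = p ^ fst (exponents e) * inverse q ^ snd (exponents e)"

lemma chi_inj: "\<chi> e = \<chi> e' \<Longrightarrow> e = e'"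
  using char_inj weight_exponents unfolding \<chi>_def by metis

lemma x_t_pow: "x * t_pow e \<doteq> \<chi> e \<bullet> (t_pow e * x)"
  unfolding t_pow_def \<chi>_def by (rule x_zw)

lemma y_t_pow: "y * t_pow e \<doteq> inverse (\<chi> e) \<bullet> (t_pow e * y)"
  using y_zw[of "fst (exponents e)" "snd (exponents e)"] by (simp add: t_pow_def \<chi>_def power_inverse)

text \<open>
  Commutation with \<open>x\<close> (or with \<open>y\<close> in negative degrees) separates the terms of a homogeneous
  element, and \<open>t ^ e\<close> is invertible; what remains of a term is a power of \<open>x\<close> or of \<open>y\<close>.
  Using \<open>y\<close> in negative degrees avoids products of \<open>x\<close> and \<open>y\<close>.
\<close>

lemma homogeneous_mem:
  assumes mem: "(\<Sum>e\<in>E. c e \<bullet> (t_pow e * v_pow n)) \<in> K" and E: "finite E" "e \<in> E" "c e \<noteq> 0"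
  shows "(\<exists>m. x ^ m \<in> K) \<or> (\<exists>m. y ^ m \<in> K)"
proof -
  have strip: "v \<in> K" if "c e \<bullet> (t_pow e * v) \<in> K" for v
  proof -
    from that E have "t_pow e * v \<in> K" by (simp add: smul_mem_iff)
    then have "u * t_pow e * v \<in> K" for u by (simp add: lmult_mem mult.assoc)
    moreover obtain u where "u * t_pow e \<doteq> 1" using t_pow_unit by blast
    ultimately show ?thesis using eqv_mem_iff[OF eqv_multR, of "u * t_pow e" 1 v] by simp
  qed
  show ?thesis
  proof (cases "n \<ge> 0")
    case True
    have comm: "x * (c e \<bullet> (t_pow e * v_pow n)) \<doteq> \<chi> e \<bullet> (c e \<bullet> (t_pow e * v_pow n) * x)" for e
      using True eqv_smul[OF eqv_multR[OF x_t_pow, of e "v_pow n"], of "c e"]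
      by (simp add: v_pow_def mult.assoc mult.commute[of "c e"] power_commutes)
    have "inj_on \<chi> E" using chi_inj by (auto intro: inj_onI)
    from eigen_components[OF E(1) mem comm this] obtain k where
      "c e \<bullet> (t_pow e * v_pow n) * x ^ k \<in> K" using E(2) by blast
    then have "x ^ (nat n + k) \<in> K"
      using strip[of "x ^ (nat n + k)"] True by (simp add: v_pow_def mult.assoc power_add)
    then show ?thesis by blast
  next
    case False
    have comm: "y * (c e \<bullet> (t_pow e * v_pow n)) \<doteq> inverse (\<chi> e) \<bullet> (c e \<bullet> (t_pow e * v_pow n) * y)" for e
      using False eqv_smul[OF eqv_multR[OF y_t_pow, of e "v_pow n"], of "c e"]
      by (simp add: v_pow_def mult.assoc mult.commute[of "c e"] power_commutes)
    have "inj_on (\<lambda>e. inverse (\<chi> e)) E" using chi_inj by (auto intro: inj_onI)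
    from eigen_components[OF E(1) mem comm this] obtain k where
      "c e \<bullet> (t_pow e * v_pow n) * y ^ k \<in> K" using E(2) by blast
    then have "y ^ (nat (- n) + k) \<in> K"
      using strip[of "y ^ (nat (- n) + k)"] False by (simp add: v_pow_def mult.assoc power_add)
    then show ?thesis by blast
  qed
qed

text \<open>
  Multiplying \<open>x ^ Suc m\<close> by \<open>y\<close> on the left and on the right produces two combinations of
  \<open>w * x ^ m\<close> and \<open>z * x ^ m\<close>. They are independent because \<open>(p * q) ^ Suc m \<noteq> 1\<close>, so \<open>z * x ^ m\<close> is in
  the ideal, and \<open>z\<close> is invertible. In terms of generalized Weyl algebras, the
  polynomial \<open>y * x\<close> in \<open>t\<close> and its translates by nonzero powers of the dilation have no common root.
\<close>

lemma x_descent: "x ^ Suc m \<in> K \<Longrightarrow> x ^ m \<in> K"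
proof -
  assume mem: "x ^ Suc m \<in> K"
  have "y * x * x ^ m \<in> K" using lmult_mem[OF mem, of y] by (simp add: mult.assoc)
  then have "g \<bullet> (q \<bullet> w - inverse p \<bullet> z) * x ^ m \<in> K"
    using eqv_mem_iff[OF eqv_multR[OF yx]] by blast
  then have 1: "q \<bullet> (w * x ^ m) - inverse p \<bullet> (z * x ^ m) \<in> K"
    using g0 by (simp add: smul_mem_iff left_diff_distrib)
  have "x ^ m * (x * y) \<in> K"
    using rmult_mem[OF mem, of y] by (simp only: power_Suc2 mult.assoc)
  then have "x ^ m * (g \<bullet> (w - z)) \<in> K"
    using eqv_mem_iff[OF eqv_multL[OF xy]] by blast
  then have "x ^ m * w - x ^ m * z \<in> K"
    using g0 by (simp add: smul_mem_iff right_diff_distrib)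
  moreover have "x ^ m * w - x ^ m * z \<doteq> inverse q ^ m \<bullet> (w * x ^ m) - p ^ m \<bullet> (z * x ^ m)"
    by (intro eqv_diff qcommute_power_left xw xz)
  ultimately have "inverse q ^ m \<bullet> (w * x ^ m) - p ^ m \<bullet> (z * x ^ m) \<in> K"
    using eqv_mem_iff by blast
  from diff_mem[OF 1 smul_mem[OF this, of "q ^ Suc m"]]
  have "(q ^ Suc m * p ^ m - inverse p) \<bullet> (z * x ^ m) \<in> K"
    using q0 by (simp add: smul_diff diff_smul power_inverse mult.assoc)
  moreover have "q ^ Suc m * p ^ m - inverse p \<noteq> 0"
    using pq_free[of "Suc m"] p0 by (simp add: field_simps power_mult_distrib)
  ultimately show "x ^ m \<in> K" using z_unit by (simp add: smul_mem_iff)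
qed

lemma y_descent: "y ^ Suc m \<in> K \<Longrightarrow> y ^ m \<in> K"
proof -
  assume mem: "y ^ Suc m \<in> K"
  have "x * y * y ^ m \<in> K" using lmult_mem[OF mem, of x] by (simp add: mult.assoc)
  then have "g \<bullet> (w - z) * y ^ m \<in> K"
    using eqv_mem_iff[OF eqv_multR[OF xy]] by blast
  then have 1: "w * y ^ m - z * y ^ m \<in> K"
    using g0 by (simp add: smul_mem_iff left_diff_distrib)
  have "y ^ m * (y * x) \<in> K"
    using rmult_mem[OF mem, of x] by (simp only: power_Suc2 mult.assoc)
  then have "y ^ m * (g \<bullet> (q \<bullet> w - inverse p \<bullet> z)) \<in> K"
    using eqv_mem_iff[OF eqv_multL[OF yx]] by blast
  then have "q \<bullet> (y ^ m * w) - inverse p \<bullet> (y ^ m * z) \<in> K"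
    using g0 by (simp add: smul_mem_iff right_diff_distrib)
  moreover have "q \<bullet> (y ^ m * w) - inverse p \<bullet> (y ^ m * z) \<doteq>
      q \<bullet> (q ^ m \<bullet> (w * y ^ m)) - inverse p \<bullet> (inverse p ^ m \<bullet> (z * y ^ m))"
    by (intro eqv_diff eqv_smul qcommute_power_left yw yz)
  ultimately have "q ^ Suc m \<bullet> (w * y ^ m) - inverse p ^ Suc m \<bullet> (z * y ^ m) \<in> K"
    using eqv_mem_iff by simp
  from diff_mem[OF this smul_mem[OF 1, of "q ^ Suc m"]]
  have "(q ^ Suc m - inverse p ^ Suc m) \<bullet> (z * y ^ m) \<in> K"
    by (simp add: smul_diff diff_smul)
  moreover have "q ^ Suc m - inverse p ^ Suc m \<noteq> 0"
    using pq_free[of "Suc m"] p0 by (simp add: field_simps power_mult_distrib power_inverse)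
  ultimately show "y ^ m \<in> K" using z_unit by (simp add: smul_mem_iff)
qed

lemma one_mem_of_power:
  assumes "x ^ m \<in> K \<or> y ^ m \<in> K"
  shows "1 \<in> K"
  using assms by (induction m) (auto dest: x_descent y_descent simp del: power_Suc)

lemma t_pow_v_pow_expansion:
  "\<exists>E N c. finite E \<and> finite N \<and> f \<doteq> (\<Sum>n\<in>N. \<Sum>e\<in>E. c n e \<bullet> (t_pow e * v_pow n))"
proof -
  have *: "\<exists>S c. finite S \<and> (\<forall>i. i \<notin> S \<longrightarrow> c i = 0) \<and> f \<doteq> (\<Sum>(n, e)\<in>S. c (n, e) \<bullet> (t_pow e * v_pow n))"
    using normal_UNIV[of f]
  proof (induction rule: normal_span.induct)
    case (normal_x c i j n)
    let ?e = "weight i j"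
    have "c \<bullet> (z ^ i * w ^ j * x ^ n) \<doteq> c \<bullet> (t_pow ?e * v_pow n)"
      by (simp add: v_pow_def eqv_smul eqv_multR t_pow_eqv)
    then show ?case
      by (intro exI[of _ "{(int n, ?e)}"] exI[of _ "\<lambda>i. if i = (int n, ?e) then c else 0"]) auto
  next
    case (normal_y c i j n)
    let ?e = "weight i j"
    have "c \<bullet> (z ^ i * w ^ j * y ^ n) \<doteq> c \<bullet> (t_pow ?e * v_pow (- int n))"
      by (cases "n = 0") (simp_all add: v_pow_def eqv_smul eqv_multR t_pow_eqv)
    then show ?case
      by (intro exI[of _ "{(- int n, ?e)}"] exI[of _ "\<lambda>i. if i = (- int n, ?e) then c else 0"]) auto
  next
    case (normal_add a b)
    then obtain S c T d where
      S: "finite S" "\<forall>i. i \<notin> S \<longrightarrow> c i = 0" "a \<doteq> (\<Sum>(n, e)\<in>S. c (n, e) \<bullet> (t_pow e * v_pow n))" and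
      T: "finite T" "\<forall>i. i \<notin> T \<longrightarrow> d i = 0" "b \<doteq> (\<Sum>(n, e)\<in>T. d (n, e) \<bullet> (t_pow e * v_pow n))"
      by blast
    have "(\<Sum>(n, e)\<in>S. c (n, e) \<bullet> (t_pow e * v_pow n)) = (\<Sum>(n, e)\<in>S \<union> T. c (n, e) \<bullet> (t_pow e * v_pow n))"
      "(\<Sum>(n, e)\<in>T. d (n, e) \<bullet> (t_pow e * v_pow n)) = (\<Sum>(n, e)\<in>S \<union> T. d (n, e) \<bullet> (t_pow e * v_pow n))"
      using S T by (auto intro!: sum.mono_neutral_left)
    with S T have "a + b \<doteq> (\<Sum>(n, e)\<in>S \<union> T. (c (n, e) + d (n, e)) \<bullet> (t_pow e * v_pow n))"
      using eqv_add[OF S(3) T(3)] by (simp add: add_smul sum.distrib split_def)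
    with S T show ?case
      by (intro exI[of _ "S \<union> T"] exI[of _ "\<lambda>i. c i + d i"]) auto
  next
    case (normal_eqv a b)
    from normal_eqv.IH obtain S c where "finite S" "\<forall>i. i \<notin> S \<longrightarrow> c i = 0"
        "a \<doteq> (\<Sum>(n, e)\<in>S. c (n, e) \<bullet> (t_pow e * v_pow n))" by blast
    with eqv_trans[OF eqv_sym[OF normal_eqv.hyps(2)]] show ?case by blast
  qed
  then obtain S c where S: "finite S" "\<forall>i. i \<notin> S \<longrightarrow> c i = 0"
      "f \<doteq> (\<Sum>(n, e)\<in>S. c (n, e) \<bullet> (t_pow e * v_pow n))" by (elim exE conjE)
  have "(\<Sum>(n, e)\<in>S. c (n, e) \<bullet> (t_pow e * v_pow n)) = (\<Sum>(n, e)\<in>fst ` S \<times> snd ` S. c (n, e) \<bullet> (t_pow e * v_pow n))"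
  proof (rule sum.mono_neutral_left)
    show "finite (fst ` S \<times> snd ` S)" using S(1) by simp
    show "S \<subseteq> fst ` S \<times> snd ` S" by (metis subset_fst_snd)
    show "\<forall>i\<in>fst ` S \<times> snd ` S - S. (case i of (n, e) \<Rightarrow> c (n, e) \<bullet> (t_pow e * v_pow n)) = 0"
      using S(2) by auto
  qed
  also have "\<dots> = (\<Sum>n\<in>fst ` S. \<Sum>e\<in>snd ` S. c (n, e) \<bullet> (t_pow e * v_pow n))"
    by (simp add: sum.cartesian_product)
  finally show ?thesis
    using S by (intro exI[of _ "snd ` S"] exI[of _ "fst ` S"] exI[of _ "\<lambda>n e. c (n, e)"]) simp
qed

text \<open>
  First \<open>z\<close> separates the degrees, then \<open>homogeneous_mem\<close> separates the terms in one degree, and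
  the descent leads down to \<open>1\<close>.
\<close>

lemma combination_mem:
  assumes mem: "(\<Sum>n\<in>N. \<Sum>e\<in>E. c n e \<bullet> (t_pow e * v_pow n)) \<in> K"
    and fin: "finite E" "finite N" and n: "n \<in> N" and e: "e \<in> E" "c n e \<noteq> 0"
  shows "1 \<in> K"
proof -
  define f where "f n = (\<Sum>e\<in>E. c n e \<bullet> (t_pow e * v_pow n))" for n
  have comm: "z * f n \<doteq> p powi (- n) \<bullet> (f n * z)" for n
  proof -
    have "(\<Sum>e\<in>E. c n e \<bullet> (z * (t_pow e * v_pow n))) \<doteq> (\<Sum>e\<in>E. c n e \<bullet> p powi (- n) \<bullet> (t_pow e * v_pow n * z))"
      by (intro eqv_sum eqv_smul z_t_pow_v_pow)
    then show ?thesis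
      unfolding f_def by (simp add: sum_distrib_left sum_distrib_right smul_sum mult.commute)
  qed
  have "inj_on (\<lambda>n. p powi (- n)) N"
    by (rule inj_onI) (use p_powi_inj in fastforce)
  from eigen_components[OF fin(2) mem[folded f_def] comm this] obtain k where
    "f n * z ^ k \<in> K" using n by blast
  moreover have "u \<in> K" if "u * z ^ k \<in> K" for u k
    using that
  proof (induction k)
    case (Suc k)
    have "u * z ^ Suc k * (z ^ (s - 1) * w ^ r) \<in> K"
      using Suc.prems by (rule rmult_mem)
    moreover have "Suc k + (s - 1) = k + s"
      using s0 by simp
    then have "z ^ Suc k * z ^ (s - 1) = z ^ k * z ^ s"
      by (simp only: power_add[symmetric])
    then have "u * (z ^ Suc k * z ^ (s - 1)) * w ^ r = u * (z ^ k * z ^ s) * w ^ r"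
      by (simp only:)
    then have "u * z ^ Suc k * (z ^ (s - 1) * w ^ r) = u * z ^ k * (z ^ s * w ^ r)"
      by (simp only: mult.assoc)
    ultimately have "u * z ^ k * (z ^ s * w ^ r) \<in> K"
      by (simp only:)
    then have "u * z ^ k \<in> K"
      using eqv_mem_iff[OF eqv_multL[OF zs_wr, of "u * z ^ k"]] by simp
    then show ?case by (rule Suc.IH)
  qed simp
  ultimately have "f n \<in> K" by blast
  from homogeneous_mem[OF this[unfolded f_def] fin(1) e] show ?thesis
    using one_mem_of_power by blast
qed

end

text \<open>
  The same constants \<open>t_pow\<close> and \<open>v_pow\<close> serve for \<open>J\<close> and \<open>I\<close>. An element outside \<open>J\<close> has an
  expansion modulo \<open>J\<close> with a nonzero coefficient; reading that expansion modulo \<open>I\<close> puts \<open>1\<close>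
  into \<open>I\<close>. Applied to the kernel of a nonzero representation of \<open>A\<close>, the
  result identifies \<open>J\<close> with that kernel.
\<close>

lemma weyl_torus_simple:
  assumes "weyl_torus J p q r s" "two_sided I" "J \<subseteq> I" "f \<in> I" "f \<notin> J"
  shows "1 \<in> I"
proof -
  interpret J: weyl_torus J p q r s by fact
  interpret I: two_sided I by fact
  interpret I: weyl_torus I p q r s
    using J.p0 J.q0 J.pq J.relations J.r0 J.s0 J.coprime_rs J.qr J.p_free J.Omega_one assms(3)
    by unfold_locales (auto simp: I.eqv_def J.eqv_def)
  obtain E N c where *: "finite E" "finite N" "J.eqv f (\<Sum>n\<in>N. \<Sum>e\<in>E. c n e \<bullet> (J.t_pow e * J.v_pow n))"
    using J.t_pow_v_pow_expansion[of f] by blast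
  have "(\<Sum>n\<in>N. \<Sum>e\<in>E. c n e \<bullet> (J.t_pow e * J.v_pow n)) \<notin> J"
    using J.eqv_mem_iff[OF *(3)] assms(5) by blast
  then obtain n e where "n \<in> N" "e \<in> E" "c n e \<noteq> 0"
    by (metis (no_types, lifting) J.sum_mem J.zero_mem zero_smul)
  moreover have "(\<Sum>n\<in>N. \<Sum>e\<in>E. c n e \<bullet> (J.t_pow e * J.v_pow n)) \<in> I"
    using *(3) assms(3) I.diff_mem[OF assms(4), of "f - (\<Sum>n\<in>N. \<Sum>e\<in>E. c n e \<bullet> (J.t_pow e * J.v_pow n))"]
    by (auto simp: J.eqv_def)
  ultimately show ?thesis using *(1,2) by (intro I.combination_mem[of c E N n e])
qed

section \<open>Noetherian rings\<close>

text \<open>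
  Everything here is relative to an ideal \<open>J\<close>: chains of left ideals of a subring \<open>S\<close> that contain
  \<open>J\<close> stand for chains in \<open>S / J\<close>. The work is done inside the class \<open>ring_1\<close>, with its operations
  as parameters, so that the results can be reused for the opposite multiplication; this turns
  statements about left ideals into statements about right ideals.
\<close>

context ring_1
begin

definition is_subring :: "'a set \<Rightarrow> bool"
  where "is_subring S \<longleftrightarrow> 0 \<in> S \<and> 1 \<in> S \<and>
    (\<forall>a\<in>S. \<forall>b\<in>S. a + b \<in> S \<and> a * b \<in> S) \<and> (\<forall>a\<in>S. - a \<in> S)"

definition subring_gen :: "'a set \<Rightarrow> 'a set"
  where "subring_gen G = \<Inter>{S. is_subring S \<and> G \<subseteq> S}"

definition left_submodule :: "'a set \<Rightarrow> 'a set \<Rightarrow> bool"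
  where "left_submodule S L \<longleftrightarrow> L \<subseteq> S \<and> 0 \<in> L \<and>
    (\<forall>a\<in>L. \<forall>b\<in>L. a + b \<in> L) \<and> (\<forall>s\<in>S. \<forall>a\<in>L. s * a \<in> L)"

definition acc_over :: "'a set \<Rightarrow> 'a set \<Rightarrow> bool"
  where "acc_over J S \<longleftrightarrow> (\<forall>L :: nat \<Rightarrow> 'a set.
    (\<forall>n. left_submodule S (L n) \<and> J \<subseteq> L n \<and> L n \<subseteq> L (Suc n)) \<longrightarrow> (\<exists>N. \<forall>n\<ge>N. L n = L N))"

definition two_sided_set :: "'a set \<Rightarrow> bool"
  where "two_sided_set J \<longleftrightarrow> 0 \<in> J \<and> (\<forall>a\<in>J. \<forall>b\<in>J. a + b \<in> J) \<and>
    (\<forall>a\<in>J. \<forall>b. b * a \<in> J \<and> a * b \<in> J)"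

lemma is_subring_gen: "is_subring (subring_gen G)"
  unfolding subring_gen_def is_subring_def by auto

lemma subring_gen_subset: "G \<subseteq> subring_gen G"
  unfolding subring_gen_def by auto

lemma subring_gen_minimal: "is_subring S \<Longrightarrow> G \<subseteq> S \<Longrightarrow> subring_gen G \<subseteq> S"
  unfolding subring_gen_def by auto

lemma left_submodule_diff:
  assumes "is_subring S" "left_submodule S L" "a \<in> L" "b \<in> L"
  shows "a - b \<in> L"
proof -
  have "- 1 \<in> S" using assms(1) by (auto simp: is_subring_def)
  then have "- 1 * b \<in> L" using assms(2,4) unfolding left_submodule_def by blast
  then have "a + - 1 * b \<in> L" using assms(2,3) unfolding left_submodule_def by blast
  then show ?thesis by simp
qed

text \<open>
  The base of the tower: modulo \<open>J\<close> every element of \<open>S\<close> outside \<open>J\<close> has a left inverse, so \<open>J\<close>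
  and \<open>S\<close> are the only members that a chain can have.
\<close>

lemma acc_over_division:
  assumes S: "is_subring S" and inv: "\<And>a. a \<in> S \<Longrightarrow> a \<notin> J \<Longrightarrow> \<exists>b\<in>S. b * a - 1 \<in> J"
  shows "acc_over J S"
  unfolding acc_over_def
proof (intro allI impI)
  fix L assume L: "\<forall>n. left_submodule S (L n) \<and> J \<subseteq> L n \<and> L n \<subseteq> L (Suc n)"
  have full: "L n = S" if "L n \<noteq> J" for n
  proof -
    from that L obtain a where a: "a \<in> L n" "a \<notin> J" by blast
    have Ln: "left_submodule S (L n)" "J \<subseteq> L n" using L by auto
    then have "a \<in> S" using a unfolding left_submodule_def by blast
    with inv a obtain b where b: "b \<in> S" "b * a - 1 \<in> J" by blast
    have "b * a \<in> L n" using Ln a b unfolding left_submodule_def by blast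
    then have "b * a - (b * a - 1) \<in> L n"
      using left_submodule_diff[OF S Ln(1)] b Ln(2) by blast
    then have one: "1 \<in> L n" by (simp add: algebra_simps)
    have "s \<in> L n" if "s \<in> S" for s
      using Ln(1) one that unfolding left_submodule_def by (metis mult_1_right)
    then show ?thesis using Ln(1) unfolding left_submodule_def by blast
  qed
  have mono: "L m \<subseteq> L n" if "m \<le> n" for m n
    using lift_Suc_mono_le[of L] L that by blast
  show "\<exists>N. \<forall>n\<ge>N. L n = L N"
  proof (cases "\<forall>n. L n = J")
    case False
    then obtain N where "L N = S" using full by blast
    moreover have "L n \<subseteq> S" for n using L unfolding left_submodule_def by blast
    ultimately show ?thesis using mono by blast
  qed auto
qed

text \<open>
  Polynomials in \<open>y\<close> of degree less than \<open>n\<close>. With the coefficients on the right, multiplication by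
  \<open>y\<close> from the left keeps the leading coefficient, so the leading coefficients of a left ideal
  increase with the degree, as in the commutative Hilbert basis theorem.
\<close>

primrec polys :: "'a set \<Rightarrow> 'a \<Rightarrow> nat \<Rightarrow> 'a set" where
  "polys S y 0 = {0}"
| "polys S y (Suc n) = {y ^ n * s + a |s a. s \<in> S \<and> a \<in> polys S y n}"

definition leading_coeffs :: "'a set \<Rightarrow> 'a \<Rightarrow> nat \<Rightarrow> 'a set \<Rightarrow> 'a set"
  where "leading_coeffs S y n L = {s \<in> S. \<exists>a\<in>polys S y n. y ^ n * s + a \<in> L}"

lemma polys_SucI: "s \<in> S \<Longrightarrow> a \<in> polys S y n \<Longrightarrow> y ^ n * s + a \<in> polys S y (Suc n)"
  by auto

lemma polys_SucE:
  assumes "f \<in> polys S y (Suc n)"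
  obtains s a where "f = y ^ n * s + a" "s \<in> S" "a \<in> polys S y n"
  using assms by auto

context
  fixes S :: "'a set" and y :: 'a
  assumes S: "is_subring S"
begin

lemma S_closed: "0 \<in> S" "1 \<in> S" "a \<in> S \<Longrightarrow> b \<in> S \<Longrightarrow> a + b \<in> S"
  "a \<in> S \<Longrightarrow> b \<in> S \<Longrightarrow> a * b \<in> S" "a \<in> S \<Longrightarrow> - a \<in> S"
  using S by (auto simp: is_subring_def)

lemma polys_zero: "0 \<in> polys S y n"
proof (induction n)
  case (Suc n)
  then show ?case using polys_SucI[of 0 S 0 y n] S_closed(1) by simp
qed simp

lemma polys_mono: "polys S y n \<subseteq> polys S y (Suc n)"
  using polys_SucI[of 0 S _ y n] S_closed(1) by auto

lemma polys_mono_le: "m \<le> n \<Longrightarrow> polys S y m \<subseteq> polys S y n"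
  using lift_Suc_mono_le[of "polys S y"] polys_mono by blast

lemma polys_add: "a \<in> polys S y n \<Longrightarrow> b \<in> polys S y n \<Longrightarrow> a + b \<in> polys S y n"
proof (induction n arbitrary: a b)
  case (Suc n)
  from Suc.prems obtain s a' t b' where
    "a = y ^ n * s + a'" "s \<in> S" "a' \<in> polys S y n" "b = y ^ n * t + b'" "t \<in> S" "b' \<in> polys S y n"
    by (elim polys_SucE)
  moreover from this have "a + b = y ^ n * (s + t) + (a' + b')"
    by (simp add: algebra_simps)
  ultimately show ?case using Suc.IH polys_SucI S_closed(3) by metis
qed simp

lemma polys_rmult: "a \<in> polys S y n \<Longrightarrow> t \<in> S \<Longrightarrow> a * t \<in> polys S y n"
proof (induction n arbitrary: a)
  case (Suc n)
  from Suc.prems obtain s a' where "a = y ^ n * s + a'" "s \<in> S" "a' \<in> polys S y n"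
    by (elim polys_SucE)
  moreover from this have "a * t = y ^ n * (s * t) + a' * t"
    by (simp add: distrib_right mult_assoc)
  ultimately show ?case using Suc polys_SucI S_closed(4) by metis
qed simp

lemma polys_uminus: "a \<in> polys S y n \<Longrightarrow> - a \<in> polys S y n"
  using polys_rmult[of a n "- 1"] S_closed by simp

lemma polys_diff: "a \<in> polys S y n \<Longrightarrow> b \<in> polys S y n \<Longrightarrow> a - b \<in> polys S y n"
  using polys_add[of a n "- b"] polys_uminus by simp

lemma polys_y: "a \<in> polys S y n \<Longrightarrow> y * a \<in> polys S y (Suc n)"
proof (induction n arbitrary: a)
  case 0
  then show ?case using polys_zero[of "Suc 0"] by simp
next
  case (Suc n)
  from Suc.prems obtain s a' where "a = y ^ n * s + a'" "s \<in> S" "a' \<in> polys S y n"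
    by (elim polys_SucE)
  moreover from this have "y * a = y ^ Suc n * s + y * a'"
    by (simp add: distrib_left mult_assoc)
  ultimately show ?case using Suc.IH polys_SucI by metis
qed

lemma polys_monom: "s \<in> S \<Longrightarrow> y ^ n * s \<in> polys S y (Suc n)"
  using polys_SucI[of s S 0 y n] polys_zero by simp

context
  assumes S_y: "\<And>s. s \<in> S \<Longrightarrow> \<exists>s'\<in>S. s * y - y * s' \<in> S"
    and y_S: "\<And>s. s \<in> S \<Longrightarrow> \<exists>s'\<in>S. y * s - s' * y \<in> S"
begin

lemma move_right: "t \<in> S \<Longrightarrow> \<exists>t'\<in>S. t * y ^ m - y ^ m * t' \<in> polys S y m"
proof (induction m arbitrary: t)
  case 0
  then show ?case by (intro bexI[of _ t]) auto
next
  case (Suc m)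
  obtain t1 where t1: "t1 \<in> S" "t * y - y * t1 \<in> S" using S_y Suc.prems by blast
  obtain t2 where t2: "t2 \<in> S" "t1 * y ^ m - y ^ m * t2 \<in> polys S y m" using Suc.IH t1 by blast
  define u where "u = t * y - y * t1"
  obtain u' where u': "u' \<in> S" "u * y ^ m - y ^ m * u' \<in> polys S y m"
    using Suc.IH t1(2) unfolding u_def by blast
  have "t * y ^ Suc m - y ^ Suc m * t2
      = y * (t1 * y ^ m - y ^ m * t2) + (y ^ m * u' + (u * y ^ m - y ^ m * u'))"
    by (simp add: u_def algebra_simps)
  moreover have "\<dots> \<in> polys S y (Suc m)"
    by (intro polys_add polys_y t2 polys_SucI u')
  ultimately show ?case using t2(1) by (metis)
qed

lemma polys_lmult: "a \<in> polys S y n \<Longrightarrow> t \<in> S \<Longrightarrow> t * a \<in> polys S y n"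
proof (induction n arbitrary: a)
  case (Suc n)
  from Suc.prems obtain s a' where a: "a = y ^ n * s + a'" "s \<in> S" "a' \<in> polys S y n"
    by (elim polys_SucE)
  obtain t' where t': "t' \<in> S" "t * y ^ n - y ^ n * t' \<in> polys S y n"
    using move_right Suc.prems by blast
  have "t * a = y ^ n * (t' * s) + ((t * y ^ n - y ^ n * t') * s + t * a')"
    using a(1) by (simp add: algebra_simps)
  moreover have "\<dots> \<in> polys S y (Suc n)"
    by (intro polys_SucI polys_add polys_rmult Suc.IH Suc.prems a t' S_closed)
  ultimately show ?case by metis
qed simp

lemma move_left: "t' \<in> S \<Longrightarrow> \<exists>t\<in>S. t * y ^ m - y ^ m * t' \<in> polys S y m"
proof (induction m)
  case 0
  then show ?case by (intro bexI[of _ t']) auto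
next
  case (Suc m)
  then obtain t where t: "t \<in> S" "t * y ^ m - y ^ m * t' \<in> polys S y m" by blast
  obtain t2 where t2: "t2 \<in> S" "y * t - t2 * y \<in> S" using y_S t by blast
  have "t2 * y ^ Suc m - y ^ Suc m * t' = y * (t * y ^ m - y ^ m * t') - (y * t - t2 * y) * (y ^ m * 1)"
    by (simp add: algebra_simps)
  moreover have "\<dots> \<in> polys S y (Suc m)"
    by (intro polys_diff polys_y polys_lmult polys_monom t t2 S_closed)
  ultimately show ?case using t2(1) by metis
qed

lemma polys_exhaust:
  assumes T: "\<And>U. is_subring U \<Longrightarrow> S \<subseteq> U \<Longrightarrow> y \<in> U \<Longrightarrow> T \<subseteq> U"
  shows "T \<subseteq> (\<Union>n. polys S y n)"
proof -
  let ?P = "\<Union>n. polys S y n"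
  have add: "a + b \<in> ?P" if "a \<in> ?P" "b \<in> ?P" for a b
  proof -
    from that obtain m n where "a \<in> polys S y m" "b \<in> polys S y n" by blast
    then have "a + b \<in> polys S y (max m n)"
      using polys_mono_le[of m "max m n"] polys_mono_le[of n "max m n"] by (intro polys_add) auto
    then show ?thesis by blast
  qed
  have uminus: "- a \<in> ?P" if "a \<in> ?P" for a using that polys_uminus by blast
  define U where "U = {a. \<forall>b\<in>?P. a * b \<in> ?P}"
  have "is_subring U"
    unfolding is_subring_def
  proof (intro conjI ballI)
    show "0 \<in> U" "1 \<in> U" unfolding U_def using polys_zero by auto
    fix a assume a: "a \<in> U"
    then show "- a \<in> U" unfolding U_def using uminus by (simp del: UN_iff)
    fix b assume b: "b \<in> U"
    show "a + b \<in> U"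
      using a b add unfolding U_def by (simp add: distrib_right del: UN_iff)
    show "a * b \<in> U"
      unfolding U_def
    proof (intro CollectI ballI)
      fix c assume "c \<in> ?P"
      then have "b * c \<in> ?P" using b unfolding U_def by blast
      then have "a * (b * c) \<in> ?P" using a unfolding U_def by blast
      then show "a * b * c \<in> ?P" by (simp only: mult_assoc)
    qed
  qed
  moreover have "S \<subseteq> U" unfolding U_def using polys_lmult by blast
  moreover have "y \<in> U" unfolding U_def using polys_y by blast
  ultimately have "T \<subseteq> U" by (rule T)
  moreover have "y ^ 0 * 1 \<in> polys S y (Suc 0)" by (rule polys_monom[OF S_closed(2)])
  then have "1 \<in> polys S y (Suc 0)" by (simp only: power_0 mult_1_left)
  then have "1 \<in> ?P" by blast
  ultimately show ?thesis unfolding U_def by force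
qed

text \<open>
  The Hilbert basis theorem for an extension of \<open>S\<close> by an element \<open>y\<close> with \<open>S y + S = y S + S\<close>. An
  element can have several expressions as a polynomial, and \<open>leading_coeffs\<close> collects the leading
  coefficients of all of them. These sets form left ideals because \<open>move_left\<close> lets an
  arbitrary coefficient pass through \<open>y ^ n\<close> from right to left.
\<close>

lemma acc_over_extension:
  assumes acc: "acc_over J S" and J: "two_sided_set J" "J \<subseteq> S"
    and T: "is_subring T" "S \<subseteq> T" "y \<in> T"
    and T_min: "\<And>U. is_subring U \<Longrightarrow> S \<subseteq> U \<Longrightarrow> y \<in> U \<Longrightarrow> T \<subseteq> U"
  shows "acc_over J T"
  unfolding acc_over_def
proof (intro allI impI)
  let ?lc = "leading_coeffs S y"
  fix L assume L: "\<forall>n. left_submodule T (L n) \<and> J \<subseteq> L n \<and> L n \<subseteq> L (Suc n)"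
  have sub: "left_submodule T (L k)" and JL: "J \<subseteq> L k" for k using L by auto
  have mono: "L m \<subseteq> L n" if "m \<le> n" for m n
    using lift_Suc_mono_le[of L] L that by blast
  have L_add: "a + b \<in> L k" if "a \<in> L k" "b \<in> L k" for a b k
    using sub[of k] that unfolding left_submodule_def by blast
  have L_mult: "t * a \<in> L k" if "t \<in> T" "a \<in> L k" for t a k
    using sub[of k] that unfolding left_submodule_def by blast
  have lc_sub: "left_submodule S (?lc n (L k))" for n k
  proof -
    have "0 \<in> ?lc n (L k)"
      using sub[of k] polys_zero S_closed(1) unfolding leading_coeffs_def left_submodule_def by force
    moreover have "s + t \<in> ?lc n (L k)" if st: "s \<in> ?lc n (L k)" "t \<in> ?lc n (L k)" for s t
    proof -
      from st obtain a b where ab: "s \<in> S" "t \<in> S" "a \<in> polys S y n" "b \<in> polys S y n"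
        "y ^ n * s + a \<in> L k" "y ^ n * t + b \<in> L k" unfolding leading_coeffs_def by blast
      have "y ^ n * (s + t) + (a + b) \<in> L k"
        using L_add[OF ab(5,6)] by (simp add: algebra_simps)
      with ab polys_add S_closed(3) show ?thesis unfolding leading_coeffs_def by blast
    qed
    moreover have "t' * s \<in> ?lc n (L k)" if st: "t' \<in> S" "s \<in> ?lc n (L k)" for t' s
    proof -
      from st obtain a where a: "s \<in> S" "a \<in> polys S y n" "y ^ n * s + a \<in> L k"
        unfolding leading_coeffs_def by blast
      obtain t where t: "t \<in> S" "t * y ^ n - y ^ n * t' \<in> polys S y n"
        using move_left st by blast
      have "t * (y ^ n * s + a) \<in> L k" using L_mult a t T(2) by blast
      moreover have "t * (y ^ n * s + a) =
          y ^ n * (t' * s) + ((t * y ^ n - y ^ n * t') * s + t * a)"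
        by (simp add: algebra_simps)
      moreover have "(t * y ^ n - y ^ n * t') * s + t * a \<in> polys S y n"
        by (intro polys_add polys_rmult polys_lmult a t)
      ultimately show ?thesis using st a S_closed(4) unfolding leading_coeffs_def by auto
    qed
    ultimately show ?thesis unfolding left_submodule_def by (auto simp: leading_coeffs_def)
  qed
  have J_lc: "J \<subseteq> ?lc n (L k)" for n k
  proof
    fix j assume "j \<in> J"
    then have "y ^ n * j \<in> J" using J(1) unfolding two_sided_set_def by blast
    with \<open>j \<in> J\<close> J(2) JL polys_zero show "j \<in> ?lc n (L k)" unfolding leading_coeffs_def by force
  qed
  have lc_mono: "?lc n (L k) \<subseteq> ?lc n (L k')" if "k \<le> k'" for n k k'
    using mono[OF that] unfolding leading_coeffs_def by blast
  have lc_Suc: "?lc n (L k) \<subseteq> ?lc (Suc n) (L k)" for n k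
  proof
    fix s assume "s \<in> ?lc n (L k)"
    then obtain a where a: "s \<in> S" "a \<in> polys S y n" "y ^ n * s + a \<in> L k"
      unfolding leading_coeffs_def by blast
    have "y * (y ^ n * s + a) \<in> L k" using L_mult a T(3) by blast
    then have "y ^ Suc n * s + y * a \<in> L k" by (simp add: distrib_left mult_assoc)
    with a polys_y show "s \<in> ?lc (Suc n) (L k)" unfolding leading_coeffs_def by blast
  qed
  have lc_mono2: "?lc n (L k) \<subseteq> ?lc n' (L k)" if "n \<le> n'" for n n' k
    using lift_Suc_mono_le[of "\<lambda>n. ?lc n (L k)"] lc_Suc that by blast
  have chain: "\<exists>N. \<forall>k\<ge>N. I k = I N"
    if "\<And>k. left_submodule S (I k)" "\<And>k. J \<subseteq> I k" "\<And>k. I k \<subseteq> I (Suc k)" for I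
    using acc that unfolding acc_over_def by blast
  have "\<exists>N. \<forall>k\<ge>N. ?lc n (L k) = ?lc n (L N)" for n
    by (rule chain[OF lc_sub J_lc lc_mono]) simp
  then obtain M where M: "\<And>n k. k \<ge> M n \<Longrightarrow> ?lc n (L k) = ?lc n (L (M n))" by metis
  \<comment> \<open>The diagonal chain controls all large degrees at once; finitely many degrees remain.\<close>
  have "?lc n (L n) \<subseteq> ?lc (Suc n) (L (Suc n))" for n
    using lc_Suc lc_mono[of n "Suc n" "Suc n"] by auto
  then have "\<exists>N. \<forall>k\<ge>N. ?lc k (L k) = ?lc N (L N)"
    by (rule chain[OF lc_sub J_lc])
  then obtain N0 where N0: "\<And>k. k \<ge> N0 \<Longrightarrow> ?lc k (L k) = ?lc N0 (L N0)" by blast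
  define N where "N = Max (insert N0 (M ` {..<N0}))"
  have N: "N0 \<le> N" "\<And>n. n < N0 \<Longrightarrow> M n \<le> N" unfolding N_def by auto
  have lc_eq: "?lc n (L k) = ?lc n (L N)" if k: "k \<ge> N" for n k
  proof (cases "n < N0")
    case True
    then show ?thesis using M[of n k] M[of n N] N(2)[of n] k by simp
  next
    case False
    have "?lc n (L k) \<subseteq> ?lc (max n k) (L (max n k))"
      using lc_mono2[of n "max n k" k] lc_mono[of k "max n k" "max n k"] by auto
    also have "\<dots> = ?lc N0 (L N0)" using False by (intro N0) auto
    also have "\<dots> \<subseteq> ?lc n (L N)"
      using lc_mono2[of N0 n N0] lc_mono[of N0 N n] False N(1) by auto
    finally show ?thesis using lc_mono[OF k] by blast
  qed
  have "L k \<subseteq> L N" if k: "k \<ge> N" for k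
  proof -
    have "f \<in> L N" if "f \<in> L k" "f \<in> polys S y n" for f n
      using that
    proof (induction n arbitrary: f)
      case 0
      then show ?case using sub[of N] by (simp add: left_submodule_def)
    next
      case (Suc n)
      then obtain s a where f: "f = y ^ n * s + a" "s \<in> S" "a \<in> polys S y n"
        by (elim polys_SucE)
      then have "s \<in> ?lc n (L k)" using Suc.prems(1) unfolding leading_coeffs_def by blast
      then obtain b where b: "b \<in> polys S y n" "y ^ n * s + b \<in> L N"
        using lc_eq[OF k] unfolding leading_coeffs_def by blast
      have "f - (y ^ n * s + b) \<in> L k"
        using left_submodule_diff[OF T(1) sub] Suc.prems(1) b mono[OF k] by blast
      moreover have "f - (y ^ n * s + b) = a - b" using f(1) by simp
      ultimately have "a - b \<in> L N" using Suc.IH polys_diff f(3) b(1) by simp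
      from L_add[OF this b(2)] have "(a - b) + (b + y ^ n * s) \<in> L N"
        by (simp only: add.commute[of b])
      then have "a + y ^ n * s \<in> L N"
        by (simp only: add.assoc[symmetric] diff_add_cancel)
      then show ?case using f(1) by (simp only: add.commute)
    qed
    moreover have "L k \<subseteq> (\<Union>n. polys S y n)"
      using sub[of k] polys_exhaust[OF T_min] unfolding left_submodule_def by blast
    ultimately show ?thesis by blast
  qed
  then show "\<exists>N. \<forall>n\<ge>N. L n = L N" using mono by blast
qed

end

end

text \<open>
  The elements that pass \<open>y\<close> modulo \<open>S\<close> form a subring.
\<close>

lemma commutation_generators:
  assumes S: "is_subring S" and G: "S = subring_gen G"
    and gen: "\<And>a. a \<in> G \<Longrightarrow> \<exists>s'\<in>S. y * a - s' * y \<in> S" and "a \<in> S"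
  shows "\<exists>s'\<in>S. y * a - s' * y \<in> S"
proof -
  define U where "U = {a \<in> S. \<exists>s'\<in>S. y * a - s' * y \<in> S}"
  note Sd = S[unfolded is_subring_def]
  have "is_subring U"
    unfolding is_subring_def
  proof (intro conjI ballI)
    show "0 \<in> U" "1 \<in> U" using Sd unfolding U_def by (auto intro: bexI[of _ 0] bexI[of _ 1])
  next
    fix a b assume "a \<in> U" "b \<in> U"
    then obtain a' b' where ab: "a \<in> S" "b \<in> S" "a' \<in> S" "b' \<in> S"
      "y * a - a' * y \<in> S" "y * b - b' * y \<in> S" unfolding U_def by blast
    have "y * (a + b) - (a' + b') * y = (y * a - a' * y) + (y * b - b' * y)"
      by (simp add: algebra_simps)
    then have "y * (a + b) - (a' + b') * y \<in> S" using ab Sd by simp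
    then show "a + b \<in> U" using ab Sd unfolding U_def by blast
    have "y * (a * b) - (a' * b') * y = (y * a - a' * y) * b + a' * (y * b - b' * y)"
      by (simp add: algebra_simps)
    then have "y * (a * b) - (a' * b') * y \<in> S" using ab Sd by simp
    then show "a * b \<in> U" using ab Sd unfolding U_def by blast
  next
    fix a assume "a \<in> U"
    then obtain a' where a: "a \<in> S" "a' \<in> S" "y * a - a' * y \<in> S" unfolding U_def by blast
    have "y * (- a) - (- a') * y = - (y * a - a' * y)" by simp
    then have "y * (- a) - (- a') * y \<in> S" using a Sd by metis
    then show "- a \<in> U" using a Sd unfolding U_def by blast
  qed
  moreover have "G \<subseteq> U" using gen subring_gen_subset G unfolding U_def by blast
  ultimately have "S \<subseteq> U" using subring_gen_minimal G by blast
  with \<open>a \<in> S\<close> show ?thesis unfolding U_def by blast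
qed

end

text \<open>
  Instantiating the facts about \<open>ring_1\<close> with this lemma yields their mirror images: the opposite
  multiplication has the same subrings and two-sided ideals, but exchanges left and right.
\<close>

lemma opposite_ring: "class.ring_1 1 (\<lambda>a b :: 'a::ring_1. b * a) (+) 0 (-) uminus"
  by standard (simp_all add: algebra_simps)

abbreviation right_acc_over :: "'a::ring_1 set \<Rightarrow> 'a set \<Rightarrow> bool"
  where "right_acc_over \<equiv> ring_1.acc_over (\<lambda>a b. b * a) (+) 0"

lemma opposite_is_subring:
  "ring_1.is_subring 1 (\<lambda>a b :: 'a::ring_1. b * a) (+) 0 uminus = is_subring"
  unfolding fun_eq_iff ring_1.is_subring_def[OF opposite_ring] is_subring_def by blast

lemma opposite_subring_gen:
  "ring_1.subring_gen 1 (\<lambda>a b :: 'a::ring_1. b * a) (+) 0 uminus = subring_gen"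
  unfolding fun_eq_iff ring_1.subring_gen_def[OF opposite_ring] subring_gen_def opposite_is_subring
  by blast

lemma opposite_two_sided_set:
  "ring_1.two_sided_set (\<lambda>a b :: 'a::ring_1. b * a) (+) 0 = two_sided_set"
  unfolding fun_eq_iff ring_1.two_sided_set_def[OF opposite_ring] two_sided_set_def by blast

definition almost_normal :: "'a::ring_1 \<Rightarrow> 'a set \<Rightarrow> 'a \<Rightarrow> bool"
  where "almost_normal y S a \<longleftrightarrow>
    (\<exists>s'\<in>S. y * a - s' * y \<in> S) \<and> (\<exists>s'\<in>S. a * y - y * s' \<in> S)"

lemma acc_over_adjoin:
  fixes y :: "'a::ring_1"
  assumes J: "two_sided_set J" "J \<subseteq> subring_gen G"
    and y: "\<And>a. a \<in> G \<Longrightarrow> almost_normal y (subring_gen G) a"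
  shows "acc_over J (subring_gen G) \<Longrightarrow> acc_over J (subring_gen (insert y G))"
    and "right_acc_over J (subring_gen G) \<Longrightarrow> right_acc_over J (subring_gen (insert y G))"
proof -
  let ?S = "subring_gen G" and ?T = "subring_gen (insert y G)"
  have left: "\<exists>s'\<in>?S. y * a - s' * y \<in> ?S" if "a \<in> ?S" for a
    using commutation_generators[OF is_subring_gen refl _ that] y unfolding almost_normal_def by blast
  have right: "\<exists>s'\<in>?S. a * y - y * s' \<in> ?S" if "a \<in> ?S" for a
    using ring_1.commutation_generators[OF opposite_ring, of ?S G y a] that y is_subring_gen[of G]
    unfolding almost_normal_def opposite_subring_gen opposite_is_subring by blast
  have T: "is_subring ?T" "?S \<subseteq> ?T" "y \<in> ?T"
    using subring_gen_subset[of "insert y G"]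
    by (auto intro!: is_subring_gen intro: subsetD[OF subring_gen_minimal[OF is_subring_gen]])
  have T_min: "?T \<subseteq> U" if "is_subring U" "?S \<subseteq> U" "y \<in> U" for U
    using that subring_gen_subset[of G] by (intro subring_gen_minimal) auto
  show "acc_over J ?T" if "acc_over J ?S"
    by (rule acc_over_extension[OF is_subring_gen right left that J T T_min])
  show "right_acc_over J ?T" if "right_acc_over J ?S"
    by (rule ring_1.acc_over_extension[OF opposite_ring, unfolded opposite_is_subring opposite_two_sided_set,
          OF is_subring_gen left right that J T T_min])
qed

section \<open>A representation by difference operators\<close>

text \<open>
  The module over the free algebra, on functions from an index set to the field, in which the letters
  act by the operators \<open>A\<close>.
\<close>

definition alg_act :: "('v \<Rightarrow> ('i \<Rightarrow> 'k) \<Rightarrow> 'i \<Rightarrow> 'k) \<Rightarrow> ('v, 'k::field) free_alg \<Rightarrow> ('i \<Rightarrow> 'k) \<Rightarrow> 'i \<Rightarrow> 'k"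
  where "alg_act A f v k =
    (\<Sum>u\<in>Poly_Mapping.keys f. Poly_Mapping.lookup f u * foldr A (letters u) v k)"

lemma alg_act_superset:
  assumes "finite S" "Poly_Mapping.keys f \<subseteq> S"
  shows "alg_act A f v k = (\<Sum>u\<in>S. Poly_Mapping.lookup f u * foldr A (letters u) v k)"
  unfolding alg_act_def using assms
  by (intro sum.mono_neutral_left) (auto simp: in_keys_iff)

lemma alg_act_add: "alg_act A (f + g) v k = alg_act A f v k + alg_act A g v k"
proof -
  let ?S = "Poly_Mapping.keys f \<union> Poly_Mapping.keys g"
  have "Poly_Mapping.keys (f + g) \<subseteq> ?S" by (rule keys_add)
  then show ?thesis
    by (simp add: alg_act_superset[of ?S] lookup_add distrib_right sum.distrib)
qed

lemma alg_act_smul: "alg_act A (c \<bullet> f) v k = c * alg_act A f v k"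
proof -
  have "Poly_Mapping.keys (c \<bullet> f) \<subseteq> Poly_Mapping.keys f" by (auto simp: in_keys_iff)
  then show ?thesis
    by (simp add: alg_act_superset[of "Poly_Mapping.keys f"] sum_distrib_left mult.assoc)
qed

lemma alg_act_zero: "alg_act A 0 v k = 0"
  by (simp add: alg_act_def)

lemma alg_act_single: "alg_act A (Poly_Mapping.single u c) v k = c * foldr A (letters u) v k"
  by (subst alg_act_superset[of "{u}"]) (auto split: if_splits)

lemma letters_zero [simp]: "letters 0 = []"
  by (simp add: zero_free_monoid_def)

lemma alg_act_one: "alg_act A 1 v = v"
  using alg_act_single[of A 0 1 v] by (simp add: fun_eq_iff)

lemma alg_act_diff: "alg_act A (f - g) v k = alg_act A f v k - alg_act A g v k"
  using alg_act_add[of A "f - g" g v k] by simp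

locale linear_action =
  fixes A :: "'v \<Rightarrow> ('i \<Rightarrow> 'k::field) \<Rightarrow> 'i \<Rightarrow> 'k"
  assumes linear: "A a (\<lambda>k. c * u k + v k) k = c * A a u k + A a v k"
begin

lemma A_zero: "A a (\<lambda>k. 0) k = 0"
  using linear[of a "-1" "\<lambda>k. 0" "\<lambda>k. 0" k] by simp

lemma A_sum: "A a (\<lambda>k. \<Sum>i\<in>S. c i * v i k) k = (\<Sum>i\<in>S. c i * A a (v i) k)"
  by (induction S rule: infinite_finite_induct) (simp_all add: A_zero linear)

lemma alg_act_gen: "alg_act A (gen a * f) v = A a (alg_act A f v)"
proof (rule ext)
  fix k
  have "gen a * f = (\<Sum>u\<in>Poly_Mapping.keys f. Poly_Mapping.single (Word (a # letters u)) (Poly_Mapping.lookup f u))"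
    by (subst (1) poly_mapping_sum_single) (simp add: sum_distrib_left gen_mult_single)
  moreover have "alg_act A (\<Sum>u\<in>S. h u) v k = (\<Sum>u\<in>S. alg_act A (h u) v k)" for S and h :: "'v free_monoid \<Rightarrow> ('v, 'k) free_alg"
    by (induction S rule: infinite_finite_induct) (simp_all add: alg_act_zero alg_act_add)
  ultimately have "alg_act A (gen a * f) v k =
      (\<Sum>u\<in>Poly_Mapping.keys f. Poly_Mapping.lookup f u * A a (foldr A (letters u) v) k)"
    by (simp add: alg_act_single)
  then show "alg_act A (gen a * f) v k = A a (alg_act A f v) k"
    by (simp add: alg_act_def[abs_def] A_sum)
qed

lemma alg_act_mult: "alg_act A (f * h) v = alg_act A f (alg_act A h v)"
proof (induction f rule: free_alg_induct)
  case (gen a f)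
  then show ?case by (simp add: mult.assoc alg_act_gen)
qed (auto simp: fun_eq_iff alg_act_one alg_act_smul alg_act_add distrib_right)

lemma two_sided_kernel: "two_sided {f. \<forall>v k. alg_act A f v k = 0}"
proof -
  have "alg_act A f (\<lambda>k. 0) k = 0" for f k
  proof (induction f arbitrary: k rule: free_alg_induct)
    case (gen a f)
    then have "alg_act A f (\<lambda>k. 0) = (\<lambda>k. 0)" by auto
    then show ?case by (simp add: alg_act_gen A_zero)
  qed (simp_all add: alg_act_one alg_act_smul alg_act_add)
  moreover have "alg_act A f v = (\<lambda>k. 0)" if "\<forall>v k. alg_act A f v k = 0" for f v
    using that by auto
  ultimately show ?thesis
    by unfold_locales (simp_all add: alg_act_zero alg_act_add alg_act_mult)
qed

end

text \<open>
  On Laurent polynomials in \<open>t\<close>, let \<open>x\<close> act by the dilation \<open>t \<mapsto> \<mu> t\<close>, \<open>z\<close> by multiplication with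
  \<open>t ^ r\<close>, and \<open>y\<close> as \<open>(\<alpha> t ^ (- s) + \<beta> t ^ r) x\<inverse>\<close>, where the bracket is the element \<open>y * x\<close> of the
  base ring. In terms of coefficient sequences this makes sense for all functions on the integers.
\<close>

locale difference_operators =
  fixes \<mu> \<alpha> \<beta> :: "'k::field" and r s :: nat
  assumes nonzero: "\<mu> \<noteq> 0" and free: "\<And>n. n > 0 \<Longrightarrow> \<mu> ^ n \<noteq> 1"
begin

fun diff_op :: "xyz \<Rightarrow> (int \<Rightarrow> 'k) \<Rightarrow> int \<Rightarrow> 'k" where
  "diff_op Gen_x v k = \<mu> powi k * v k"
| "diff_op Gen_y v k = \<alpha> * \<mu> powi (- (k + int s)) * v (k + int s) + \<beta> * \<mu> powi (- (k - int r)) * v (k - int r)"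
| "diff_op Gen_z v k = v (k - int r)"

sublocale linear_action diff_op
proof
  fix a c u v k
  show "diff_op a (\<lambda>k. c * u k + v k) k = c * diff_op a u k + diff_op a v k"
    by (cases a) (simp_all add: algebra_simps)
qed

lemma powi_inj: "\<mu> powi m = \<mu> powi n \<Longrightarrow> m = n"
  by (rule power_int_inj_of_not_root_of_unity[OF nonzero free])

text \<open>
  Laurent polynomials evaluated along the sequence \<open>\<mu> powi k\<close>. Every operator in the image of the
  representation is a finite sum of shifts with coefficients of this kind (\<open>normal_form\<close>). Such a
  coefficient is zero or nonzero at all large \<open>k\<close>, because a polynomial has finitely many roots and the
  values \<open>\<mu> powi k\<close> are distinct.
\<close>

definition exp_poly :: "(int \<Rightarrow> 'k) set"
  where "exp_poly = {h. \<exists>M Q. \<forall>k. h k = \<mu> powi (- (M * k)) * poly Q (\<mu> powi k)}"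

lemma exp_poly_I: "(\<And>k. h k = \<mu> powi (- (M * k)) * poly Q (\<mu> powi k)) \<Longrightarrow> h \<in> exp_poly"
  unfolding exp_poly_def by blast

lemma exp_poly_const: "(\<lambda>k. c) \<in> exp_poly"
  by (rule exp_poly_I[of _ 0 "[:c:]"]) simp

lemma exp_poly_powi: "h \<in> exp_poly \<Longrightarrow> (\<lambda>k. \<mu> powi (n * k) * h k) \<in> exp_poly"
proof -
  assume "h \<in> exp_poly"
  then obtain M Q where h: "\<And>k. h k = \<mu> powi (- (M * k)) * poly Q (\<mu> powi k)"
    unfolding exp_poly_def by blast
  have "\<mu> powi (n * k) * h k = \<mu> powi (- ((M - n) * k)) * poly Q (\<mu> powi k)" for k
  proof -
    have "\<mu> powi (n * k) * \<mu> powi (- (M * k)) = \<mu> powi (- ((M - n) * k))"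
      using nonzero by (simp add: algebra_simps flip: power_int_add)
    then show ?thesis by (simp add: h flip: mult.assoc)
  qed
  then show ?thesis by (rule exp_poly_I)
qed

lemma exp_poly_smult: "h \<in> exp_poly \<Longrightarrow> (\<lambda>k. c * h k) \<in> exp_poly"
proof -
  assume "h \<in> exp_poly"
  then obtain M Q where "\<And>k. h k = \<mu> powi (- (M * k)) * poly Q (\<mu> powi k)"
    unfolding exp_poly_def by blast
  then show ?thesis by (intro exp_poly_I[of _ M "smult c Q"]) (simp add: algebra_simps)
qed

lemma exp_poly_shift: "h \<in> exp_poly \<Longrightarrow> (\<lambda>k. h (k + m)) \<in> exp_poly"
proof -
  assume "h \<in> exp_poly"
  then obtain M Q where h: "\<And>k. h k = \<mu> powi (- (M * k)) * poly Q (\<mu> powi k)"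
    unfolding exp_poly_def by blast
  have "h (k + m) = \<mu> powi (- (M * k)) *
      poly (smult (\<mu> powi (- (M * m))) (pcompose Q [:0, \<mu> powi m:])) (\<mu> powi k)" for k
    using nonzero by (simp add: h poly_pcompose power_int_add power_int_diff power_int_minus field_simps)
  then show ?thesis by (rule exp_poly_I)
qed

lemma exp_poly_raise:
  assumes "\<And>k. h k = \<mu> powi (- (M * k)) * poly Q (\<mu> powi k)" "M \<le> N"
  shows "\<exists>Q. \<forall>k. h k = \<mu> powi (- (N * k)) * poly Q (\<mu> powi k)"
proof (intro exI allI)
  fix k
  have "\<mu> powi (- (N * k)) * (\<mu> powi k) ^ nat (N - M) = \<mu> powi (- (M * k))"
  proof -
    have "(\<mu> powi k) ^ nat (N - M) = \<mu> powi (k * (N - M))"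
      using assms(2) by (metis power_int_mult power_int_of_nat nat_0_le diff_ge_0_iff_ge)
    then show ?thesis using nonzero by (simp add: algebra_simps flip: power_int_add)
  qed
  then show "h k = \<mu> powi (- (N * k)) * poly (monom 1 (nat (N - M)) * Q) (\<mu> powi k)"
    by (simp add: assms(1) poly_monom flip: mult.assoc)
qed

lemma exp_poly_add:
  assumes "h \<in> exp_poly" "h' \<in> exp_poly"
  shows "(\<lambda>k. h k + h' k) \<in> exp_poly"
proof -
  from assms obtain M Q M' Q' where
    h: "\<And>k. h k = \<mu> powi (- (M * k)) * poly Q (\<mu> powi k)" and
    h': "\<And>k. h' k = \<mu> powi (- (M' * k)) * poly Q' (\<mu> powi k)"
    unfolding exp_poly_def by blast
  obtain P where P: "\<forall>k. h k = \<mu> powi (- (max M M' * k)) * poly P (\<mu> powi k)"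
    using exp_poly_raise[of h M Q "max M M'"] h by auto
  obtain P' where P': "\<forall>k. h' k = \<mu> powi (- (max M M' * k)) * poly P' (\<mu> powi k)"
    using exp_poly_raise[of h' M' Q' "max M M'"] h' by auto
  show ?thesis
    by (rule exp_poly_I[of _ "max M M'" "P + P'"]) (simp add: P P' distrib_left)
qed

lemma exp_poly_eventually_nonzero:
  assumes "h \<in> exp_poly" "h k0 \<noteq> 0"
  shows "\<exists>N. \<forall>k\<ge>N. h k \<noteq> 0"
proof -
  from assms(1) obtain M Q where h: "\<And>k. h k = \<mu> powi (- (M * k)) * poly Q (\<mu> powi k)"
    unfolding exp_poly_def by blast
  have "Q \<noteq> 0" using assms(2) h by auto
  then have "finite {t. poly Q t = 0}" by (rule poly_roots_finite)
  then have "finite ((\<lambda>k. \<mu> powi k) -` {t. poly Q t = 0})"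
    by (rule finite_vimageI) (auto intro: injI powi_inj)
  then have "finite {k. h k = 0}"
    by (rule finite_subset[rotated]) (auto simp: h nonzero)
  then obtain N where "\<And>k. h k = 0 \<Longrightarrow> k \<le> N"
    by (metis (mono_tags) Max_ge mem_Collect_eq)
  then show ?thesis by (intro exI[of _ "N + 1"]) force
qed

lemma normal_form:
  "\<exists>S h. finite S \<and> (\<forall>j. h j \<in> exp_poly) \<and> (\<forall>j k. j \<notin> S \<longrightarrow> h j k = 0) \<and>
     (\<forall>v k. alg_act diff_op f v k = (\<Sum>j\<in>S. h j k * v (k - j)))"
  (is "?P (\<lambda>v k. alg_act diff_op f v k)")
proof (induction f rule: free_alg_induct)
  let ?N = "\<lambda>F. \<exists>S h. finite S \<and> (\<forall>j. h j \<in> exp_poly) \<and> (\<forall>j k. j \<notin> S \<longrightarrow> h j k = 0) \<and>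
     (\<forall>v k. F v k = (\<Sum>j\<in>S. h j k * v (k - j)))"
  have zero: "(\<lambda>k. 0) \<in> exp_poly" using exp_poly_const[of 0] .
  have N_add: "?N (\<lambda>v k. F v k + G v k)" if F: "?N F" and G: "?N G"
    for F G :: "(int \<Rightarrow> 'k) \<Rightarrow> int \<Rightarrow> 'k"
  proof -
    from F obtain S h where h: "finite S" "\<And>j. h j \<in> exp_poly" "\<And>j k. j \<notin> S \<Longrightarrow> h j k = 0"
      "\<And>v k. F v k = (\<Sum>j\<in>S. h j k * v (k - j))" by blast
    from G obtain T g where g: "finite T" "\<And>j. g j \<in> exp_poly" "\<And>j k. j \<notin> T \<Longrightarrow> g j k = 0"
      "\<And>v k. G v k = (\<Sum>j\<in>T. g j k * v (k - j))" by blast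
    have "(\<Sum>j\<in>S. h j k * v (k - j)) = (\<Sum>j\<in>S \<union> T. h j k * v (k - j))"
      "(\<Sum>j\<in>T. g j k * v (k - j)) = (\<Sum>j\<in>S \<union> T. g j k * v (k - j))" for v k
      using h g by (auto intro!: sum.mono_neutral_left)
    then have "F v k + G v k = (\<Sum>j\<in>S \<union> T. (h j k + g j k) * v (k - j))" for v k
      by (simp add: h(4) g(4) distrib_right sum.distrib)
    then show ?thesis
      using h g by (intro exI[of _ "S \<union> T"] exI[of _ "\<lambda>j k. h j k + g j k"])
        (auto intro: exp_poly_add)
  qed
  have smult: "?N (\<lambda>v k. c * F v k)" if F: "?N F" for F :: "(int \<Rightarrow> 'k) \<Rightarrow> int \<Rightarrow> 'k" and c
  proof -
    from F obtain S h where h: "finite S" "\<And>j. h j \<in> exp_poly" "\<And>j k. j \<notin> S \<Longrightarrow> h j k = 0"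
      "\<And>v k. F v k = (\<Sum>j\<in>S. h j k * v (k - j))" by blast
    then show ?thesis
      by (intro exI[of _ S] exI[of _ "\<lambda>j k. c * h j k"])
        (auto intro: exp_poly_smult simp: sum_distrib_left mult.assoc)
  qed
  have powi: "?N (\<lambda>v k. \<mu> powi (n * k) * F v k)" if F: "?N F" for F :: "(int \<Rightarrow> 'k) \<Rightarrow> int \<Rightarrow> 'k" and n
  proof -
    from F obtain S h where h: "finite S" "\<And>j. h j \<in> exp_poly" "\<And>j k. j \<notin> S \<Longrightarrow> h j k = 0"
      "\<And>v k. F v k = (\<Sum>j\<in>S. h j k * v (k - j))" by blast
    then show ?thesis
      by (intro exI[of _ S] exI[of _ "\<lambda>j k. \<mu> powi (n * k) * h j k"])
        (auto intro: exp_poly_powi simp: sum_distrib_left mult.assoc)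
  qed
  have shift: "?N (\<lambda>v k. F v (k + m))" if F: "?N F" for F :: "(int \<Rightarrow> 'k) \<Rightarrow> int \<Rightarrow> 'k" and m
  proof -
    from F obtain S h where h: "finite S" "\<And>j. h j \<in> exp_poly" "\<And>j k. j \<notin> S \<Longrightarrow> h j k = 0"
      "\<And>v k. F v k = (\<Sum>j\<in>S. h j k * v (k - j))" by blast
    have "F v (k + m) = (\<Sum>j\<in>(\<lambda>j. j - m) ` S. h (j + m) (k + m) * v (k - j))" for v k
      by (subst sum.reindex) (auto simp: inj_on_def h(4) algebra_simps)
    moreover have "h (j + m) (k + m) = 0" if "j \<notin> (\<lambda>j. j - m) ` S" for j k
      using that h(3)[of "j + m"] by (metis add_diff_cancel_right' imageI)
    ultimately show ?thesis
      using h by (intro exI[of _ "(\<lambda>j. j - m) ` S"] exI[of _ "\<lambda>j k. h (j + m) (k + m)"])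
        (auto intro: exp_poly_shift)
  qed
  {
    case one
    show ?case
      by (intro exI[of _ "{0}"] exI[of _ "\<lambda>j k. if j = 0 then 1 else 0"])
        (auto simp: alg_act_one exp_poly_const zero)
  next
    case (gen a f)
    show ?case
    proof (cases a)
      case Gen_x
      then show ?thesis using powi[OF gen, of 1] by (simp add: alg_act_gen)
    next
      case Gen_z
      then show ?thesis using shift[OF gen, of "- int r"] by (simp add: alg_act_gen)
    next
      case Gen_y
      show ?thesis
        using N_add[OF shift[OF smult[OF powi[OF gen, of "- 1"], of \<alpha>], of "int s"]
            shift[OF smult[OF powi[OF gen, of "- 1"], of \<beta>], of "- int r"]] Gen_y
        by (simp add: alg_act_gen mult.assoc)
    qed
  next
    case (smul c f)
    then show ?case using smult[OF smul] by (simp add: alg_act_smul)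
  next
    case (add f g)
    then show ?case using N_add[OF add] by (simp add: alg_act_add)
  }
qed

text \<open>
  The topmost shift with a nonzero coefficient dominates: on a sequence with last nonzero entry far
  enough to the right it moves that last entry by \<open>J\<close> and multiplies it by a nonzero number.
\<close>

lemma leading_term:
  assumes "alg_act diff_op f v0 k0 \<noteq> 0"
  shows "\<exists>J N. \<forall>m\<ge>N. \<forall>v. v m \<noteq> 0 \<and> (\<forall>k>m. v k = 0) \<longrightarrow>
    alg_act diff_op f v (m + J) \<noteq> 0 \<and> (\<forall>k>m + J. alg_act diff_op f v k = 0)"
proof -
  obtain S h where h: "finite S" "\<And>j. h j \<in> exp_poly" "\<And>j k. j \<notin> S \<Longrightarrow> h j k = 0"
    "\<And>v k. alg_act diff_op f v k = (\<Sum>j\<in>S. h j k * v (k - j))" using normal_form[of f] by blast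
  define T where "T = {j. \<exists>k. h j k \<noteq> 0}"
  have T: "T \<subseteq> S" using h(3) unfolding T_def by blast
  then have fin: "finite T" using h(1) finite_subset by blast
  have act: "alg_act diff_op f v k = (\<Sum>j\<in>T. h j k * v (k - j))" for v k
    unfolding h(4) by (rule sum.mono_neutral_right[OF h(1) T]) (auto simp: T_def)
  have "T \<noteq> {}" using assms act by force
  define J where "J = Max T"
  have J: "J \<in> T" "\<And>j. j \<in> T \<Longrightarrow> j \<le> J" using fin \<open>T \<noteq> {}\<close> unfolding J_def by auto
  then obtain N where N: "\<And>k. k \<ge> N \<Longrightarrow> h J k \<noteq> 0"
    using exp_poly_eventually_nonzero[OF h(2)] unfolding T_def by blast
  have main: "alg_act diff_op f v (m + J) \<noteq> 0 \<and> (\<forall>k>m + J. alg_act diff_op f v k = 0)"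
    if m: "m \<ge> N - J" and v: "v m \<noteq> 0" "\<And>k. k > m \<Longrightarrow> v k = 0" for m v
  proof
    have "alg_act diff_op f v (m + J) = (\<Sum>j\<in>T. if j = J then h J (m + J) * v m else 0)"
      unfolding act
    proof (rule sum.cong)
      fix j assume "j \<in> T"
      show "h j (m + J) * v (m + J - j) = (if j = J then h J (m + J) * v m else 0)"
        using J(2)[OF \<open>j \<in> T\<close>] v(2)[of "m + J - j"] by auto
    qed simp
    also have "\<dots> = h J (m + J) * v m" using fin J(1) by simp
    finally show "alg_act diff_op f v (m + J) \<noteq> 0" using N[of "m + J"] m v(1) by simp
    show "\<forall>k>m + J. alg_act diff_op f v k = 0"
    proof (intro allI impI)
      fix k assume k: "k > m + J"
      show "alg_act diff_op f v k = 0"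
        unfolding act using J(2) k by (intro sum.neutral ballI) (force intro: v(2))
    qed
  qed
  show ?thesis
    by (intro exI[of _ J] exI[of _ "N - J"] allI impI main) simp_all
qed

text \<open>
  Applied to a unit sequence far enough to the right, both factors move the last nonzero entry, and
  so does the product.
\<close>

lemma act_domain:
  assumes "alg_act diff_op f v k \<noteq> 0" "alg_act diff_op h u l \<noteq> 0"
  shows "\<exists>v k. alg_act diff_op (f * h) v k \<noteq> 0"
proof -
  obtain J N where f: "\<forall>m\<ge>N. \<forall>v. v m \<noteq> 0 \<and> (\<forall>k>m. v k = 0) \<longrightarrow>
    alg_act diff_op f v (m + J) \<noteq> 0 \<and> (\<forall>k>m + J. alg_act diff_op f v k = 0)"
    using leading_term[OF assms(1)] by (elim exE)
  obtain J' N' where h: "\<forall>m\<ge>N'. \<forall>v. v m \<noteq> 0 \<and> (\<forall>k>m. v k = 0) \<longrightarrow>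
    alg_act diff_op h v (m + J') \<noteq> 0 \<and> (\<forall>k>m + J'. alg_act diff_op h v k = 0)"
    using leading_term[OF assms(2)] by (elim exE)
  define m where "m = max N' (N - J')"
  define \<delta> where "\<delta> = (\<lambda>k. if k = m then 1 else 0 :: 'k)"
  have "alg_act diff_op h \<delta> (m + J') \<noteq> 0 \<and> (\<forall>k>m + J'. alg_act diff_op h \<delta> k = 0)"
    by (rule h[rule_format]) (auto simp: m_def \<delta>_def)
  then have "alg_act diff_op f (alg_act diff_op h \<delta>) (m + J' + J) \<noteq> 0"
    by (intro f[rule_format, THEN conjunct1]) (auto simp: m_def)
  then show ?thesis by (auto simp: alg_act_mult)
qed

end

section \<open>The standard identity\<close>

text \<open>
  The standard polynomial of degree \<open>d\<close>, evaluated in a ring.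
\<close>

definition standard_sum :: "nat \<Rightarrow> (nat \<Rightarrow> 'a::ring_1) \<Rightarrow> 'a"
  where "standard_sum d h = (\<Sum>\<sigma> | \<sigma> permutes {..<d}. of_int (sign \<sigma>) * prod_list (map h (map \<sigma> [0..<d])))"

definition standard_poly :: "nat \<Rightarrow> (nat, int) free_alg"
  where "standard_poly d =
    (\<Sum>\<sigma> | \<sigma> permutes {..<d}. Poly_Mapping.single (Word (map \<sigma> [0..<d])) (sign \<sigma>))"

lemma permutes_word_inj: "inj_on (\<lambda>\<sigma>. Word (map \<sigma> [0..<d])) {\<sigma>. \<sigma> permutes {..<d}}"
proof (rule inj_onI)
  fix \<sigma> \<tau> :: "nat \<Rightarrow> nat"
  assume *: "\<sigma> \<in> {\<sigma>. \<sigma> permutes {..<d}}" "\<tau> \<in> {\<sigma>. \<sigma> permutes {..<d}}"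
    "Word (map \<sigma> [0..<d]) = Word (map \<tau> [0..<d])"
  show "\<sigma> = \<tau>"
  proof
    fix i
    show "\<sigma> i = \<tau> i"
    proof (cases "i < d")
      case True
      then show ?thesis using *(3) by simp
    next
      case False
      then have "\<sigma> i = i" "\<tau> i = i" using *(1,2) by (auto intro: permutes_not_in)
      then show ?thesis by simp
    qed
  qed
qed

lemma finite_perms: "finite {\<sigma>. \<sigma> permutes {..<d::nat}}"
  by (rule finite_permutations) simp

lemma lookup_standard_poly:
  assumes "\<sigma> permutes {..<d}"
  shows "Poly_Mapping.lookup (standard_poly d) (Word (map \<sigma> [0..<d])) = sign \<sigma>"
proof -
  have "Poly_Mapping.lookup (standard_poly d) (Word (map \<sigma> [0..<d])) =
      (\<Sum>\<tau> | \<tau> permutes {..<d}. if \<tau> = \<sigma> then sign \<sigma> else 0)"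
    unfolding standard_poly_def lookup_sum
    using assms inj_onD[OF permutes_word_inj[of d]]
    by (intro sum.cong) (auto simp: lookup_single when_def)
  then show ?thesis using assms finite_perms by simp
qed

lemma keys_standard_poly:
  "Poly_Mapping.keys (standard_poly d) = (\<lambda>\<sigma>. Word (map \<sigma> [0..<d])) ` {\<sigma>. \<sigma> permutes {..<d}}"
proof
  show "Poly_Mapping.keys (standard_poly d) \<subseteq> (\<lambda>\<sigma>. Word (map \<sigma> [0..<d])) ` {\<sigma>. \<sigma> permutes {..<d}}"
  proof
    fix u assume "u \<in> Poly_Mapping.keys (standard_poly d)"
    then have "(\<Sum>\<sigma> | \<sigma> permutes {..<d}.
        Poly_Mapping.lookup (Poly_Mapping.single (Word (map \<sigma> [0..<d])) (sign \<sigma>)) u) \<noteq> 0"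
      by (simp add: in_keys_iff standard_poly_def lookup_sum)
    then obtain \<sigma> where "\<sigma> permutes {..<d}"
      "Poly_Mapping.lookup (Poly_Mapping.single (Word (map \<sigma> [0..<d])) (sign \<sigma>)) u \<noteq> 0"
      by (metis (mono_tags, lifting) mem_Collect_eq sum.neutral)
    then show "u \<in> (\<lambda>\<sigma>. Word (map \<sigma> [0..<d])) ` {\<sigma>. \<sigma> permutes {..<d}}"
      by (auto simp: lookup_single when_def split: if_splits)
  qed
  show "(\<lambda>\<sigma>. Word (map \<sigma> [0..<d])) ` {\<sigma>. \<sigma> permutes {..<d}} \<subseteq> Poly_Mapping.keys (standard_poly d)"
    by (auto simp: in_keys_iff lookup_standard_poly sign_def)
qed

lemma nc_monic_standard_poly: "nc_monic (standard_poly d)"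
  unfolding nc_monic_def
proof (intro exI conjI)
  show "Poly_Mapping.lookup (standard_poly d) (Word (map id [0..<d])) = 1"
    using lookup_standard_poly[OF permutes_id] by (simp add: sign_id)
qed (auto simp: keys_standard_poly)

lemma standard_poly_eval:
  "(\<Sum>u\<in>Poly_Mapping.keys (standard_poly d).
     of_int (Poly_Mapping.lookup (standard_poly d) u) * prod_list (map h (letters u))) = standard_sum d h"
  unfolding keys_standard_poly standard_sum_def
  by (subst sum.reindex[OF permutes_word_inj]) (simp add: lookup_standard_poly)

text \<open>
  Composition with the transposition of \<open>i\<close> and \<open>j\<close> permutes the summands and changes their
  signs. This shows that twice the sum vanishes.
\<close>

lemma standard_alternating:
  assumes "i < d" "j < d" "i \<noteq> j" "h i = h j"
  shows "standard_sum d h + standard_sum d h = 0"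
proof -
  let ?\<tau> = "transpose i j"
  let ?t = "\<lambda>\<sigma>. of_int (sign \<sigma>) * prod_list (map h (map \<sigma> [0..<d]))"
  have \<tau>: "?\<tau> permutes {..<d}" using assms(1,2) by (intro permutes_swap_id) auto
  have "standard_sum d h = (\<Sum>\<sigma> | \<sigma> permutes {..<d}. ?t (?\<tau> \<circ> \<sigma>))"
    unfolding standard_sum_def by (rule setum_permutations_compose_left[OF \<tau>])
  also have "\<dots> = (\<Sum>\<sigma> | \<sigma> permutes {..<d}. - ?t \<sigma>)"
  proof (rule sum.cong)
    fix \<sigma> assume "\<sigma> \<in> {\<sigma>. \<sigma> permutes {..<d}}"
    then have "permutation \<sigma>" using permutation_permutes[of \<sigma>] by blast
    then have "sign (?\<tau> \<circ> \<sigma>) = - sign \<sigma>"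
      using assms(3) by (simp add: sign_compose permutation_swap_id sign_swap_id)
    moreover have "h (?\<tau> k) = h k" for k
      using assms(4) by (auto simp: transpose_def)
    ultimately show "?t (?\<tau> \<circ> \<sigma>) = - ?t \<sigma>" by (simp add: comp_def)
  qed simp
  also have "\<dots> = - standard_sum d h" by (simp add: standard_sum_def sum_negf)
  finally show ?thesis by (simp add: eq_neg_iff_add_eq_0)
qed

lemma prod_list_upd_add:
  assumes "distinct us" "i \<in> set us"
  shows "prod_list (map (h(i := a + b)) us) =
    prod_list (map (h(i := a)) us) + prod_list (map (h(i := b)) us :: 'a::ring_1 list)"
  using assms
proof (induction us)
  case (Cons u us)
  show ?case
  proof (cases "u = i")
    case True
    with Cons.prems have rest: "map (h(i := t)) us = map h us" for t by auto
    show ?thesis unfolding True list.map rest prod_list.Cons fun_upd_same by (rule distrib_right)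
  next
    case False
    with Cons show ?thesis by (simp add: distrib_left)
  qed
qed simp

lemma permutes_list:
  assumes "\<sigma> permutes {..<d}"
  shows "distinct (map \<sigma> [0..<d])" "set (map \<sigma> [0..<d]) = {..<d}"
  using assms permutes_inj_on[OF assms] permutes_image[OF assms]
  by (auto simp: distinct_map atLeast0LessThan)

lemma standard_add:
  assumes "i < d"
  shows "standard_sum d (h(i := a + b)) = standard_sum d (h(i := a)) + standard_sum d (h(i := b))"
  unfolding standard_sum_def sum.distrib[symmetric]
proof (rule sum.cong)
  fix \<sigma> assume "\<sigma> \<in> {\<sigma>. \<sigma> permutes {..<d}}"
  then have \<sigma>: "\<sigma> permutes {..<d}" by simp
  show "of_int (sign \<sigma>) * prod_list (map (h(i := a + b)) (map \<sigma> [0..<d])) =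
    of_int (sign \<sigma>) * prod_list (map (h(i := a)) (map \<sigma> [0..<d])) +
    of_int (sign \<sigma>) * prod_list (map (h(i := b)) (map \<sigma> [0..<d]))"
    using prod_list_upd_add[of "map \<sigma> [0..<d]" i h a b] permutes_list[OF \<sigma>] assms
    by (simp only: distrib_left lessThan_iff)
qed simp

context two_sided
begin

definition central :: "'a \<Rightarrow> bool"
  where "central c \<longleftrightarrow> (\<forall>a. c * a \<doteq> a * c)"

lemma central_mult: "central c \<Longrightarrow> central c' \<Longrightarrow> central (c * c')"
proof -
  assume c: "central c" "central c'"
  have "c * c' * a \<doteq> a * (c * c')" for a
  proof -
    have "c * c' * a = c * (c' * a)" by (simp add: mult.assoc)
    also have "\<dots> \<doteq> c * (a * c')" using c by (intro eqv_multL) (simp add: central_def)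
    also have "c * (a * c') = c * a * c'" by (simp add: mult.assoc)
    also have "\<dots> \<doteq> a * c * c'" using c by (intro eqv_multR) (simp add: central_def)
    finally show ?thesis by (simp add: mult.assoc)
  qed
  then show ?thesis by (simp add: central_def)
qed

lemma central_one: "central 1"
  by (simp add: central_def)

lemma central_power: "central c \<Longrightarrow> central (c ^ n)"
  by (induction n) (auto intro: central_mult central_one)

lemma prod_list_upd_central:
  assumes "distinct us" "i \<in> set us" "central c"
  shows "prod_list (map (h(i := c * a)) us) \<doteq> c * prod_list (map (h(i := a)) us)"
  using assms(1,2)
proof (induction us)
  case (Cons u us)
  show ?case
  proof (cases "u = i")
    case True
    with Cons.prems have rest: "map (h(i := t)) us = map h us" for t by auto
    show ?thesis unfolding True list.map rest prod_list.Cons fun_upd_same mult.assoc by (rule eqv_refl)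
  next
    case False
    have head: "prod_list (map (h(i := t)) (u # us)) = h u * prod_list (map (h(i := t)) us)" for t
      using False by simp
    have "h u * prod_list (map (h(i := c * a)) us) \<doteq> h u * (c * prod_list (map (h(i := a)) us))"
      using Cons.prems False by (intro eqv_multL Cons.IH) auto
    also have "h u * (c * prod_list (map (h(i := a)) us)) = h u * c * prod_list (map (h(i := a)) us)"
      by (simp add: mult.assoc)
    also have "\<dots> \<doteq> c * h u * prod_list (map (h(i := a)) us)"
      using assms(3) by (intro eqv_multR eqv_sym[of "c * h u"]) (simp add: central_def)
    finally show ?thesis by (simp only: head mult.assoc)
  qed
qed simp

lemma standard_central:
  assumes "i < d" "central c"
  shows "standard_sum d (h(i := c * a)) \<doteq> c * standard_sum d (h(i := a))"
  unfolding standard_sum_def sum_distrib_left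
proof (rule eqv_sum)
  fix \<sigma> assume "\<sigma> \<in> {\<sigma>. \<sigma> permutes {..<d}}"
  then have \<sigma>: "\<sigma> permutes {..<d}" by simp
  have "of_int (sign \<sigma>) * prod_list (map (h(i := c * a)) (map \<sigma> [0..<d]))
      \<doteq> of_int (sign \<sigma>) * (c * prod_list (map (h(i := a)) (map \<sigma> [0..<d])))"
    using permutes_list[OF \<sigma>] assms by (intro eqv_multL prod_list_upd_central) auto
  then show "of_int (sign \<sigma>) * prod_list (map (h(i := c * a)) (map \<sigma> [0..<d]))
      \<doteq> c * (of_int (sign \<sigma>) * prod_list (map (h(i := a)) (map \<sigma> [0..<d])))"
    by (simp only: mult_of_int_commute mult.assoc)
qed

lemma standard_eqv:
  assumes "\<And>i. i < d \<Longrightarrow> h i \<doteq> h' i"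
  shows "standard_sum d h \<doteq> standard_sum d h'"
  unfolding standard_sum_def
  using assms permutes_in_image
  by (intro eqv_sum eqv_multL eqv_prod_list) (fastforce simp: permutes_list)

text \<open>
  The span of \<open>B\<close> over the centre modulo the ideal.
\<close>

inductive_set central_span :: "'a set \<Rightarrow> 'a set" for B where
  zero: "0 \<in> central_span B"
| step: "central c \<Longrightarrow> b \<in> B \<Longrightarrow> a \<in> central_span B \<Longrightarrow> c * b + a \<in> central_span B"

lemma central_span_add: "a \<in> central_span B \<Longrightarrow> b \<in> central_span B \<Longrightarrow> a + b \<in> central_span B"
  by (induction rule: central_span.induct) (auto simp: add.assoc intro: central_span.step)

text \<open>
  By multilinearity over the centre the arguments may be taken from \<open>B\<close>, one position after the
  other; as \<open>B\<close> has fewer than \<open>d\<close> elements two of them then coincide.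
\<close>

lemma standard_identity:
  assumes torsion: "\<And>a. a + a \<in> K \<Longrightarrow> a \<in> K"
    and B: "finite B" "card B < d"
    and span: "\<And>i. i < d \<Longrightarrow> \<exists>a\<in>central_span B. h i \<doteq> a"
  shows "standard_sum d h \<in> K"
proof -
  have *: "standard_sum d h \<in> K"
    if "\<And>j. j < k \<Longrightarrow> h j \<in> central_span B" "\<And>j. k \<le> j \<Longrightarrow> j < d \<Longrightarrow> h j \<in> B" "k \<le> d" for k h
    using that
  proof (induction k arbitrary: h)
    case 0
    then have "h ` {..<d} \<subseteq> B" by auto
    then have "card (h ` {..<d}) \<le> card B" by (rule card_mono[OF B(1)])
    with B(2) have "card (h ` {..<d}) < card {..<d}" by simp
    then have "\<not> inj_on h {..<d}" by (rule pigeonhole)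
    then obtain i j where "i < d" "j < d" "i \<noteq> j" "h i = h j" unfolding inj_on_def by auto
    then have "standard_sum d h + standard_sum d h = 0" by (rule standard_alternating)
    then show ?case using torsion zero_mem by simp
  next
    case (Suc k)
    have "standard_sum d (h(k := a)) \<in> K" if "a \<in> central_span B" for a
      using that
    proof (induction rule: central_span.induct)
      case zero
      have "standard_sum d (h(k := 0 + 0)) = standard_sum d (h(k := 0)) + standard_sum d (h(k := 0))"
        using Suc.prems by (intro standard_add) simp
      then have "standard_sum d (h(k := 0)) = 0" by simp
      then show ?case by (simp only: zero_mem)
    next
      case (step c b a)
      have "standard_sum d (h(k := b)) \<in> K"
        using Suc.prems step by (intro Suc.IH) auto
      then have "c * standard_sum d (h(k := b)) \<in> K" by (rule lmult_mem)
      then have "standard_sum d (h(k := c * b)) \<in> K"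
        using eqv_mem[OF standard_central[OF _ step(1)]] Suc.prems by simp
      moreover have "standard_sum d (h(k := a)) \<in> K"
        using step.IH by (simp only: fun_upd_def)
      ultimately have "standard_sum d (h(k := c * b + a)) \<in> K"
        using Suc.prems by (simp add: standard_add add_mem)
      then show ?case by (simp only: fun_upd_def)
    qed
    from this[of "h k"] show ?case using Suc.prems by simp
  qed
  obtain h' where h': "\<And>i. i < d \<Longrightarrow> h' i \<in> central_span B \<and> h i \<doteq> h' i"
    using span by metis
  then have "standard_sum d h' \<in> K" by (intro *[of d]) auto
  then show ?thesis using eqv_mem[OF standard_eqv] h' by blast
qed

end

section \<open>Roots of unity\<close>

lemma (in two_sided_alg) central_gens:
  assumes "\<And>v. c * gen v \<doteq> gen v * c"
  shows "central c"
  unfolding central_def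
proof
  fix a
  show "c * a \<doteq> a * c"
  proof (induction a rule: free_alg_induct)
    case (gen v f)
    have "c * (gen v * f) = c * gen v * f" by (simp add: mult.assoc)
    also have "\<dots> \<doteq> gen v * c * f" by (intro eqv_multR assms)
    also have "gen v * c * f = gen v * (c * f)" by (simp add: mult.assoc)
    also have "\<dots> \<doteq> gen v * (f * c)" by (intro eqv_multL gen)
    finally show ?case by (simp add: mult.assoc)
  qed (auto simp: distrib_left distrib_right intro: eqv_smul eqv_add)
qed

lemma (in two_sided_alg) central_smul: "central a \<Longrightarrow> central (c \<bullet> a)"
  by (auto simp: central_def intro: eqv_smul)

context weyl_relations
begin

text \<open>
  If \<open>p ^ N = q ^ N = 1\<close>, the \<open>N\<close>-th powers of \<open>x\<close>, \<open>y\<close>, \<open>z\<close> and \<open>w\<close> are central. Division of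
  exponents by \<open>N\<close> then leaves finitely many monomials that span the algebra over its centre.
\<close>

context
  fixes N :: nat
  assumes N0: "N > 0" and pN: "p ^ N = 1" and qN: "q ^ N = 1"
begin

lemma xN_y: "x ^ N * y \<doteq> y * x ^ N"
proof -
  obtain m where m: "N = Suc m" using N0 by (cases N) auto
  have qm: "inverse q ^ m = q" and pm: "p ^ m = inverse p"
    using pN qN p0 q0 by (simp_all add: m field_simps)
  have "x ^ N * y = x ^ m * (x * y)" by (simp only: m power_Suc2 mult.assoc)
  also have "\<dots> \<doteq> x ^ m * (g \<bullet> (w - z))" by (intro eqv_multL xy)
  also have "x ^ m * (g \<bullet> (w - z)) = g \<bullet> (x ^ m * w - x ^ m * z)" by (simp add: right_diff_distrib)
  also have "\<dots> \<doteq> g \<bullet> (inverse q ^ m \<bullet> (w * x ^ m) - p ^ m \<bullet> (z * x ^ m))"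
    by (intro eqv_smul eqv_diff qcommute_power_left xw xz)
  also have "\<dots> = g \<bullet> (q \<bullet> w - inverse p \<bullet> z) * x ^ m"
    by (simp add: qm pm left_diff_distrib)
  also have "\<dots> \<doteq> y * x * x ^ m" by (intro eqv_multR eqv_sym[OF yx])
  finally show ?thesis by (simp add: m mult.assoc)
qed

lemma yN_x: "y ^ N * x \<doteq> x * y ^ N"
proof -
  obtain m where m: "N = Suc m" using N0 by (cases N) auto
  have qm: "q * q ^ m = 1" and pm: "inverse p * inverse p ^ m = 1"
    using pN qN p0 q0 by (simp_all add: m field_simps)
  have "y ^ N * x = y ^ m * (y * x)" by (simp only: m power_Suc2 mult.assoc)
  also have "\<dots> \<doteq> y ^ m * (g \<bullet> (q \<bullet> w - inverse p \<bullet> z))" by (intro eqv_multL yx)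
  also have "\<dots> = g \<bullet> (q \<bullet> (y ^ m * w) - inverse p \<bullet> (y ^ m * z))" by (simp add: right_diff_distrib)
  also have "\<dots> \<doteq> g \<bullet> (q \<bullet> q ^ m \<bullet> (w * y ^ m) - inverse p \<bullet> inverse p ^ m \<bullet> (z * y ^ m))"
    by (intro eqv_smul eqv_diff qcommute_power_left yw yz)
  also have "\<dots> = g \<bullet> (w - z) * y ^ m"
    by (simp only: qm pm smul_smul one_smul left_diff_distrib smul_mult_left)
  also have "\<dots> \<doteq> x * y * y ^ m" by (intro eqv_multR eqv_sym[OF xy])
  finally show ?thesis by (simp add: m mult.assoc)
qed

lemma central_N: "central (z ^ N)" "central (w ^ N)" "central (x ^ N)" "central (y ^ N)"
proof -
  have ip: "inverse p ^ N = 1" and iq: "inverse q ^ N = 1"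
    using pN qN by (simp_all add: power_inverse)
  have left: "a ^ N * b \<doteq> b * a ^ N" if "a * b \<doteq> c \<bullet> (b * a)" "c ^ N = 1" for a b c
    using qcommute_power_left[OF that(1), of N] that(2) by simp
  have all: "central c" if "c * x \<doteq> x * c" "c * y \<doteq> y * c" "c * z \<doteq> z * c" for c
  proof (rule central_gens)
    fix v
    show "c * gen v \<doteq> gen v * c" using that by (cases v) simp_all
  qed
  show "central (z ^ N)"
    by (intro all left[OF zx ip] left[OF zy pN] left[of z z 1]) auto
  show "central (w ^ N)"
    by (intro all left[OF wx qN] left[OF wy iq] left[of w z 1]) (auto simp: wz)
  show "central (x ^ N)"
    by (intro all xN_y left[OF xz pN] left[of x x 1]) auto
  show "central (y ^ N)"
    by (intro all yN_x left[OF yz ip] left[of y y 1]) auto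
qed

definition basis :: "(xyz, 'k) free_alg set"
  where "basis = (\<lambda>(i, j, n). z ^ i * w ^ j * x ^ n) ` ({..<N} \<times> {..<N} \<times> {..<N}) \<union>
    (\<lambda>(i, j, n). z ^ i * w ^ j * y ^ n) ` ({..<N} \<times> {..<N} \<times> {..<N})"

lemma finite_basis: "finite basis"
  by (simp add: basis_def)

lemma split_power:
  assumes "central (b ^ N)"
  shows "\<exists>c. central c \<and> a * b ^ n \<doteq> c * (a * b ^ (n mod N))"
proof (intro exI conjI)
  show c: "central ((b ^ N) ^ (n div N))" by (rule central_power[OF assms])
  have "a * b ^ n = a * b ^ (n mod N) * (b ^ N) ^ (n div N)"
    by (simp add: mult.assoc add.commute flip: power_mult power_add)
  also have "\<dots> \<doteq> (b ^ N) ^ (n div N) * (a * b ^ (n mod N))"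
    using c by (intro eqv_sym[of "(b ^ N) ^ (n div N) * _"]) (simp add: central_def)
  finally show "a * b ^ n \<doteq> (b ^ N) ^ (n div N) * (a * b ^ (n mod N))" .
qed

lemma split_monomial:
  assumes "central (b ^ N)"
  shows "\<exists>c. central c \<and> z ^ i * w ^ j * b ^ n \<doteq> c * (z ^ (i mod N) * w ^ (j mod N) * b ^ (n mod N))"
proof -
  obtain c1 where c1: "central c1" "1 * z ^ i \<doteq> c1 * (1 * z ^ (i mod N))"
    using split_power[OF central_N(1)] by blast
  obtain c2 where c2: "central c2" "z ^ i * w ^ j \<doteq> c2 * (z ^ i * w ^ (j mod N))"
    using split_power[OF central_N(2)] by blast
  obtain c3 where c3: "central c3" "z ^ i * w ^ j * b ^ n \<doteq> c3 * (z ^ i * w ^ j * b ^ (n mod N))"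
    using split_power[OF assms] by blast
  have "z ^ i * w ^ j * b ^ n \<doteq> c3 * (z ^ i * w ^ j * b ^ (n mod N))" by (rule c3)
  also have "\<dots> \<doteq> c3 * (c2 * (z ^ i * w ^ (j mod N)) * b ^ (n mod N))"
    by (intro eqv_multL eqv_multR c2)
  also have "\<dots> = c3 * (c2 * (1 * z ^ i * w ^ (j mod N)) * b ^ (n mod N))" by simp
  also have "\<dots> \<doteq> c3 * (c2 * (c1 * (1 * z ^ (i mod N)) * w ^ (j mod N)) * b ^ (n mod N))"
    by (intro eqv_multL eqv_multR c1)
  also have "\<dots> = c3 * c2 * c1 * (z ^ (i mod N) * w ^ (j mod N) * b ^ (n mod N))"
    by (simp add: mult.assoc)
  finally show ?thesis using c1(1) c2(1) c3(1) central_mult by blast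
qed

lemma basis_span: "\<exists>b\<in>central_span basis. a \<doteq> b"
  using normal_UNIV[of a]
proof (induction rule: normal_span.induct)
  case (normal_x c i j n)
  obtain d where d: "central d"
    "z ^ i * w ^ j * x ^ n \<doteq> d * (z ^ (i mod N) * w ^ (j mod N) * x ^ (n mod N))"
    using split_monomial[OF central_N(3)] by blast
  have "z ^ (i mod N) * w ^ (j mod N) * x ^ (n mod N) \<in> basis"
    using N0 by (auto simp: basis_def intro!: image_eqI[of _ _ "(i mod N, j mod N, n mod N)"])
  from central_span.step[OF central_smul[OF d(1), of c] this central_span.zero]
  show ?case using eqv_smul[OF d(2), of c] by (intro bexI) auto
next
  case (normal_y c i j n)
  obtain d where d: "central d"
    "z ^ i * w ^ j * y ^ n \<doteq> d * (z ^ (i mod N) * w ^ (j mod N) * y ^ (n mod N))"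
    using split_monomial[OF central_N(4)] by blast
  have "z ^ (i mod N) * w ^ (j mod N) * y ^ (n mod N) \<in> basis"
    using N0 by (auto simp: basis_def intro!: image_eqI[of _ _ "(i mod N, j mod N, n mod N)"])
  from central_span.step[OF central_smul[OF d(1), of c] this central_span.zero]
  show ?case using eqv_smul[OF d(2), of c] by (intro bexI) auto
next
  case (normal_add a b)
  then show ?case using central_span_add eqv_add by blast
next
  case (normal_eqv a b)
  then show ?case using eqv_trans[OF eqv_sym] by blast
qed

lemma standard_identity_root_of_unity:
  assumes "(2::'k) \<noteq> 0"
  shows "standard_sum (Suc (card basis)) h \<in> K"
proof (rule standard_identity)
  fix a assume "a + a \<in> K"
  then have "2 \<bullet> a \<in> K" using add_smul[of 1 1 a] by simp
  then show "a \<in> K" using smul_mem_iff[OF assms] by blast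
qed (use finite_basis basis_span in auto)

end

end

section \<open>Transfer along a surjection\<close>

text \<open>
  A ring given as a quotient of a type with ring structure. Its ideals correspond to the ideals of
  the type that contain the kernel, so its ring-theoretic properties can be read off upstairs.
\<close>

locale quotient_map =
  fixes R :: "('b, 'm) ring_scheme" and \<pi> :: "'a::ring_1 \<Rightarrow> 'b"
  assumes ring_R: "ring R"
    and hom: "\<pi> \<in> ring_hom ring_of_type_algebra R"
    and surj: "\<pi> ` UNIV = carrier R"
begin

sublocale R: ring R by (rule ring_R)

definition ker :: "'a set"
  where "ker = {a. \<pi> a = \<zero>\<^bsub>R\<^esub>}"

lemma closed: "\<pi> a \<in> carrier R"
  using surj by blast

lemma hom_add: "\<pi> (a + b) = \<pi> a \<oplus>\<^bsub>R\<^esub> \<pi> b"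
  and hom_mult: "\<pi> (a * b) = \<pi> a \<otimes>\<^bsub>R\<^esub> \<pi> b"
  and hom_one: "\<pi> 1 = \<one>\<^bsub>R\<^esub>"
  using ring_hom_add[OF hom] ring_hom_mult[OF hom] ring_hom_one[OF hom]
  by (simp_all add: ring_of_type_algebra_def)

lemma hom_zero: "\<pi> 0 = \<zero>\<^bsub>R\<^esub>"
  using hom_add[of 0 0] closed[of 0] R.add.r_cancel_one by simp

lemma hom_uminus: "\<pi> (- a) = \<ominus>\<^bsub>R\<^esub> \<pi> a"
  using hom_add[of "- a" a] closed hom_zero by (simp add: R.minus_equality)

lemma hom_diff: "\<pi> (a - b) = \<pi> a \<ominus>\<^bsub>R\<^esub> \<pi> b"
  using hom_add[of a "- b"] by (simp add: hom_uminus R.minus_eq)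

lemma eq_iff: "\<pi> a = \<pi> b \<longleftrightarrow> a - b \<in> ker"
  unfolding ker_def using hom_diff closed R.r_right_minus_eq by simp

lemma hom_sum: "finite A \<Longrightarrow> (\<Oplus>\<^bsub>R\<^esub>u\<in>A. \<pi> (f u)) = \<pi> (sum f A)"
  by (induction A rule: finite_induct) (auto simp: hom_zero hom_add closed Pi_iff)

lemma hom_of_nat: "add_pow R (n :: nat) (\<pi> a) = \<pi> (of_nat n * a)"
proof (induction n)
  case 0
  show ?case by (simp add: hom_zero)
next
  case (Suc n)
  then show ?case by (simp add: R.add.nat_pow_Suc closed distrib_right hom_add R.add.m_comm)
qed

lemma hom_of_int: "add_pow R (n :: int) (\<pi> a) = \<pi> (of_int n * a)"
proof (cases "n \<ge> 0")
  case True
  then show ?thesis by (simp add: add_pow_int_ge hom_of_nat)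
next
  case False
  then have "add_pow R n (\<pi> a) = \<ominus>\<^bsub>R\<^esub> \<pi> (of_nat (nat (- n)) * a)"
    by (simp add: add_pow_int_lt hom_of_nat)
  also have "\<dots> = \<pi> (of_int n * a)"
    using False by (simp flip: hom_uminus)
  finally show ?thesis .
qed

lemma hom_word: "foldr (\<otimes>\<^bsub>R\<^esub>) (map (\<lambda>v. \<pi> (\<phi> v)) u) \<one>\<^bsub>R\<^esub> = \<pi> (prod_list (map \<phi> u))"
  by (induction u) (simp_all add: hom_one hom_mult)

lemma hom_nc_eval: "nc_eval R (\<lambda>v. \<pi> (\<phi> v)) f =
    \<pi> (\<Sum>u\<in>Poly_Mapping.keys f. of_int (Poly_Mapping.lookup f u) * prod_list (map \<phi> (letters u)))"
  unfolding nc_eval_def hom_word hom_of_int by (rule hom_sum) simp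

lemma PI_ringI:
  assumes "\<And>h. standard_sum d h \<in> ker"
  shows "PI_ring R"
  unfolding PI_ring_def
proof (intro conjI exI ballI ring_R)
  show "nc_monic (standard_poly d)" by (rule nc_monic_standard_poly)
  fix \<phi> :: "nat \<Rightarrow> 'b" assume "\<phi> \<in> UNIV \<rightarrow> carrier R"
  then have "\<forall>v. \<exists>a. \<phi> v = \<pi> a" using surj by (metis PiE UNIV_I imageE)
  then obtain h where "\<phi> = (\<lambda>v. \<pi> (h v))" by metis
  then show "nc_eval R \<phi> (standard_poly d) = \<zero>\<^bsub>R\<^esub>"
    using assms[of h] by (simp only: hom_nc_eval standard_poly_eval) (simp add: ker_def)
qed

lemma preimage_zero: "additive_subgroup I R \<Longrightarrow> ker \<subseteq> \<pi> -` I"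
  unfolding ker_def by (auto simp: additive_subgroup.zero_closed)

lemma image_preimage: "additive_subgroup I R \<Longrightarrow> \<pi> ` (\<pi> -` I) = I"
  by (simp add: image_vimage_eq surj inf.absorb1 additive_subgroup.a_subset)

lemma simple_ringI:
  assumes "1 \<notin> ker"
    and simple: "\<And>I f. two_sided I \<Longrightarrow> ker \<subseteq> I \<Longrightarrow> f \<in> I \<Longrightarrow> f \<notin> ker \<Longrightarrow> 1 \<in> I"
  shows "simple_ring R"
  unfolding simple_ring_def
proof (intro conjI allI impI ring_R)
  show "\<one>\<^bsub>R\<^esub> \<noteq> \<zero>\<^bsub>R\<^esub>" using assms(1) by (simp add: ker_def hom_one)
  fix I assume "ideal I R"
  then interpret I: ideal I R .
  have add: "additive_subgroup I R" by (rule I.additive_subgroup_axioms)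
  have two: "two_sided (\<pi> -` I)"
    by unfold_locales (auto simp: hom_zero hom_add hom_mult closed I.I_l_closed I.I_r_closed)
  show "I = {\<zero>\<^bsub>R\<^esub>} \<or> I = carrier R"
  proof (cases "\<pi> -` I \<subseteq> ker")
    case True
    have "b = \<zero>\<^bsub>R\<^esub>" if "b \<in> I" for b
    proof -
      have "b \<in> \<pi> ` (\<pi> -` I)" using that image_preimage[OF add] by simp
      then obtain a where "b = \<pi> a" "a \<in> \<pi> -` I" by (rule imageE)
      with True show ?thesis by (auto simp: ker_def)
    qed
    then have "I = {\<zero>\<^bsub>R\<^esub>}" using I.zero_closed by (intro equalityI subsetI) auto
    then show ?thesis ..
  next
    case False
    then obtain f where "f \<in> \<pi> -` I" "f \<notin> ker" by (auto simp: subset_iff)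
    with simple[OF two preimage_zero[OF add]] have "1 \<in> \<pi> -` I" .
    then show ?thesis using I.one_imp_carrier by (simp add: hom_one)
  qed
qed

lemma nc_domainI:
  assumes "1 \<notin> ker" "\<And>a b. a * b \<in> ker \<Longrightarrow> a \<in> ker \<or> b \<in> ker"
  shows "nc_domain R"
  unfolding nc_domain_def
proof (intro conjI ballI impI ring_R)
  show "\<one>\<^bsub>R\<^esub> \<noteq> \<zero>\<^bsub>R\<^esub>" using assms(1) by (simp add: ker_def hom_one)
  fix a b assume "a \<in> carrier R" "b \<in> carrier R" "a \<otimes>\<^bsub>R\<^esub> b = \<zero>\<^bsub>R\<^esub>"
  moreover from this obtain a' b' where "a = \<pi> a'" "b = \<pi> b'" using surj by blast
  ultimately show "a = \<zero>\<^bsub>R\<^esub> \<or> b = \<zero>\<^bsub>R\<^esub>"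
    using assms(2)[of a' b'] by (simp add: ker_def hom_mult)
qed

lemma ideal_image:
  assumes "two_sided I"
  shows "ideal (\<pi> ` I) R"
proof -
  interpret I: two_sided I by fact
  have "subgroup (\<pi> ` I) (add_monoid R)"
  proof (rule R.add.subgroupI)
    show "\<pi> ` I \<noteq> {}" using I.zero_mem by blast
    fix a assume "a \<in> \<pi> ` I"
    then show "\<ominus>\<^bsub>R\<^esub> a \<in> \<pi> ` I"
      using I.uminus_mem by (force simp flip: hom_uminus)
    fix b assume "b \<in> \<pi> ` I"
    with \<open>a \<in> \<pi> ` I\<close> show "a \<oplus>\<^bsub>R\<^esub> b \<in> \<pi> ` I"
      using I.add_mem by (force simp flip: hom_add)
  qed (use closed in auto)
  moreover have "b \<otimes>\<^bsub>R\<^esub> a \<in> \<pi> ` I \<and> a \<otimes>\<^bsub>R\<^esub> b \<in> \<pi> ` I"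
    if ab: "a \<in> \<pi> ` I" "b \<in> carrier R" for a b
  proof -
    obtain a' where "a' \<in> I" "a = \<pi> a'" using ab(1) by auto
    moreover obtain b' where "b = \<pi> b'" using ab(2) surj by blast
    ultimately show ?thesis using I.lmult_mem I.rmult_mem by (simp flip: hom_mult)
  qed
  ultimately show ?thesis by (intro idealI ring_R) simp_all
qed

lemma vimage_image:
  assumes "two_sided I" "ker \<subseteq> I"
  shows "\<pi> -` (\<pi> ` I) = I"
proof (intro equalityI subsetI)
  fix a assume "a \<in> \<pi> -` (\<pi> ` I)"
  then obtain b where b: "b \<in> I" "\<pi> a = \<pi> b" by auto
  then have "a - b \<in> I" using eq_iff assms(2) by blast
  from two_sided.add_mem[OF assms(1) this b(1)] show "a \<in> I" by simp
qed auto

lemma chain_transfer: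
  assumes "\<And>n. additive_subgroup (I n) R" "\<exists>N. \<forall>n\<ge>N. \<pi> -` I n = \<pi> -` I N"
  shows "\<exists>N. \<forall>n\<ge>N. I n = I N"
proof -
  obtain N where "\<forall>n\<ge>N. \<pi> -` I n = \<pi> -` I N" using assms(2) by blast
  then have "\<forall>n\<ge>N. \<pi> ` (\<pi> -` I n) = \<pi> ` (\<pi> -` I N)" by simp
  then show ?thesis using image_preimage[OF assms(1)] by auto
qed

lemma left_noetherianI:
  assumes "acc_over ker UNIV"
  shows "left_noetherian R"
  unfolding left_noetherian_def
proof (intro conjI allI impI ring_R)
  fix I :: "nat \<Rightarrow> 'b set" assume I: "\<forall>n. left_ideal (I n) R \<and> I n \<subseteq> I (Suc n)"
  then have add: "additive_subgroup (I n) R" for n by (simp add: left_ideal_def)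
  have "left_submodule UNIV (\<pi> -` I n)" for n
    using I add closed unfolding left_submodule_def left_ideal_def
    by (auto simp: hom_zero hom_add hom_mult additive_subgroup.zero_closed additive_subgroup.a_closed)
  moreover have "\<pi> -` I n \<subseteq> \<pi> -` I (Suc n)" for n using I by blast
  ultimately show "\<exists>N. \<forall>n\<ge>N. I n = I N"
    using assms preimage_zero[OF add] unfolding acc_over_def
    by (intro chain_transfer[OF add]) (elim allE[of _ "\<lambda>n. \<pi> -` I n"], blast)
qed

lemma right_noetherianI:
  assumes "right_acc_over ker UNIV"
  shows "right_noetherian R"
  unfolding right_noetherian_def
proof (intro conjI allI impI ring_R)
  fix I :: "nat \<Rightarrow> 'b set" assume I: "\<forall>n. right_ideal (I n) R \<and> I n \<subseteq> I (Suc n)"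
  then have add: "additive_subgroup (I n) R" for n by (simp add: right_ideal_def)
  have "ring_1.left_submodule (\<lambda>a b. b * a) (+) 0 UNIV (\<pi> -` I n)" for n
    using I add closed unfolding ring_1.left_submodule_def[OF opposite_ring] right_ideal_def
    by (auto simp: hom_zero hom_add hom_mult additive_subgroup.zero_closed additive_subgroup.a_closed)
  moreover have "\<pi> -` I n \<subseteq> \<pi> -` I (Suc n)" for n using I by blast
  ultimately show "\<exists>N. \<forall>n\<ge>N. I n = I N"
    using assms preimage_zero[OF add] unfolding ring_1.acc_over_def[OF opposite_ring]
    by (intro chain_transfer[OF add]) (elim allE[of _ "\<lambda>n. \<pi> -` I n"], blast)
qed

end

lemma type_algebra_simps:
  "\<zero>\<^bsub>ring_of_type_algebra\<^esub> = 0" "\<one>\<^bsub>ring_of_type_algebra\<^esub> = 1"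
  "a \<oplus>\<^bsub>ring_of_type_algebra\<^esub> b = a + b" "a \<otimes>\<^bsub>ring_of_type_algebra\<^esub> b = a * b"
  "carrier ring_of_type_algebra = UNIV"
  by (simp_all add: ring_of_type_algebra_def)

lemma ideal_iff_two_sided:
  "ideal I (ring_of_type_algebra :: 'a::ring_1 ring) \<longleftrightarrow> two_sided I"
proof
  assume "ideal I (ring_of_type_algebra :: 'a ring)"
  then interpret I: ideal I "ring_of_type_algebra :: 'a ring" .
  have "0 \<in> I" using additive_subgroup.zero_closed[OF I.additive_subgroup_axioms] by (simp only: type_algebra_simps)
  moreover have "a + b \<in> I" if "a \<in> I" "b \<in> I" for a b
    using additive_subgroup.a_closed[OF I.additive_subgroup_axioms that] by (simp only: type_algebra_simps)
  ultimately show "two_sided I"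
    using I.I_l_closed I.I_r_closed by unfold_locales (auto simp: ring_of_type_algebra_def)
next
  assume "two_sided I"
  then interpret I: two_sided I .
  have "subgroup I (add_monoid (ring_of_type_algebra :: 'a ring))"
  proof (rule group.subgroupI)
    show "group (add_monoid (ring_of_type_algebra :: 'a ring))"
      using ring.is_abelian_group[OF ring_ring_of_type_algebra] abelian_group.a_group by blast
    show "I \<noteq> {}" using I.zero_mem by blast
    fix a assume a: "a \<in> I"
    have "inv\<^bsub>add_monoid (ring_of_type_algebra :: 'a ring)\<^esub> a = - a"
    proof (rule group.inv_equality)
      show "group (add_monoid (ring_of_type_algebra :: 'a ring))"
        using ring.is_abelian_group[OF ring_ring_of_type_algebra] abelian_group.a_group by blast
    qed (auto simp: ring_of_type_algebra_def)
    then show "inv\<^bsub>add_monoid (ring_of_type_algebra :: 'a ring)\<^esub> a \<in> I"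
      using I.uminus_mem[OF a] by simp
  qed (auto simp: ring_of_type_algebra_def I.add_mem)
  then show "ideal I (ring_of_type_algebra :: 'a ring)"
    by (intro idealI ring_ring_of_type_algebra)
      (auto simp: ring_of_type_algebra_def I.lmult_mem I.rmult_mem)
qed

text \<open>
  Iterating this for the two quotients shows that \<open>A\<close> is a single quotient of the free algebra.
\<close>

lemma quotient_map_Quot:
  assumes "ideal I R" "quotient_map R \<pi>"
  shows "quotient_map (R Quot I) (\<lambda>a. I +>\<^bsub>R\<^esub> \<pi> a)"
    and "quotient_map.ker (R Quot I) (\<lambda>a. I +>\<^bsub>R\<^esub> \<pi> a) = \<pi> -` I"
proof -
  interpret I: ideal I R by fact
  interpret q: quotient_map R \<pi> by fact
  have "(\<lambda>a. I +>\<^bsub>R\<^esub> \<pi> a) \<in> ring_hom ring_of_type_algebra (R Quot I)"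
    using ring_hom_trans[OF q.hom I.rcos_ring_hom] by (simp add: comp_def)
  moreover have "(\<lambda>a. I +>\<^bsub>R\<^esub> \<pi> a) ` UNIV = carrier (R Quot I)"
  proof -
    have "carrier (R Quot I) = (\<lambda>b. I +>\<^bsub>R\<^esub> b) ` \<pi> ` UNIV"
      unfolding q.surj by (auto simp: FactRing_simps)
    then show ?thesis by (simp only: image_image)
  qed
  ultimately show *: "quotient_map (R Quot I) (\<lambda>a. I +>\<^bsub>R\<^esub> \<pi> a)"
    using I.quotient_is_ring by (intro quotient_map.intro)
  have "I +>\<^bsub>R\<^esub> \<pi> a = I \<longleftrightarrow> \<pi> a \<in> I" for a
    using I.a_rcos_const I.a_rcos_self q.closed by metis
  moreover have "\<zero>\<^bsub>R Quot I\<^esub> = I" by (simp add: FactRing_def)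
  ultimately show "quotient_map.ker (R Quot I) (\<lambda>a. I +>\<^bsub>R\<^esub> \<pi> a) = \<pi> -` I"
    unfolding quotient_map.ker_def[OF *] by auto
qed

section \<open>Noetherianity of the quotients\<close>

context weyl_relations
begin

text \<open>
  This set generates the subring of all elements that are congruent to a scalar. The tower
  of subrings that adjoins \<open>z\<close>, \<open>x\<close> and \<open>y\<close> one after the other starts here.
\<close>

definition scalars :: "(xyz, 'k) free_alg set"
  where "scalars = K \<union> range (\<lambda>c. c \<bullet> 1)"

lemma two_sided_set_K: "two_sided_set K"
  by (auto simp: two_sided_set_def zero_mem add_mem lmult_mem rmult_mem)

lemma scalars_gen:
  assumes "a \<in> subring_gen scalars"
  shows "\<exists>c. a - c \<bullet> 1 \<in> K"
proof -
  define S where "S = {a. \<exists>c. a - c \<bullet> 1 \<in> K}"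
  have "is_subring S"
    unfolding is_subring_def S_def
  proof (intro conjI ballI CollectI)
    show "\<exists>c. 0 - c \<bullet> 1 \<in> K" by (rule exI[of _ 0]) (simp add: zero_mem)
    show "\<exists>c. 1 - c \<bullet> 1 \<in> K" by (rule exI[of _ 1]) (simp add: zero_mem)
    fix a assume "a \<in> {a. \<exists>c. a - c \<bullet> 1 \<in> K}"
    then obtain c where c: "a - c \<bullet> 1 \<in> K" by blast
    show "\<exists>c. - a - c \<bullet> 1 \<in> K"
      using uminus_mem[OF c] by (intro exI[of _ "- c"]) (simp flip: minus_smul)
    fix b assume "b \<in> {a. \<exists>c. a - c \<bullet> 1 \<in> K}"
    then obtain d where d: "b - d \<bullet> 1 \<in> K" by blast
    show "\<exists>c. a + b - c \<bullet> 1 \<in> K"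
      using add_mem[OF c d] by (intro exI[of _ "c + d"]) (simp add: add_smul algebra_simps)
    have "a * b \<doteq> c \<bullet> 1 * (d \<bullet> 1)"
      using c d by (intro eqv_mult) (simp_all add: eqv_def)
    then show "\<exists>c. a * b - c \<bullet> 1 \<in> K"
      by (intro exI[of _ "d * c"]) (simp add: eqv_def)
  qed
  moreover have "scalars \<subseteq> S"
  proof
    fix a assume "a \<in> scalars"
    then consider "a \<in> K" | c where "a = c \<bullet> 1" unfolding scalars_def by blast
    then show "a \<in> S"
    proof cases
      case 1
      then show ?thesis unfolding S_def by (auto intro!: exI[of _ 0])
    next
      case (2 c)
      then show ?thesis unfolding S_def by (auto intro!: exI[of _ c] simp: zero_mem)
    qed
  qed
  ultimately show ?thesis using assms subring_gen_minimal unfolding S_def by blast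
qed

lemma acc_scalars: "acc_over K (subring_gen scalars)" "right_acc_over K (subring_gen scalars)"
proof -
  have inv: "\<exists>b\<in>subring_gen scalars. b * a - 1 \<in> K \<and> a * b - 1 \<in> K"
    if a: "a \<in> subring_gen scalars" "a \<notin> K" for a
  proof -
    obtain c where c: "a - c \<bullet> 1 \<in> K" using scalars_gen[OF a(1)] by blast
    have "c \<noteq> 0" using c a(2) by auto
    have "inverse c \<bullet> 1 \<in> subring_gen scalars"
      using subring_gen_subset[of scalars] unfolding scalars_def by blast
    moreover have "inverse c \<bullet> a - 1 \<in> K"
      using smul_mem[OF c, of "inverse c"] \<open>c \<noteq> 0\<close> by (simp add: smul_diff)
    ultimately show ?thesis by (intro bexI[of _ "inverse c \<bullet> 1"]) simp_all
  qed
  show "acc_over K (subring_gen scalars)"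
    using inv by (intro acc_over_division is_subring_gen) blast
  show "right_acc_over K (subring_gen scalars)"
    using inv by (intro ring_1.acc_over_division[OF opposite_ring, unfolded opposite_is_subring] is_subring_gen) blast
qed

lemma almost_normalI:
  assumes "is_subring S" "K \<subseteq> S" "range (\<lambda>c. c \<bullet> 1) \<subseteq> S" "b \<in> S"
    and "v * a - (c \<bullet> b) * v \<in> S" "a * v - v * (d \<bullet> b) \<in> S"
  shows "almost_normal v S a"
proof -
  have "e \<bullet> b \<in> S" for e
  proof -
    have "e \<bullet> 1 * b \<in> S" using assms(1,3,4) unfolding is_subring_def by blast
    then show ?thesis by simp
  qed
  with assms(5,6) show ?thesis unfolding almost_normal_def by blast
qed

lemma almost_normal_scalars:
  assumes "scalars \<subseteq> G" "a \<in> scalars"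
  shows "almost_normal v (subring_gen G) a"
proof -
  let ?S = "subring_gen G"
  have S: "is_subring ?S" "K \<subseteq> ?S" "range (\<lambda>c. c \<bullet> 1) \<subseteq> ?S" "0 \<in> ?S" "1 \<in> ?S"
    using is_subring_gen[of G] subring_gen_subset[of G] assms(1)
    unfolding scalars_def is_subring_def by blast+
  show ?thesis
  proof (cases "a \<in> K")
    case True
    then have "v * a \<in> ?S" "a * v \<in> ?S" using lmult_mem rmult_mem S(2) by blast+
    then show ?thesis by (intro almost_normalI[OF S(1-4), of _ _ 0 0]) simp_all
  next
    case False
    then obtain c where "a = c \<bullet> 1" using assms(2) unfolding scalars_def by blast
    then show ?thesis using S by (intro almost_normalI[OF S(1-3,5), of _ _ c c]) simp_all
  qed
qed

text \<open>
  Each step of the tower adjoins one generator that commutes with the previous ones up to scalars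
  and lower terms: \<open>x * z = p \<bullet> (z * x)\<close>, \<open>y * z = inverse p \<bullet> (z * y)\<close> and \<open>y * x = q \<bullet> (x * y) + z\<close>.
\<close>

lemma noetherian: "acc_over K UNIV" "right_acc_over K UNIV"
proof -
  have K: "K \<subseteq> subring_gen G" if "scalars \<subseteq> G" for G
    using subring_gen_subset[of G] that unfolding scalars_def by blast
  have sc: "range (\<lambda>c. c \<bullet> 1) \<subseteq> subring_gen G" if "scalars \<subseteq> G" for G
    using subring_gen_subset[of G] that unfolding scalars_def by blast
  let ?Z = "insert z scalars"
  let ?X = "insert x ?Z"
  let ?Y = "insert y ?X"
  have z: "almost_normal z (subring_gen scalars) a" if "a \<in> scalars" for a
    by (rule almost_normal_scalars[OF order_refl that])
  have x: "almost_normal x (subring_gen ?Z) a" if "a \<in> ?Z" for a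
  proof (cases "a = z")
    case True
    have sub: "scalars \<subseteq> ?Z" by blast
    have "z \<in> subring_gen ?Z" using subring_gen_subset[of ?Z] by blast
    from almost_normalI[OF is_subring_gen K[OF sub] sc[OF sub] this, of x z p "inverse p"]
    show ?thesis using xz zx K[OF sub] True unfolding eqv_def by auto
  next
    case False
    then show ?thesis using that by (intro almost_normal_scalars) auto
  qed
  have y: "almost_normal y (subring_gen ?X) a" if "a \<in> ?X" for a
  proof -
    have sub: "scalars \<subseteq> ?X" by blast
    let ?S = "subring_gen ?X"
    note S = is_subring_gen[of ?X]
    have gens: "z \<in> ?S" "x \<in> ?S" using subring_gen_subset[of ?X] by blast+
    note almost = almost_normalI[OF S K[OF sub] sc[OF sub]]
    consider "a = z" | "a = x" | "a \<in> scalars" using \<open>a \<in> ?X\<close> by blast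
    then show ?thesis
    proof cases
      case 1
      then show ?thesis
        using almost[OF gens(1), of y z "inverse p" p] yz zy K[OF sub] unfolding eqv_def by auto
    next
      case 2
      have "y * x - q \<bullet> (x * y) - z + z \<in> ?S"
        using rel_yx K[OF sub] gens(1) S unfolding is_subring_def by blast
      then have 1: "y * x - q \<bullet> (x * y) \<in> ?S" by simp
      have "(- inverse q) \<bullet> 1 \<in> ?S" using sc[OF sub] by blast
      with 1 have "(- inverse q) \<bullet> 1 * (y * x - q \<bullet> (x * y)) \<in> ?S"
        using S unfolding is_subring_def by blast
      then have "x * y - inverse q \<bullet> (y * x) \<in> ?S"
        using q0 by (simp add: smul_diff minus_smul[symmetric] flip: minus_smul)
      with 1 show ?thesis using almost[OF gens(2), of y x q "inverse q"] 2 by simp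
    next
      case 3
      then show ?thesis by (intro almost_normal_scalars) auto
    qed
  qed
  have UNIV: "subring_gen ?Y = UNIV"
  proof (intro equalityI subsetI)
    fix a :: "(xyz, 'k) free_alg"
    have S: "is_subring (subring_gen ?Y)" by (rule is_subring_gen)
    note closed = S[unfolded is_subring_def]
    have sub: "?Y \<subseteq> subring_gen ?Y" by (rule subring_gen_subset)
    show "a \<in> subring_gen ?Y"
    proof (induction a rule: free_alg_induct)
      case (gen v f)
      have "gen v \<in> subring_gen ?Y" using sub by (cases v) auto
      with gen closed show ?case by blast
    next
      case (smul c f)
      have "c \<bullet> 1 \<in> subring_gen ?Y" using sc[of ?Y] by blast
      with smul closed have "c \<bullet> 1 * f \<in> subring_gen ?Y" by blast
      then show ?case by simp
    qed (use closed in auto)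
  qed simp
  have KZ: "K \<subseteq> subring_gen scalars" "K \<subseteq> subring_gen ?Z" "K \<subseteq> subring_gen ?X" by (rule K; blast)+
  show "acc_over K UNIV"
    unfolding UNIV[symmetric]
    by (intro acc_over_adjoin(1) two_sided_set_K KZ x y z acc_scalars)
  show "right_acc_over K UNIV"
    unfolding UNIV[symmetric]
    by (intro acc_over_adjoin(2) two_sided_set_K KZ x y z acc_scalars)
qed

lemma Omega_central:
  assumes "q ^ r = p ^ s"
  shows "central (w ^ r * z ^ s)"
proof (rule central_gens)
  have "q ^ r * inverse p ^ s = 1" "inverse q ^ r * p ^ s = 1"
    using assms p0 q0 by (simp_all add: power_inverse)
  then have "w ^ r * z ^ s * x \<doteq> x * (w ^ r * z ^ s)" "w ^ r * z ^ s * y \<doteq> y * (w ^ r * z ^ s)"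
    using qcommute_mult_left[OF qcommute_power_left[OF wx] qcommute_power_left[OF zx], of r s]
      qcommute_mult_left[OF qcommute_power_left[OF wy] qcommute_power_left[OF zy], of r s] by simp_all
  moreover have "w ^ r * z ^ s * z \<doteq> z * (w ^ r * z ^ s)"
    using qcommute_mult_left[OF qcommute_power_left[of w z 1 r] qcommute_power_left[of z z 1 s]] wz by simp
  ultimately show "w ^ r * z ^ s * gen v \<doteq> gen v * (w ^ r * z ^ s)" for v
    by (cases v) simp_all
qed

end

text \<open>
  Factors on the left pass through the central element \<open>c\<close> at the cost of an element of \<open>K\<close>.
\<close>

lemma (in two_sided) two_sided_adjoin_central:
  assumes "central c"
  shows "two_sided {f. \<exists>h. f - c * h \<in> K}"
proof
  show "0 \<in> {f. \<exists>h. f - c * h \<in> K}" by (auto intro: exI[of _ 0] simp: zero_mem)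
next
  fix a b assume "a \<in> {f. \<exists>h. f - c * h \<in> K}" "b \<in> {f. \<exists>h. f - c * h \<in> K}"
  then obtain h h' where "a - c * h \<in> K" "b - c * h' \<in> K" by blast
  from add_mem[OF this] have "a + b - c * (h + h') \<in> K" by (simp add: algebra_simps)
  then show "a + b \<in> {f. \<exists>h. f - c * h \<in> K}" by blast
next
  fix a b assume "a \<in> {f. \<exists>h. f - c * h \<in> K}"
  then obtain h where h: "a - c * h \<in> K" by blast
  have "(a - c * h) * b \<in> K" by (rule rmult_mem[OF h])
  then have "a * b - c * (h * b) \<in> K" by (simp add: algebra_simps)
  then show "a * b \<in> {f. \<exists>h. f - c * h \<in> K}" by blast
  have "c * b - b * c \<in> K"
    using assms by (simp add: central_def eqv_def)
  then have "b * (a - c * h) - (c * b - b * c) * h \<in> K"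
    by (intro diff_mem[OF lmult_mem[OF h] rmult_mem])
  then have "b * a - c * (b * h) \<in> K" by (simp add: algebra_simps)
  then show "b * a \<in> {f. \<exists>h. f - c * h \<in> K}" by blast
qed

section \<open>The relations in the representation\<close>

lemma (in linear_action) alg_act_gen_single: "alg_act A (gen a) v = A a v"
  using alg_act_gen[of a 1 v] by (simp add: alg_act_one)

text \<open>
  The constants \<open>\<alpha>\<close> and \<open>\<beta>\<close> are the coefficients in \<open>y * x = \<alpha> \<bullet> w + \<beta> \<bullet> z\<close>. The element \<open>w\<close> then acts as
  multiplication by \<open>t ^ (- s)\<close>.
\<close>

lemma (in difference_operators) act_relations:
  assumes p: "\<mu> ^ r = p" and q: "\<mu> ^ s = q" and pq: "p * q \<noteq> 1"
    and \<alpha>: "\<alpha> = q * inverse (q - inverse p)" and \<beta>: "\<beta> = - inverse p * inverse (q - inverse p)"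
  shows "H_relations p q \<subseteq> {f. \<forall>v k. alg_act diff_op f v k = 0}"
    and "alg_act diff_op (fy * fx - inverse p \<bullet> (fx * fy)) v k = v (k + int s)"
proof -
  have p0: "p \<noteq> 0" and q0: "q \<noteq> 0" using nonzero p q by auto
  have D: "q - inverse p \<noteq> 0" using pq p0 by (auto simp: field_simps)
  have powi: "\<mu> powi (k + int s) = \<mu> powi k * q" "\<mu> powi (k - int r) = \<mu> powi k * inverse p" for k
    using nonzero p q by (simp_all add: power_int_add power_int_diff field_simps)
  have nz: "\<mu> powi k \<noteq> 0" for k using nonzero by simp
  note act = alg_act_mult alg_act_gen_single alg_act_diff alg_act_smul diff_op.simps powi power_int_minus
  have zx: "alg_act diff_op (fz * fx - inverse p \<bullet> (fx * fz)) v k = 0" for v k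
    by (simp add: act)
  have "\<mu> powi (- (m - int r)) = p * \<mu> powi (- m)" for m
    using power_int_add[of \<mu> "int r" "- m"] nonzero p by simp
  from this[of "k + int s" for k] this[of "k - int r" for k] have shift: "\<mu> powi (- (k - int r + int s)) = p * \<mu> powi (- (k + int s))"
    "\<mu> powi (- (k - int r - int r)) = p * \<mu> powi (- (k - int r))" for k
    by (simp_all add: algebra_simps)
  have zy: "alg_act diff_op (fz * fy - p \<bullet> (fy * fz)) v k = 0" for v k
    unfolding alg_act_mult alg_act_gen_single alg_act_diff alg_act_smul diff_op.simps shift
    by (simp add: algebra_simps)
  have cancel: "c * \<mu> powi (- m) * (\<mu> powi m * t) = c * t" for c m t
    using nz[of m] by (simp add: power_int_minus)
  have yx: "alg_act diff_op (fy * fx) v k = \<alpha> * v (k + int s) + \<beta> * v (k - int r)" for v k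
    by (simp only: alg_act_mult alg_act_gen_single diff_op.simps cancel)
  have xy: "alg_act diff_op (fx * fy) v k = \<alpha> * inverse q * v (k + int s) + \<beta> * p * v (k - int r)" for v k
  proof -
    have "\<mu> powi k * \<mu> powi (- (k + int s)) = inverse q" "\<mu> powi k * \<mu> powi (- (k - int r)) = p"
      using power_int_add[of \<mu> k "- (k + int s)"] power_int_add[of \<mu> k "- (k - int r)"] nonzero p q
      by (simp_all add: power_int_minus)
    moreover have "alg_act diff_op (fx * fy) v k = \<alpha> * (\<mu> powi k * \<mu> powi (- (k + int s))) * v (k + int s) +
        \<beta> * (\<mu> powi k * \<mu> powi (- (k - int r))) * v (k - int r)"
      by (simp add: alg_act_mult alg_act_gen_single algebra_simps)
    ultimately show ?thesis by simp
  qed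
  have coeffs: "\<beta> - q * \<beta> * p = 1" "\<alpha> - inverse p * \<alpha> * inverse q = 1"
  proof -
    define t where "t = inverse (q - inverse p)"
    have t: "t * q - t * inverse p = 1"
      using D by (simp add: t_def flip: right_diff_distrib)
    have "\<beta> - q * \<beta> * p = t * q * (p * inverse p) - t * inverse p"
      unfolding \<beta> t_def[symmetric] by (simp only: minus_mult_left[symmetric] mult_minus_right ac_simps) simp
    then show "\<beta> - q * \<beta> * p = 1" using t p0 by simp
    have "\<alpha> - inverse p * \<alpha> * inverse q = t * q - t * inverse p * (q * inverse q)"
      unfolding \<alpha> t_def[symmetric] by (simp only: ac_simps)
    then show "\<alpha> - inverse p * \<alpha> * inverse q = 1" using t q0 by simp
  qed
  have yxz: "alg_act diff_op (fy * fx - q \<bullet> (fx * fy) - fz) v k = 0" for v k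
  proof -
    have "alg_act diff_op (fy * fx - q \<bullet> (fx * fy) - fz) v k = (\<beta> - q * \<beta> * p) * v (k - int r) - v (k - int r)"
      unfolding alg_act_diff alg_act_smul yx xy alg_act_gen_single diff_op.simps
      using q0 by (simp add: algebra_simps)
    then show ?thesis by (simp add: coeffs)
  qed
  have "alg_act diff_op (fy * fx - inverse p \<bullet> (fx * fy)) v k = (\<alpha> - inverse p * \<alpha> * inverse q) * v (k + int s)"
    unfolding alg_act_diff alg_act_smul yx xy
    using p0 by (simp add: algebra_simps)
  then show "alg_act diff_op (fy * fx - inverse p \<bullet> (fx * fy)) v k = v (k + int s)"
    by (simp add: coeffs)
  show "H_relations p q \<subseteq> {f. \<forall>v k. alg_act diff_op f v k = 0}"
    using zx zy yxz by (auto simp: H_relations_def smul_def mult.assoc)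
qed

lemma (in linear_action) alg_act_power: "alg_act A (f ^ n) v = (alg_act A f ^^ n) v"
  by (induction n) (simp_all add: alg_act_one alg_act_mult)

lemma (in difference_operators) act_Omega:
  assumes "\<And>v k. alg_act diff_op u v k = v (k + int s)"
  shows "alg_act diff_op (u ^ r * fz ^ s) v k = v k"
proof -
  have "(alg_act diff_op u ^^ n) v = (\<lambda>k. v (k + int n * int s))" for n v
    by (induction n arbitrary: v) (auto simp: assms fun_eq_iff algebra_simps)
  moreover have "(alg_act diff_op fz ^^ n) v = (\<lambda>k. v (k - int n * int r))" for n v
    by (induction n arbitrary: v) (auto simp: alg_act_gen_single fun_eq_iff algebra_simps)
  ultimately show ?thesis by (simp add: alg_act_mult alg_act_power mult.commute)
qed

section \<open>Simple noetherian domains\<close>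

theorem theorem6p2:
  fixes p q :: "'k :: {alg_closed_field, field_char_0}" and r s :: nat
  assumes "uncountable (UNIV :: 'k set)"
    and "p \<noteq> 0" and "q \<noteq> 0"
    and "r > 0" and "s > 0" and "gcd r s = 1"
    and "q ^ r = p ^ s"
    and "p * q \<noteq> 1"
    and "\<not> PI_ring (H_alg p q)"
  shows "simple_ring (A_alg p q r s) \<and> nc_noetherian (A_alg p q r s) \<and> nc_domain (A_alg p q r s)"
proof -
  define K where "K = H_ideal p q"
  have rel_carrier: "H_relations p q \<subseteq> carrier ring_of_type_algebra"
    by (simp add: type_algebra_simps)
  interpret K: two_sided K
    using ideal_H_ideal[of p q] by (simp add: K_def ideal_iff_two_sided)
  interpret K: weyl_relations K p q
    using assms(2,3,8) ring.genideal_self[OF ring_ring_of_type_algebra rel_carrier]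
    by unfold_locales (auto simp: K_def H_ideal_def)
  have id_map: "quotient_map (ring_of_type_algebra :: (xyz, 'k) free_alg ring) (\<lambda>a. a)"
    by (intro quotient_map.intro ring_ring_of_type_algebra)
      (auto simp: type_algebra_simps ring_hom_def)
  define \<pi> where "\<pi> = (\<lambda>a. K +>\<^bsub>ring_of_type_algebra\<^esub> a)"
  interpret H: quotient_map "H_alg p q" \<pi>
    using quotient_map_Quot(1)[OF ideal_H_ideal id_map] by (simp add: H_alg_def \<pi>_def K_def)
  have kerH: "H.ker = K"
    using quotient_map_Quot(2)[OF ideal_H_ideal[of p q] id_map] by (simp add: H_alg_def \<pi>_def K_def)

  \<comment> \<open>The exponent \<open>r * n\<close> serves \<open>q\<close> as well, because \<open>q ^ (r * n) = p ^ (s * n)\<close>.\<close>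
  have p_free: "p ^ n \<noteq> 1" if "n > 0" for n
  proof
    assume n: "p ^ n = 1"
    have "p ^ (r * n) = 1" by (metis n mult.commute power_mult power_one)
    moreover have "q ^ (r * n) = 1" by (metis assms(7) n mult.commute power_mult power_one)
    moreover have "r * n > 0" using that assms(4) by simp
    ultimately have "standard_sum (Suc (card (K.basis (r * n)))) h \<in> H.ker" for h
      unfolding kerH by (intro K.standard_identity_root_of_unity) simp_all
    then have "PI_ring (H_alg p q)" by (rule H.PI_ringI)
    with assms(9) show False ..
  qed

  define \<Omega> where "\<Omega> = K.w ^ r * fz ^ s"
  define J where "J = {f. \<exists>h. f - (\<Omega> - 1) * h \<in> K}"
  have "K.central \<Omega>" using K.Omega_central[OF assms(7)] by (simp add: \<Omega>_def)
  then have "K.central (\<Omega> - 1)"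
    by (auto simp: K.central_def left_diff_distrib right_diff_distrib intro: K.eqv_diff)
  then interpret J: two_sided J
    unfolding J_def by (rule K.two_sided_adjoin_central)
  have KJ: "K \<subseteq> J" unfolding J_def by (auto intro: exI[of _ 0])
  interpret J: weyl_torus J p q r s
  proof
    show "H_relations p q \<subseteq> J" using K.relations KJ by blast
    have "\<Omega> - 1 - (\<Omega> - 1) * 1 \<in> K" by (simp add: K.zero_mem)
    then have "\<Omega> - 1 \<in> J" unfolding J_def by blast
    then show "J.eqv (K.w ^ r * fz ^ s) 1" unfolding J.eqv_def \<Omega>_def .
    show "coprime r s" using assms(6) by (simp only: coprime_iff_gcd_eq_1)
  qed (use assms p_free in auto)

  have \<pi>J: "\<pi> ` J = (Omega p q r s \<ominus>\<^bsub>H_alg p q\<^esub> \<one>\<^bsub>H_alg p q\<^esub>) <#\<^bsub>H_alg p q\<^esub> carrier (H_alg p q)"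
  proof -
    have "Omega p q r s = \<pi> \<Omega>"
      by (simp add: Omega_def \<pi>_def K_def \<Omega>_def K.w_def smul_def mult.assoc)
    then have "Omega p q r s \<ominus>\<^bsub>H_alg p q\<^esub> \<one>\<^bsub>H_alg p q\<^esub> = \<pi> (\<Omega> - 1)"
      by (simp add: H.hom_diff H.hom_one)
    then have "(Omega p q r s \<ominus>\<^bsub>H_alg p q\<^esub> \<one>\<^bsub>H_alg p q\<^esub>) <#\<^bsub>H_alg p q\<^esub> carrier (H_alg p q) =
        range (\<lambda>h. \<pi> ((\<Omega> - 1) * h))"
      by (auto simp: l_coset_def H.surj[symmetric] H.hom_mult)
    also have "\<dots> = \<pi> ` J"
    proof (intro equalityI subsetI)
      fix a assume "a \<in> range (\<lambda>h. \<pi> ((\<Omega> - 1) * h))"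
      then obtain h where "a = \<pi> ((\<Omega> - 1) * h)" by blast
      moreover have "(\<Omega> - 1) * h \<in> J" unfolding J_def by (auto intro!: exI[of _ h] simp: K.zero_mem)
      ultimately show "a \<in> \<pi> ` J" by blast
    next
      fix a assume "a \<in> \<pi> ` J"
      then obtain f h where "a = \<pi> f" "f - (\<Omega> - 1) * h \<in> K" unfolding J_def by blast
      then have "a = \<pi> ((\<Omega> - 1) * h)" using H.eq_iff kerH by simp
      then show "a \<in> range (\<lambda>h. \<pi> ((\<Omega> - 1) * h))" by blast
    qed
    finally show ?thesis ..
  qed
  have A: "A_alg p q r s = H_alg p q Quot (\<pi> ` J)" by (simp add: A_alg_def \<pi>J)
  define \<psi> where "\<psi> = (\<lambda>a. \<pi> ` J +>\<^bsub>H_alg p q\<^esub> \<pi> a)"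
  interpret A: quotient_map "A_alg p q r s" \<psi>
    unfolding A \<psi>_def
    by (rule quotient_map_Quot(1)[OF H.ideal_image[OF J.two_sided_axioms] H.quotient_map_axioms])
  have kerA: "A.ker = J"
    using quotient_map_Quot(2)[OF H.ideal_image[OF J.two_sided_axioms] H.quotient_map_axioms]
      H.vimage_image[OF J.two_sided_axioms] KJ kerH
    by (simp add: A \<psi>_def)

  have simple: "1 \<in> I" if "two_sided I" "J \<subseteq> I" "f \<in> I" "f \<notin> J" for I f
    using weyl_torus_simple[OF J.weyl_torus_axioms that] .

  obtain d a b where "d dvd r" "d dvd s" "r * a = s * b + d"
    using bezout_add_strong_nat[of r s] assms(4) by auto
  moreover from this have "d = 1" using assms(6) by (metis gcd_greatest is_unit_gcd_iff nat_dvd_1_iff_1)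
  ultimately have ab: "r * a = s * b + 1" by simp
  \<comment> \<open>The dilation factor must satisfy \<open>\<mu> ^ r = p\<close> and \<open>\<mu> ^ s = q\<close>; Bezout coefficients solve both.\<close>
  define \<mu> where "\<mu> = p ^ a / q ^ b"
  have \<mu>r: "\<mu> ^ r = p"
  proof -
    have "\<mu> ^ r = p ^ (r * a) / (q ^ r) ^ b"
      by (simp add: \<mu>_def power_divide mult.commute flip: power_mult)
    also have "\<dots> = p" using assms(2) by (simp add: assms(7) ab flip: power_mult)
    finally show ?thesis .
  qed
  have \<mu>s: "\<mu> ^ s = q"
  proof -
    have "\<mu> ^ s = (p ^ s) ^ a / q ^ (s * b)"
      by (simp add: \<mu>_def power_divide mult.commute flip: power_mult)
    also have "\<dots> = q" using assms(3) by (simp add: ab flip: assms(7) power_mult)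
    finally show ?thesis .
  qed
  define \<alpha> where "\<alpha> = q * inverse (q - inverse p)"
  define \<beta> where "\<beta> = - inverse p * inverse (q - inverse p)"
  interpret D: difference_operators \<mu> \<alpha> \<beta> r s
  proof
    show "\<mu> \<noteq> 0" using assms(2,3) by (simp add: \<mu>_def)
    fix n :: nat assume "n > 0"
    then show "\<mu> ^ n \<noteq> 1" using p_free[of n] \<mu>r by (metis mult.commute power_mult power_one)
  qed
  define L where "L = {f. \<forall>v k. alg_act D.diff_op f v k = 0}"
  interpret L: two_sided L unfolding L_def by (rule D.two_sided_kernel)
  note act = D.act_relations[OF \<mu>r \<mu>s assms(8) \<alpha>_def \<beta>_def]
  have "K \<subseteq> L"
    unfolding K_def H_ideal_def
    using act(1) L.two_sided_axioms
    by (intro ring.genideal_minimal[OF ring_ring_of_type_algebra]) (simp_all add: ideal_iff_two_sided L_def)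
  moreover have "\<Omega> - 1 \<in> L"
    unfolding L_def \<Omega>_def K.w_def using D.act_Omega[OF act(2)] by (simp add: alg_act_diff alg_act_one)
  ultimately have JL: "J \<subseteq> L"
    unfolding J_def using L.rmult_mem L.add_mem by (auto, metis diff_add_cancel subsetD)
  have "alg_act D.diff_op 1 (\<lambda>k. 1) 0 \<noteq> 0" by (simp add: alg_act_one)
  then have one: "1 \<notin> L" unfolding L_def by blast
  \<comment> \<open>A proper ideal above \<open>J\<close> equals \<open>J\<close>, so the representation is faithful on \<open>A\<close>.\<close>
  have LJ: "L = J"
    using simple[OF L.two_sided_axioms JL] one JL by blast

  have "simple_ring (A_alg p q r s)"
    using one simple by (intro A.simple_ringI) (simp_all add: kerA LJ)
  moreover have "nc_domain (A_alg p q r s)"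
  proof (rule A.nc_domainI)
    show "1 \<notin> A.ker" using one by (simp add: kerA LJ)
    show "f \<in> A.ker \<or> h \<in> A.ker" if "f * h \<in> A.ker" for f h
      using that D.act_domain[of f _ _ h] unfolding kerA LJ[symmetric] L_def by blast
  qed
  moreover have "nc_noetherian (A_alg p q r s)"
    unfolding nc_noetherian_def
    using A.left_noetherianI A.right_noetherianI J.noetherian by (simp add: kerA)
  ultimately show ?thesis by blast
qed

end
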